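(* Let $k\ge 1$ be such that $\lambda_k<\lambda_{k+1}$, let $\lambda_k<\alpha<\lambda_{k+1}$, and let $\alpha\le\beta<\beta(\alpha)$. Let $f:\mathbb{R}\to\mathbb{R}$ be bounded and continuous and let $h\in L^2(\Omega)$. Then the problem $$-\mathcal{L}_K u=\alpha u^+-\beta u^-+f(u)+h\ \text{ in }\Omega,\qquad u=0\ \text{ on }\mathbb{R}^n\setminus\Omega,$$ has at least one weak solution $u\in X_0$.
   Context: Setting: $s\in(0,1)$, $n>2s$, $\Omega\subset\mathbb{R}^n$ is a bounded domain with Lipschitz boundary, and $u^\pm=\max\{\pm u,0\}$. The kernel $K:\mathbb{R}^n\setminus\{0\}\to(0,\infty)$ satisfies: $mK\in L^1(\mathbb{R}^n)$ with $m(x)=\min\{|x|^2,1\}$; there is $\lambda>0$ with $K(x)\ge\lambda|x|^{-(n+2s)}$; and $K(x)=K(-x)$. The operator is $\mathcal{L}_Ku(x)=\frac12\int_{\mathbb{R}^n}(u(x+y)+u(x-y)-2u(x))K(y)\,dy$. Spaces: $Q=\mathbb{R}^{2n}\setminus((\mathbb{R}^n\setminus\Omega)\times(\mathbb{R}^n\setminus\Omega))$. $X$ is the set of measurable $u:\mathbb{R}^n\to\mathbb{R}$ with $u|_\Omega\in L^2(\Omega)$ and $(u(x)-u(y))\sqrt{K(x-y)}\in L^2(Q)$. $X_0=\{u\in X: u=0\text{ a.e. in }\mathbb{R}^n\setminus\Omega\}$ is a Hilbert space with norm $\|u\|=\left(\int_Q|u(x)-u(y)|^2K(x-y)\,dx\,dy\right)^{1/2}$.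 $\|\cdot\|_{L^2}$ is the norm of $L^2(\Omega)$. Weak solution: $u\in X_0$ is a weak solution of $-\mathcal{L}_Ku=g$ in $\Omega$, $u=0$ on $\mathbb{R}^n\setminus\Omega$ (where $g$ may depend on $u$), if $\int_Q(u(x)-u(y))(v(x)-v(y))K(x-y)\,dx\,dy=\int_\Omega g\,v\,dx$ for all $v\in X_0$. Eigenvalues: $0<\lambda_1<\lambda_2\le\lambda_3\le\cdots$ are the eigenvalues (counted with multiplicity) of $-\mathcal{L}_Ku=\lambda u$ in $\Omega$, $u=0$ on $\mathbb{R}^n\setminus\Omega$ (in the weak sense above), with eigenfunctions $\phi_1,\phi_2,\dots$ forming an orthonormal basis of $L^2(\Omega)$ and an orthogonal basis of $X_0$. $X_1=\mathrm{span}\{\phi_1,\dots,\phi_k\}$ and $X_2=X_1^\perp$ in $X_0$. Definition of $\beta(\alpha)$: let $J_{\alpha,\beta}(u)=\frac12\left(\|u\|^2-\alpha\int_\Omega|u^+|^2-\beta\int_\Omega|u^-|^2\right)$ on $X_0$ and, for $\lambda_k<\alpha<\lambda_{k+1}$, $\beta\ge\alpha$, let $$m(\alpha,\beta)=\min_{v\in X_2,\ \|v\|_{L^2}=1}\ \max_{u\in X_1}J_{\alpha,\beta}(u+v).$$ When there is $\beta\ge\alpha$ with $m(\alpha,\beta)=0$, it is unique and greater than $\lambda_{k+1}$, and it is denoted $\beta(\alpha)$. The hypothesis $\alpha\le\beta<\beta(\alpha)$ is understood to include the existence of $\beta(\alpha)$. *)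

theory Defs
  imports "HOL-Analysis.Analysis"
begin

text \<open>
  Elements of the function spaces are represented by functions on the whole space, not by
  classes modulo null sets; every notion below is invariant under changes on null sets.
  All measures are (complete) Lebesgue measures; on pairs, \<open>lebesgue\<close> is the completed measure
  on the product space.
\<close>

definition pos_part :: "real \<Rightarrow> real" where
  "pos_part t = max t 0"

definition neg_part :: "real \<Rightarrow> real" where
  "neg_part t = max (- t) 0"

text \<open>
  Near each boundary point the set is, in the direction of a suitable unit vector \<open>e\<close>, the
  strict epigraph of a Lipschitz function \<open>g\<close> of the component orthogonal to \<open>e\<close>.
\<close>

definition lipschitz_boundary :: "(real^'n) set \<Rightarrow> bool" where
  "lipschitz_boundary \<Omega> \<longleftrightarrow>
     (\<forall>p\<in>frontier \<Omega>. \<exists>r>0. \<exists>e. norm e = 1 \<and>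
        (\<exists>g L. L-lipschitz_on {y. y \<bullet> e = 0} g \<and>
           \<Omega> \<inter> ball p r = {x \<in> ball p r. g (x - (x \<bullet> e) *\<^sub>R e) < x \<bullet> e}))"

definition bounded_lipschitz_domain :: "(real^'n) set \<Rightarrow> bool" where
  "bounded_lipschitz_domain \<Omega> \<longleftrightarrow>
     \<Omega> \<noteq> {} \<and> open \<Omega> \<and> connected \<Omega> \<and> bounded \<Omega> \<and> lipschitz_boundary \<Omega>"

text \<open>
  The kernel lives on the complement of the origin; its value at \<open>0\<close> is left unconstrained
  and never matters, since it only enters on the null set \<open>x = y\<close>.
\<close>

definition admissible_kernel :: "real \<Rightarrow> (real^'n \<Rightarrow> real) \<Rightarrow> bool" where
  "admissible_kernel s K \<longleftrightarrow>
     (\<forall>x. x \<noteq> 0 \<longrightarrow> K x > 0) \<and>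
     integrable lebesgue (\<lambda>x. min ((norm x)\<^sup>2) 1 * K x) \<and>
     (\<exists>c>0. \<forall>x. x \<noteq> 0 \<longrightarrow> K x \<ge> c * norm x powr (- (real CARD('n) + 2 * s))) \<and>
     (\<forall>x. x \<noteq> 0 \<longrightarrow> K (- x) = K x)"

definition L2_on :: "'a::euclidean_space set \<Rightarrow> ('a \<Rightarrow> real) \<Rightarrow> bool" where
  "L2_on S f \<longleftrightarrow>
     set_borel_measurable lebesgue S f \<and> set_integrable lebesgue S (\<lambda>x. (f x)\<^sup>2)"

definition inner_L2 :: "(real^'n) set \<Rightarrow> (real^'n \<Rightarrow> real) \<Rightarrow> (real^'n \<Rightarrow> real) \<Rightarrow> real" where
  "inner_L2 \<Omega> u v = set_lebesgue_integral lebesgue \<Omega> (\<lambda>x. u x * v x)"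

definition norm_L2 :: "(real^'n) set \<Rightarrow> (real^'n \<Rightarrow> real) \<Rightarrow> real" where
  "norm_L2 \<Omega> u = sqrt (inner_L2 \<Omega> u u)"

definition Q_set :: "(real^'n) set \<Rightarrow> ((real^'n) \<times> (real^'n)) set" where
  "Q_set \<Omega> = UNIV - (UNIV - \<Omega>) \<times> (UNIV - \<Omega>)"

definition space_X :: "(real^'n \<Rightarrow> real) \<Rightarrow> (real^'n) set \<Rightarrow> (real^'n \<Rightarrow> real) set" where
  "space_X K \<Omega> =
     {u \<in> borel_measurable lebesgue. L2_on \<Omega> u \<and>
        L2_on (Q_set \<Omega>) (\<lambda>(x, y). (u x - u y) * sqrt (K (x - y)))}"

definition space_X0 :: "(real^'n \<Rightarrow> real) \<Rightarrow> (real^'n) set \<Rightarrow> (real^'n \<Rightarrow> real) set" where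
  "space_X0 K \<Omega> = {u \<in> space_X K \<Omega>. AE x in lebesgue. x \<notin> \<Omega> \<longrightarrow> u x = 0}"

definition inner_X0 ::
  "(real^'n \<Rightarrow> real) \<Rightarrow> (real^'n) set \<Rightarrow> (real^'n \<Rightarrow> real) \<Rightarrow> (real^'n \<Rightarrow> real) \<Rightarrow> real" where
  "inner_X0 K \<Omega> u v =
     set_lebesgue_integral lebesgue (Q_set \<Omega>)
       (\<lambda>(x, y). (u x - u y) * (v x - v y) * K (x - y))"

definition norm_X0 :: "(real^'n \<Rightarrow> real) \<Rightarrow> (real^'n) set \<Rightarrow> (real^'n \<Rightarrow> real) \<Rightarrow> real" where
  "norm_X0 K \<Omega> u = sqrt (inner_X0 K \<Omega> u u)"

text \<open>
  Weak solutions of \<open>- \<L>\<^sub>K u = g\<close> in \<open>\<Omega>\<close>, \<open>u = 0\<close> outside \<open>\<Omega>\<close>. A right-hand side depending on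
  \<open>u\<close> is passed already composed with \<open>u\<close>.
\<close>

definition weak_solution ::
  "(real^'n \<Rightarrow> real) \<Rightarrow> (real^'n) set \<Rightarrow> (real^'n \<Rightarrow> real) \<Rightarrow> (real^'n \<Rightarrow> real) \<Rightarrow> bool" where
  "weak_solution K \<Omega> g u \<longleftrightarrow>
     u \<in> space_X0 K \<Omega> \<and>
     (\<forall>v\<in>space_X0 K \<Omega>. inner_X0 K \<Omega> u v = set_lebesgue_integral lebesgue \<Omega> (\<lambda>x. g x * v x))"

text \<open>Density of the finite linear combinations of \<open>\<phi> 1, \<phi> 2, \<dots>\<close> in \<open>V\<close>.\<close>

definition total_in ::
  "(real^'n \<Rightarrow> real) set \<Rightarrow> ((real^'n \<Rightarrow> real) \<Rightarrow> real) \<Rightarrow> (nat \<Rightarrow> real^'n \<Rightarrow> real) \<Rightarrow> bool" where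
  "total_in V N \<phi> \<longleftrightarrow>
     (\<forall>w\<in>V. \<forall>\<epsilon>>0. \<exists>m c. N (\<lambda>x. w x - (\<Sum>i=1..m. c i * \<phi> i x)) < \<epsilon>)"

text \<open>
  The eigenvalues \<open>\<lambda>\<^sub>1 < \<lambda>\<^sub>2 \<le> \<lambda>\<^sub>3 \<le> \<dots>\<close> with their eigenfunctions, indexed from \<open>1\<close> (index \<open>0\<close> is
  unused). That every eigenvalue is listed, as often as its multiplicity, is expressed by
  the eigenfunctions forming a basis.
\<close>

definition eigensystem ::
  "(real^'n \<Rightarrow> real) \<Rightarrow> (real^'n) set \<Rightarrow> (nat \<Rightarrow> real) \<Rightarrow> (nat \<Rightarrow> real^'n \<Rightarrow> real) \<Rightarrow> bool" where
  "eigensystem K \<Omega> ev \<phi> \<longleftrightarrow>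
     0 < ev 1 \<and> ev 1 < ev 2 \<and> (\<forall>i\<ge>2. ev i \<le> ev (Suc i)) \<and>
     (\<forall>i\<ge>1. weak_solution K \<Omega> (\<lambda>x. ev i * \<phi> i x) (\<phi> i)) \<and>
     (\<forall>i\<ge>1. \<forall>j\<ge>1. inner_L2 \<Omega> (\<phi> i) (\<phi> j) = (if i = j then 1 else 0)) \<and>
     total_in {w. L2_on \<Omega> w} (norm_L2 \<Omega>) \<phi> \<and>
     (\<forall>i\<ge>1. \<forall>j\<ge>1. i \<noteq> j \<longrightarrow> inner_X0 K \<Omega> (\<phi> i) (\<phi> j) = 0) \<and>
     total_in (space_X0 K \<Omega>) (norm_X0 K \<Omega>) \<phi>"

definition X1 :: "(nat \<Rightarrow> real^'n \<Rightarrow> real) \<Rightarrow> nat \<Rightarrow> (real^'n \<Rightarrow> real) set" where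
  "X1 \<phi> k = {u. \<exists>c. u = (\<lambda>x. \<Sum>i=1..k. c i * \<phi> i x)}"

definition X2 ::
  "(real^'n \<Rightarrow> real) \<Rightarrow> (real^'n) set \<Rightarrow> (nat \<Rightarrow> real^'n \<Rightarrow> real) \<Rightarrow> nat \<Rightarrow> (real^'n \<Rightarrow> real) set" where
  "X2 K \<Omega> \<phi> k = {v \<in> space_X0 K \<Omega>. \<forall>u\<in>X1 \<phi> k. inner_X0 K \<Omega> u v = 0}"

definition J_fun ::
  "(real^'n \<Rightarrow> real) \<Rightarrow> (real^'n) set \<Rightarrow> real \<Rightarrow> real \<Rightarrow> (real^'n \<Rightarrow> real) \<Rightarrow> real" where
  "J_fun K \<Omega> \<alpha> \<beta> u =
     ((norm_X0 K \<Omega> u)\<^sup>2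
       - \<alpha> * set_lebesgue_integral lebesgue \<Omega> (\<lambda>x. \<bar>pos_part (u x)\<bar>\<^sup>2)
       - \<beta> * set_lebesgue_integral lebesgue \<Omega> (\<lambda>x. \<bar>neg_part (u x)\<bar>\<^sup>2)) / 2"

definition is_maximum :: "real set \<Rightarrow> real \<Rightarrow> bool" where
  "is_maximum A c \<longleftrightarrow> c \<in> A \<and> (\<forall>a\<in>A. a \<le> c)"

definition is_minimum :: "real set \<Rightarrow> real \<Rightarrow> bool" where
  "is_minimum A c \<longleftrightarrow> c \<in> A \<and> (\<forall>a\<in>A. c \<le> a)"

text \<open>
  \<open>m(\<alpha>, \<beta>) = c\<close>, where
  \<open>m(\<alpha>, \<beta>)\<close> is the minimum over \<open>v \<in> X\<^sub>2\<close> with unit \<open>L\<^sup>2\<close> norm of the maximum over \<open>u \<in> X\<^sub>1\<close> of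
  \<open>J (u + v)\<close>. It is a relation because minima and maxima of infinite sets of reals are partial:
  it says that all of them exist and that the resulting value is \<open>c\<close>.
\<close>

definition minimax_value ::
  "(real^'n \<Rightarrow> real) \<Rightarrow> (real^'n) set \<Rightarrow> (nat \<Rightarrow> real^'n \<Rightarrow> real) \<Rightarrow> nat \<Rightarrow> real \<Rightarrow> real \<Rightarrow> real \<Rightarrow> bool"
  where
  "minimax_value K \<Omega> \<phi> k \<alpha> \<beta> c \<longleftrightarrow>
     (\<exists>M. (\<forall>v\<in>X2 K \<Omega> \<phi> k. norm_L2 \<Omega> v = 1 \<longrightarrow>
             is_maximum ((\<lambda>u. J_fun K \<Omega> \<alpha> \<beta> (\<lambda>x. u x + v x)) ` X1 \<phi> k) (M v)) \<and>
          is_minimum (M ` {v \<in> X2 K \<Omega> \<phi> k. norm_L2 \<Omega> v = 1}) c)"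

text \<open>
  \<open>b\<close> is the threshold \<open>\<beta>(\<alpha>)\<close>, the (necessarily unique) zero of \<open>m(\<alpha>, \<cdot>)\<close> in \<open>[\<alpha>, \<infinity>)\<close>.
\<close>

definition is_beta_threshold ::
  "(real^'n \<Rightarrow> real) \<Rightarrow> (real^'n) set \<Rightarrow> (nat \<Rightarrow> real^'n \<Rightarrow> real) \<Rightarrow> nat \<Rightarrow> real \<Rightarrow> real \<Rightarrow> bool" where
  "is_beta_threshold K \<Omega> \<phi> k \<alpha> b \<longleftrightarrow> \<alpha> \<le> b \<and> minimax_value K \<Omega> \<phi> k \<alpha> b 0"

end

theory Submission
  imports Defs "HOL-Homology.Homology"
begin

text \<open>
  The solution is a limit of Galerkin approximations \<open>u\<^sub>n\<close> in the span of \<open>\<phi>\<^sub>1, \<dots>, \<phi>\<^sub>n\<close>. Solving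
  the finite-dimensional problems with a bound uniform in \<open>n\<close> is where the threshold enters.

  Write \<open>b = \<beta>(\<alpha>)\<close>. As \<open>\<alpha> > \<lambda>\<^sub>k\<close>, the functionals \<open>J\<^bsub>\<alpha>,\<beta>\<^esub>(\<cdot> + v)\<close> and \<open>J\<^bsub>\<alpha>,b\<^esub>(\<cdot> + v)\<close> are
  uniformly concave on \<open>X\<^sub>1\<close>. For \<open>v \<in> X\<^sub>2\<close> let \<open>\<tau>(v)\<close> be the maximiser of the second one; it depends
  on \<open>v\<close> in a Lipschitz way (\<open>low_critical_lipschitz\<close>), and \<open>J\<^bsub>\<alpha>,b\<^esub>(\<tau>(v) + v) \<ge> 0\<close> by the definition
  of the threshold. Replacing \<open>b\<close> by \<open>\<beta> < b\<close> raises the value by \<open>(b - \<beta>)/2\<close> times the squared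
  \<open>L\<^sup>2\<close> norm of the negative part of \<open>\<tau>(v) + v\<close>. If that negative part is small, the equation
  for \<open>\<tau>(v)\<close> forces \<open>\<tau>(v)\<close> to be small, and then the value is close to that of the quadratic form at \<open>v\<close>, which is
  positive as \<open>\<alpha> < \<lambda>\<^sub>k\<^sub>+\<^sub>1\<close>. Either way \<open>2 J\<^bsub>\<alpha>,\<beta>\<^esub>(\<tau>(v) + v) \<ge> \<delta> \<parallel>v\<parallel>\<^sup>2\<close> in \<open>L\<^sup>2\<close>, with \<open>\<delta> > 0\<close>
  independent of the dimension (\<open>low_critical_energy_lower\<close>).

  For \<open>u = w + v\<close> with \<open>w \<in> X\<^sub>1\<close>, \<open>v \<in> X\<^sub>2\<close>, test the equation with \<open>S u = 2 \<tau>(v) - w + v\<close>, that is,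
  with \<open>u + 2 (\<tau>(v) - w)\<close>. Homogeneity gives \<open>J'(u) u = 2 J(u)\<close>, concavity bounds
  \<open>J'(u) (\<tau>(v) - w)\<close> from below by \<open>J(\<tau>(v) + v) - J(u)\<close> plus a multiple of \<open>\<parallel>\<tau>(v) - w\<parallel>\<^sup>2\<close>, and so
  \<open>J'(u) (S u) \<ge> \<delta> \<parallel>v\<parallel>\<^sup>2 + (\<alpha> - \<lambda>\<^sub>k) \<parallel>\<tau>(v) - w\<parallel>\<^sup>2\<close>. This dominates \<open>\<parallel>S u\<parallel>\<^sup>2\<close>, while the bounded
  term and \<open>h\<close> contribute only linearly in \<open>\<parallel>S u\<parallel>\<close>. Since \<open>S\<close> is a continuous involution, the
  vector field of the problem, composed with \<open>S\<close>, points outwards on a large sphere and has a zero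
  (\<open>acute_angle_zero\<close>, a form of Brouwer's theorem); see \<open>galerkin_solution\<close>.

  The passage to the limit rests on \<open>\<lambda>\<^sub>i \<rightarrow> \<infinity>\<close>, which makes sets bounded in energy relatively compact in
  \<open>L\<^sup>2\<close> (\<open>L2_compactness\<close>). It holds because of the lower bound on the kernel: bounded
  eigenvalues would bound the energy of the indicator function of a ball by a multiple of its volume,
  but for a ball of radius \<open>r\<close> the energy is at least of order \<open>r\<^sup>-\<^sup>2\<^sup>s\<close> times the volume
  (\<open>eigenvalues_unbounded\<close>). The limit lies in \<open>X\<^sub>0\<close> by Fatou's lemma (\<open>X0_closed\<close>) and solves the equation
  tested with each \<open>\<phi>\<^sub>j\<close>; density of their span in \<open>X\<^sub>0\<close> and the Poincare inequality extend this to
  all test functions (\<open>weak_solution_from_coefficients\<close>).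
\<close>

section \<open>Zeros of outward pointing vector fields\<close>

text \<open>
  If \<open>F\<close> had no zero in the ball, then \<open>x \<mapsto> F (R x) / \<bar>F (R x)\<bar>\<close> would be defined on the unit sphere. It is homotopic
  to the identity through \<open>(1 - t) x + t F (R x)\<close>, which stays nonzero as its product with \<open>x\<close> is
  positive, and to a constant through \<open>F ((1 - t) R x)\<close>, so the sphere would be contractible. The vectors
  of \<open>n\<close> coordinates are sequences vanishing from \<open>n\<close> on, which leaves the dimension a variable.
\<close>

lemma acute_angle_zero:
  fixes F :: "(nat \<Rightarrow> real) \<Rightarrow> nat \<Rightarrow> real"
  defines "V \<equiv> \<lambda>n. {c::nat \<Rightarrow> real. \<forall>i\<ge>n. c i = 0}"
  assumes "0 < n" "0 < R"
    and cont: "\<And>j. j < n \<Longrightarrow> continuous_on (V n) (\<lambda>c. F c j)"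
    and acute: "\<And>c. c \<in> V n \<Longrightarrow> (\<Sum>i<n. (c i)\<^sup>2) = R\<^sup>2 \<Longrightarrow> 0 < (\<Sum>i<n. F c i * c i)"
  shows "\<exists>c\<in>V n. (\<Sum>i<n. (c i)\<^sup>2) \<le> R\<^sup>2 \<and> (\<forall>j<n. F c j = 0)"
proof (rule ccontr)
  assume neg: "\<not> ?thesis"
  define S where "S = {x \<in> V n. (\<Sum>i<n. (x i)\<^sup>2) = 1}"
  define G where "G = (\<lambda>c j. if j < n then F c j else 0)"
  define \<rho> :: "(nat \<Rightarrow> real) \<Rightarrow> nat \<Rightarrow> real" where "\<rho> = (\<lambda>y i. y i / sqrt (\<Sum>i<n. (y i)\<^sup>2))"
  have sphere: "nsphere (n - 1) = top_of_set S"
  proof -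
    have "{..n - 1} = {..<n}" "\<And>i. i > n - 1 \<longleftrightarrow> i \<ge> n"
      using \<open>0 < n\<close> by auto
    then show ?thesis
      unfolding nsphere S_def V_def euclidean_product_topology by (intro arg_cong2[where f=subtopology]) auto
  qed
  have sum_pos: "0 < (\<Sum>i<n. (y i)\<^sup>2)" if "\<exists>i<n. y i \<noteq> 0" for y :: "nat \<Rightarrow> real"
    using that by (metis finite_lessThan lessThan_iff sum_pos2 zero_le_power2 zero_less_power2)
  have \<rho>S: "\<rho> y \<in> S" if "y \<in> V n" "0 < (\<Sum>i<n. (y i)\<^sup>2)" for y
  proof -
    have "(\<Sum>i<n. (\<rho> y i)\<^sup>2) = (\<Sum>i<n. (y i)\<^sup>2) / (sqrt (\<Sum>i<n. (y i)\<^sup>2))\<^sup>2"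
      unfolding \<rho>_def by (simp add: power_divide sum_divide_distrib)
    also have "\<dots> = 1"
      using that(2) by simp
    finally show ?thesis
      using that(1) by (auto simp: S_def V_def \<rho>_def)
  qed
  have \<rho>id: "\<rho> x = x" if "x \<in> S" for x
    using that by (auto simp: S_def \<rho>_def)
  \<comment> \<open>Normalising a continuous family of nonzero vectors gives a homotopy within the sphere.\<close>
  have homotopy: "homotopic_with_canon (\<lambda>_. True) S S (\<lambda>x. \<rho> (k (0, x))) (\<lambda>x. \<rho> (k (1, x)))"
    if k: "\<And>j. continuous_on ({0..1::real} \<times> S) (\<lambda>z. k z j)"
      and kV: "\<And>z. z \<in> {0..1} \<times> S \<Longrightarrow> k z \<in> V n \<and> 0 < (\<Sum>i<n. (k z i)\<^sup>2)" for k
  proof -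
    have "continuous_on ({0..1::real} \<times> S) (\<lambda>z. \<rho> (k z))"
    proof (rule continuous_on_coordinatewise_then_product)
      fix j
      show "continuous_on ({0..1} \<times> S) (\<lambda>z. \<rho> (k z) j)"
        unfolding \<rho>_def
      proof (intro continuous_intros k ballI)
        fix z assume "z \<in> {0..1::real} \<times> S"
        from kV[OF this] show "sqrt (\<Sum>i<n. (k z i)\<^sup>2) \<noteq> 0" by simp
      qed
    qed
    moreover have "(\<lambda>z. \<rho> (k z)) \<in> ({0..1} \<times> S) \<rightarrow> S"
      using \<rho>S kV by blast
    ultimately show ?thesis
      unfolding homotopic_with_def
      by (intro exI[of _ "\<lambda>z. \<rho> (k z)"]) (auto simp flip: subtopology_Times)
  qed
  have SV: "(\<lambda>j. R * (t * x j)) \<in> V n" "(\<Sum>i<n. (R * (t * x i))\<^sup>2) = R\<^sup>2 * t\<^sup>2" if "x \<in> S" for t x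
  proof -
    have "(\<Sum>i<n. (R * (t * x i))\<^sup>2) = R\<^sup>2 * t\<^sup>2 * (\<Sum>i<n. (x i)\<^sup>2)"
      by (simp add: power_mult_distrib sum_distrib_left mult.assoc)
    with that show "(\<lambda>j. R * (t * x j)) \<in> V n" "(\<Sum>i<n. (R * (t * x i))\<^sup>2) = R\<^sup>2 * t\<^sup>2"
      by (simp_all add: S_def V_def)
  qed
  have Gcont: "continuous_on ({0..1::real} \<times> S) (\<lambda>z. G (\<lambda>i. R * (\<tau> (fst z) * snd z i)) j)"
    if "continuous_on {0..1} \<tau>" for j \<tau>
  proof (cases "j < n")
    case True
    have "continuous_on ({0..1::real} \<times> S) (\<lambda>z. F (\<lambda>i. R * (\<tau> (fst z) * snd z i)) j)"
    proof (rule continuous_on_compose2[OF cont[OF True]])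
      show "continuous_on ({0..1} \<times> S) (\<lambda>z i. R * (\<tau> (fst z) * snd z i))"
        by (intro continuous_on_coordinatewise_then_product continuous_intros
            continuous_on_compose2[OF that] continuous_on_product_then_coordinatewise[OF continuous_on_snd[OF continuous_on_id]]) auto
    qed (use SV(1) in auto)
    with True show ?thesis by (simp add: G_def)
  qed (simp add: G_def)
  let ?k1 = "\<lambda>z j. (1 - fst z) * snd z j + fst z * G (\<lambda>i. R * (1 * snd z i)) j"
  let ?k2 = "\<lambda>z. G (\<lambda>i. R * ((1 - fst z) * snd z i))"
  have coord: "continuous_on ({0..1::real} \<times> S) (\<lambda>z. snd z j)" for j
    by (rule continuous_on_product_then_coordinatewise[OF continuous_on_snd[OF continuous_on_id]])
  have h1: "homotopic_with_canon (\<lambda>_. True) S S (\<lambda>x. \<rho> (?k1 (0, x))) (\<lambda>x. \<rho> (?k1 (1, x)))"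
  proof (rule homotopy)
    fix j
    have "continuous_on ({0..1::real} \<times> S) (\<lambda>z. G (\<lambda>i. R * (1 * snd z i)) j)"
      using Gcont[of "\<lambda>_. 1" j] by simp
    then show "continuous_on ({0..1} \<times> S) (\<lambda>z. ?k1 z j)"
      by (intro continuous_intros coord)
  next
    fix z assume zin: "z \<in> {0..1::real} \<times> S"
    obtain t x where "z = (t,x)" by (cases z)
    with zin have z: "z = (t,x)" "0 \<le> t" "t \<le> 1" "x \<in> S" by auto
    define y where "y = ?k1 z"
    define w where "w = (\<lambda>i. R * (1 * x i))"
    have p: "0 < (\<Sum>i<n. F w i * w i)"
    proof (rule acute)
      show "w \<in> V n"
        unfolding w_def by (rule SV(1)[OF z(4)])
      show "(\<Sum>i<n. (w i)\<^sup>2) = R\<^sup>2"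
        unfolding w_def SV(2)[OF z(4)] by simp
    qed
    have "(\<Sum>i<n. y i * x i) = (\<Sum>i<n. (1 - t) * (x i)\<^sup>2 + t / R * (F w i * w i))"
      using \<open>0 < R\<close> by (intro sum.cong refl) (simp add: y_def z(1) G_def w_def power2_eq_square algebra_simps)
    also have "\<dots> = (1 - t) * (\<Sum>i<n. (x i)\<^sup>2) + t / R * (\<Sum>i<n. F w i * w i)"
      by (simp add: sum.distrib sum_distrib_left)
    also have "\<dots> = (1 - t) + t * ((\<Sum>i<n. F w i * w i) / R)"
      using z by (simp add: S_def)
    also have "\<dots> > 0"
    proof (cases "t = 0")
      case False
      then have "0 < t * ((\<Sum>i<n. F w i * w i) / R)"
        using z p \<open>0 < R\<close> by simp
      then show ?thesis using z by simp
    qed simp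
    finally have "\<exists>i<n. y i \<noteq> 0"
    proof (rule contrapos_pp)
      assume "\<not> (\<exists>i<n. y i \<noteq> 0)"
      then have "(\<Sum>i<n. y i * x i) = 0" by (intro sum.neutral) auto
      then show "\<not> 0 < (\<Sum>i<n. y i * x i)" by simp
    qed
    moreover have "y \<in> V n"
      using z by (auto simp: y_def V_def S_def G_def)
    ultimately show "?k1 z \<in> V n \<and> 0 < (\<Sum>i<n. (?k1 z i)\<^sup>2)"
      using sum_pos[of y] by (simp add: y_def)
  qed
  have h2: "homotopic_with_canon (\<lambda>_. True) S S (\<lambda>x. \<rho> (?k2 (0, x))) (\<lambda>x. \<rho> (?k2 (1, x)))"
  proof (rule homotopy)
    fix j
    show "continuous_on ({0..1} \<times> S) (\<lambda>z. ?k2 z j)"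
      by (rule Gcont[of "\<lambda>t. 1 - t"]) (intro continuous_intros)
  next
    fix z assume zin: "z \<in> {0..1::real} \<times> S"
    obtain t x where "z = (t,x)" by (cases z)
    with zin have z: "z = (t,x)" "0 \<le> t" "t \<le> 1" "x \<in> S" by auto
    define w where "w = (\<lambda>i. R * ((1 - t) * x i))"
    have "(1-t)\<^sup>2 \<le> 1" using z by (simp add: power_le_one)
    then have "(\<Sum>i<n. (w i)\<^sup>2) \<le> R\<^sup>2" "w \<in> V n"
      using SV[OF z(4), of "1-t"] by (simp_all add: mult_left_le w_def)
    then have "\<exists>j<n. F w j \<noteq> 0"
      using neg by blast
    then have "0 < (\<Sum>i<n. (G w i)\<^sup>2)"
      by (intro sum_pos) (auto simp: G_def)
    moreover have "G w \<in> V n"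
      by (simp add: V_def G_def)
    ultimately show "?k2 z \<in> V n \<and> 0 < (\<Sum>i<n. (?k2 z i)\<^sup>2)"
      by (simp add: z w_def)
  qed
  have "homotopic_with_canon (\<lambda>_. True) S S (\<lambda>x. \<rho> (?k1 (0, x))) (\<lambda>x. \<rho> (G (\<lambda>i. 0)))"
    using homotopic_with_trans[OF h1, of "\<lambda>x. \<rho> (?k2 (1, x))"] h2 by simp
  then have "homotopic_with_canon (\<lambda>_. True) S S id (\<lambda>x. \<rho> (G (\<lambda>i. 0)))"
    by (rule homotopic_with_eq) (auto simp: \<rho>id)
  then have "contractible_space (nsphere (n - 1))"
    unfolding sphere contractible_space_def by blast
  then show False
    by (rule notE[OF non_contractible_space_nsphere])
qed

section \<open>Square-integrable functions\<close>

definition sq_integrable :: "'a measure \<Rightarrow> ('a \<Rightarrow> real) \<Rightarrow> bool" where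
  "sq_integrable M f \<longleftrightarrow> f \<in> borel_measurable M \<and> integrable M (\<lambda>x. (f x)\<^sup>2)"

lemma sq_integrable_measurable: "sq_integrable M f \<Longrightarrow> f \<in> borel_measurable M"
  by (simp add: sq_integrable_def)

lemma sq_integrable_square: "sq_integrable M f \<Longrightarrow> integrable M (\<lambda>x. (f x)\<^sup>2)"
  by (simp add: sq_integrable_def)

lemma sq_integrable_mult:
  assumes "sq_integrable M f" "sq_integrable M g"
  shows "integrable M (\<lambda>x. f x * g x)"
proof (rule Bochner_Integration.integrable_bound)
  show "integrable M (\<lambda>x. (f x)\<^sup>2 + (g x)\<^sup>2)"
    using assms by (simp add: sq_integrable_def)
  show "(\<lambda>x. f x * g x) \<in> borel_measurable M"
    using assms[THEN sq_integrable_measurable] by measurable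
  have "\<bar>a * b\<bar> \<le> a\<^sup>2 + b\<^sup>2" for a b :: real
  proof -
    have "0 \<le> (\<bar>a\<bar> - \<bar>b\<bar>)\<^sup>2" by simp
    then have "2 * (\<bar>a\<bar> * \<bar>b\<bar>) \<le> a\<^sup>2 + b\<^sup>2" by (simp add: power2_diff)
    moreover have "0 \<le> \<bar>a\<bar> * \<bar>b\<bar>" by simp
    ultimately show ?thesis unfolding abs_mult by linarith
  qed
  then show "AE x in M. norm (f x * g x) \<le> norm ((f x)\<^sup>2 + (g x)\<^sup>2)"
    by simp
qed

lemma sq_integrable_bound:
  assumes "sq_integrable M f" "g \<in> borel_measurable M" "AE x in M. \<bar>g x\<bar> \<le> \<bar>f x\<bar>"
  shows "sq_integrable M g"
  unfolding sq_integrable_def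
proof (intro conjI assms(2) Bochner_Integration.integrable_bound[OF sq_integrable_square[OF assms(1)]])
  show "AE x in M. norm ((g x)\<^sup>2) \<le> norm ((f x)\<^sup>2)"
    using assms(3) by eventually_elim (simp add: abs_le_square_iff)
qed (use assms(2) in measurable)

lemma sq_integrable_add:
  assumes "sq_integrable M f" "sq_integrable M g"
  shows "sq_integrable M (\<lambda>x. f x + g x)"
  using assms sq_integrable_mult[OF assms] by (auto simp: sq_integrable_def power2_sum mult.assoc intro: borel_measurable_add)

lemma sq_integrable_cmult: "sq_integrable M f \<Longrightarrow> sq_integrable M (\<lambda>x. c * f x)"
  by (auto simp: sq_integrable_def power_mult_distrib intro: borel_measurable_times)

lemma sq_integrable_uminus: "sq_integrable M f \<Longrightarrow> sq_integrable M (\<lambda>x. - f x)"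
  by (simp add: sq_integrable_def)

lemma sq_integrable_diff:
  "sq_integrable M f \<Longrightarrow> sq_integrable M g \<Longrightarrow> sq_integrable M (\<lambda>x. f x - g x)"
  using sq_integrable_add[OF _ sq_integrable_uminus] by fastforce

lemma sq_integrable_abs: "sq_integrable M f \<Longrightarrow> sq_integrable M (\<lambda>x. \<bar>f x\<bar>)"
  by (auto simp: sq_integrable_def intro: borel_measurable_abs)

lemma sq_integrable_sum:
  "(\<And>i. i \<in> I \<Longrightarrow> sq_integrable M (f i)) \<Longrightarrow> sq_integrable M (\<lambda>x. \<Sum>i\<in>I. f i x)"
proof (induction I rule: infinite_finite_induct)
  case (insert i I)
  then show ?case by (simp add: sq_integrable_add)
qed (simp_all add: sq_integrable_def)

lemma (in finite_measure) sq_integrable_const: "sq_integrable M (\<lambda>_. c)"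
  by (simp add: sq_integrable_def)

text \<open>
  The quadratic polynomial \<open>t \<mapsto> \<integral>(f - t g)\<^sup>2\<close> is nonnegative; it is evaluated at its minimum, or, if
  \<open>g\<close> vanishes, at a point where a nonzero linear term would make it negative.
\<close>

lemma L2_Cauchy_Schwarz:
  assumes "sq_integrable M f" "sq_integrable M g"
  shows "(\<integral>x. f x * g x \<partial>M)\<^sup>2 \<le> (\<integral>x. (f x)\<^sup>2 \<partial>M) * (\<integral>x. (g x)\<^sup>2 \<partial>M)"
proof -
  let ?A = "\<integral>x. (f x)\<^sup>2 \<partial>M" and ?B = "\<integral>x. f x * g x \<partial>M" and ?C = "\<integral>x. (g x)\<^sup>2 \<partial>M"
  note int = sq_integrable_square[OF assms(1)] sq_integrable_mult[OF assms] sq_integrable_square[OF assms(2)]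
  have q: "0 \<le> ?A - 2 * t * ?B + t\<^sup>2 * ?C" for t
  proof -
    have "0 \<le> (\<integral>x. (f x - t * g x)\<^sup>2 \<partial>M)"
      by (rule integral_nonneg_AE) simp
    also have "(\<lambda>x. (f x - t * g x)\<^sup>2) = (\<lambda>x. (f x)\<^sup>2 - 2 * t * (f x * g x) + t\<^sup>2 * (g x)\<^sup>2)"
      by (simp add: power2_eq_square algebra_simps)
    finally show ?thesis using int by simp
  qed
  have A: "0 \<le> ?A" and C: "0 \<le> ?C" by (rule integral_nonneg_AE; simp)+
  show ?thesis
  proof (cases "?C = 0")
    case True
    have "?B = 0"
    proof (rule ccontr)
      assume "?B \<noteq> 0"
      then show False using q[of "(?A + 1) / (2 * ?B)"] True by (simp add: field_simps)
    qed
    with True show ?thesis by simp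
  next
    case False
    with C have "0 < ?C" by linarith
    then show ?thesis
      using mult_left_mono[OF q[of "?B / ?C"], of ?C] by (simp add: field_simps power2_eq_square)
  qed
qed

lemma L2_Cauchy_Schwarz_abs:
  assumes "sq_integrable M f" "sq_integrable M g"
  shows "\<bar>\<integral>x. f x * g x \<partial>M\<bar> \<le> sqrt (\<integral>x. (f x)\<^sup>2 \<partial>M) * sqrt (\<integral>x. (g x)\<^sup>2 \<partial>M)"
  using real_sqrt_le_mono[OF L2_Cauchy_Schwarz[OF assms]] by (simp add: real_sqrt_mult)

lemma L2_tendsto_inner:
  assumes u: "\<And>n. sq_integrable M (u n)" and v: "sq_integrable M v" and w: "sq_integrable M w"
    and lim: "(\<lambda>n. \<integral>x. (u n x - v x)\<^sup>2 \<partial>M) \<longlonglongrightarrow> 0"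
  shows "(\<lambda>n. \<integral>x. u n x * w x \<partial>M) \<longlonglongrightarrow> (\<integral>x. v x * w x \<partial>M)"
proof (rule LIM_zero_cancel, rule tendsto_rabs_zero_cancel, rule tendsto_sandwich[OF _ _ tendsto_const])
  let ?w = "sqrt (\<integral>x. (w x)\<^sup>2 \<partial>M)"
  have "\<bar>(\<integral>x. u n x * w x \<partial>M) - (\<integral>x. v x * w x \<partial>M)\<bar> \<le> sqrt (\<integral>x. (u n x - v x)\<^sup>2 \<partial>M) * ?w" for n
  proof -
    have "(\<integral>x. u n x * w x \<partial>M) - (\<integral>x. v x * w x \<partial>M) = (\<integral>x. (u n x - v x) * w x \<partial>M)"
      using sq_integrable_mult[OF u w] sq_integrable_mult[OF v w] by (simp add: left_diff_distrib)
    then show ?thesis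
      using L2_Cauchy_Schwarz_abs[OF sq_integrable_diff[OF u v] w] by simp
  qed
  then show "\<forall>\<^sub>F n in sequentially. \<bar>(\<integral>x. u n x * w x \<partial>M) - (\<integral>x. v x * w x \<partial>M)\<bar>
      \<le> sqrt (\<integral>x. (u n x - v x)\<^sup>2 \<partial>M) * ?w"
    by simp
  show "(\<lambda>n. sqrt (\<integral>x. (u n x - v x)\<^sup>2 \<partial>M) * ?w) \<longlonglongrightarrow> 0"
    using tendsto_mult_right[OF tendsto_real_sqrt[OF lim], of ?w] by simp
qed simp_all

text \<open>
  The Riesz-Fischer theorem. Along a subsequence whose \<open>j\<close>-th increment has squared norm at most \<open>4\<^sup>-\<^sup>j\<close>, the increments are summable almost
  everywhere, because their \<open>L\<^sup>1\<close> norms are summable; Fatou's lemma then turns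
  the Cauchy condition into convergence of the whole sequence to the pointwise limit of the subsequence.
\<close>

lemma (in finite_measure) L2_complete:
  assumes u: "\<And>n. sq_integrable M (u n)"
    and cauchy: "\<And>\<epsilon>. 0 < \<epsilon> \<Longrightarrow> \<exists>N::nat. \<forall>m\<ge>N. \<forall>n\<ge>N. (\<integral>x. (u m x - u n x)\<^sup>2 \<partial>M) \<le> \<epsilon>"
  obtains v r where "sq_integrable M v" "strict_mono r"
    "AE x in M. (\<lambda>n. u (r n) x) \<longlonglongrightarrow> v x" "(\<lambda>n. \<integral>x. (u n x - v x)\<^sup>2 \<partial>M) \<longlonglongrightarrow> 0"
proof -
  have "\<forall>j. \<exists>N. \<forall>m\<ge>N. \<forall>n\<ge>N. (\<integral>x. (u m x - u n x)\<^sup>2 \<partial>M) \<le> (1/4)^j"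
    using cauchy by simp
  then obtain N where N: "\<And>j m n. N j \<le> m \<Longrightarrow> N j \<le> n \<Longrightarrow> (\<integral>x. (u m x - u n x)\<^sup>2 \<partial>M) \<le> (1/4)^j"
    by metis
  define r where "r = rec_nat (N 0) (\<lambda>j q. max (Suc q) (N (Suc j)))"
  have rS: "r (Suc j) = max (Suc (r j)) (N (Suc j))" for j by (simp add: r_def)
  have "strict_mono r" by (rule strict_mono_Suc_iff[THEN iffD2]) (simp add: rS less_max_iff_disj)
  have rN: "N j \<le> r j" for j by (cases j) (simp_all add: r_def)
  define d where "d j x = u (r (Suc j)) x - u (r j) x" for j x
  have dm [measurable]: "d j \<in> borel_measurable M" for j
    unfolding d_def using u by (intro borel_measurable_diff) (auto dest: sq_integrable_measurable)
  have d2: "integrable M (\<lambda>x. (d j x)\<^sup>2)" for j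
    unfolding d_def by (rule sq_integrable_square[OF sq_integrable_diff[OF u u]])
  have nnd: "(\<integral>\<^sup>+x. ennreal \<bar>d j x\<bar> \<partial>M) \<le> ennreal ((1/2)^j * (1 + measure M (space M)))" for j
  proof -
    \<comment> \<open>The arithmetic-geometric mean inequality turns the bound \<open>4 ^ - j\<close> on squares into an \<open>L\<^sup>1\<close> bound.\<close>
    have amgm: "\<bar>t\<bar> \<le> 2^j * t\<^sup>2 + (1/2)^j" for t :: real
    proof -
      have "0 \<le> (2^j * \<bar>t\<bar> - 1)\<^sup>2" by simp
      then have "2 * (2^j * \<bar>t\<bar>) \<le> 2^j * 2^j * t\<^sup>2 + 1"
        by (simp add: power2_diff power_mult_distrib power2_eq_square[of "2^j"])
      moreover have "0 \<le> 2^j * \<bar>t\<bar>" by simp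
      ultimately have "2^j * \<bar>t\<bar> \<le> 2^j * (2^j * t\<^sup>2) + 1" by linarith
      also have "\<dots> = 2^j * (2^j * t\<^sup>2 + (1/2)^j)"
        by (simp add: distrib_left power_one_over)
      finally show ?thesis by simp
    qed
    have "(\<integral>\<^sup>+x. ennreal \<bar>d j x\<bar> \<partial>M) \<le> (\<integral>\<^sup>+x. ennreal (2^j * (d j x)\<^sup>2 + (1/2)^j) \<partial>M)"
      by (intro nn_integral_mono ennreal_leI amgm)
    also have "\<dots> = ennreal (\<integral>x. 2^j * (d j x)\<^sup>2 + (1/2)^j \<partial>M)"
      by (rule nn_integral_eq_integral) (simp_all add: d2)
    also have "(\<integral>x. 2^j * (d j x)\<^sup>2 + (1/2)^j \<partial>M) = 2^j * (\<integral>x. (d j x)\<^sup>2 \<partial>M) + (1/2)^j * measure M (space M)"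
      using d2 by simp
    also have "\<dots> \<le> 2^j * (1/4)^j + (1/2)^j * measure M (space M)"
      using N[of j "r (Suc j)" "r j"] rN[of j] rS[of j] by (intro add_mono mult_left_mono) (simp_all add: d_def)
    also have "(2::real)^j * (1/4)^j = (1/2)^j" by (simp flip: power_mult_distrib)
    finally show ?thesis by (simp add: distrib_left ennreal_leI)
  qed
  have "AE x in M. summable (\<lambda>j. \<bar>d j x\<bar>)"
  proof -
    have "(\<integral>\<^sup>+x. (suminf (\<lambda>j. ennreal \<bar>d j x\<bar>)) \<partial>M) = (suminf (\<lambda>j. \<integral>\<^sup>+x. ennreal \<bar>d j x\<bar> \<partial>M))"
      by (rule nn_integral_suminf) measurable
    also have "\<dots> \<le> suminf (\<lambda>j. ennreal ((1/2)^j * (1 + measure M (space M))))"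
      by (intro suminf_le nnd) auto
    also have "\<dots> = ennreal (suminf (\<lambda>j. (1/2)^j * (1 + measure M (space M))))"
      by (rule suminf_ennreal2) (auto intro!: summable_mult2 summable_geometric)
    also have "\<dots> < \<infinity>" by simp
    finally have "AE x in M. (suminf (\<lambda>j. ennreal \<bar>d j x\<bar>)) \<noteq> \<infinity>"
      by (intro nn_integral_PInf_AE) auto
    then show ?thesis
      by eventually_elim (rule summable_suminf_not_top, simp_all)
  qed
  then have conv: "AE x in M. convergent (\<lambda>j. u (r j) x)"
  proof eventually_elim
    case (elim x)
    have "u (r j) x = u (r 0) x + (\<Sum>i<j. d i x)" for j
      by (induction j) (simp_all add: d_def)
    then have "(\<lambda>j. u (r j) x) = (\<lambda>j. u (r 0) x + (\<Sum>i<j. d i x))" ..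
    moreover have "convergent (\<lambda>j. u (r 0) x + (\<Sum>i<j. d i x))"
      using summable_rabs_cancel[OF elim] by (intro convergent_add convergent_const) (simp add: summable_iff_convergent)
    ultimately show ?case by (rule ssubst[where P = convergent])
  qed
  define v where "v x = lim (\<lambda>j. u (r j) x)" for x
  have um [measurable]: "u n \<in> borel_measurable M" for n using u by (rule sq_integrable_measurable)
  have vm [measurable]: "v \<in> borel_measurable M" unfolding v_def by measurable
  have lim: "AE x in M. (\<lambda>j. u (r j) x) \<longlonglongrightarrow> v x"
    using conv by eventually_elim (simp add: v_def convergent_LIMSEQ_iff)
  have fatou: "(\<integral>\<^sup>+x. ennreal ((u n x - v x)\<^sup>2) \<partial>M) \<le> ennreal ((1/4)^j)" if "N j \<le> n" for n j
  proof -
    have "(\<integral>\<^sup>+x. ennreal ((u n x - v x)\<^sup>2) \<partial>M) \<le> (\<integral>\<^sup>+x. liminf (\<lambda>i. ennreal ((u n x - u (r i) x)\<^sup>2)) \<partial>M)"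
    proof (rule nn_integral_mono_AE)
      show "AE x in M. ennreal ((u n x - v x)\<^sup>2) \<le> liminf (\<lambda>i. ennreal ((u n x - u (r i) x)\<^sup>2))"
        using lim
      proof eventually_elim
        case (elim x)
        have "(\<lambda>i. ennreal ((u n x - u (r i) x)\<^sup>2)) \<longlonglongrightarrow> ennreal ((u n x - v x)\<^sup>2)"
          by (intro tendsto_intros elim)
        then show ?case
            by (intro eq_refl lim_imp_Liminf[OF trivial_limit_sequentially, symmetric])
      qed
    qed
    also have "\<dots> \<le> liminf (\<lambda>i. \<integral>\<^sup>+x. ennreal ((u n x - u (r i) x)\<^sup>2) \<partial>M)"
      by (rule nn_integral_liminf) measurable
    also have "\<dots> \<le> liminf (\<lambda>i. ennreal ((1/4)^j))"
    proof (rule Liminf_mono, rule eventually_sequentiallyI)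
      fix i assume "j \<le> i"
      then have "r j \<le> r i" using \<open>strict_mono r\<close> by (simp add: strict_mono_less_eq)
      then have "N j \<le> r i" using rN[of j] by simp
      have "(\<integral>\<^sup>+x. ennreal ((u n x - u (r i) x)\<^sup>2) \<partial>M) = ennreal (\<integral>x. (u n x - u (r i) x)\<^sup>2 \<partial>M)"
        by (rule nn_integral_eq_integral) (simp_all add: sq_integrable_square[OF sq_integrable_diff[OF u u]])
      then show "(\<integral>\<^sup>+x. ennreal ((u n x - u (r i) x)\<^sup>2) \<partial>M) \<le> ennreal ((1/4)^j)"
        using N[OF that \<open>N j \<le> r i\<close>] by (simp add: ennreal_leI)
    qed
    also have "\<dots> = ennreal ((1/4)^j)" by (simp add: Liminf_const)
    finally show ?thesis .
  qed
  have diff: "sq_integrable M (\<lambda>x. u n x - v x)" if "N j \<le> n" for n j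
    unfolding sq_integrable_def
  proof (intro conjI integrableI_bounded)
    have "(\<integral>\<^sup>+x. ennreal (norm ((u n x - v x)\<^sup>2)) \<partial>M) \<le> ennreal ((1/4)^j)"
      using fatou[OF that] by simp
    also have "\<dots> < \<infinity>" by simp
    finally show "(\<integral>\<^sup>+x. ennreal (norm ((u n x - v x)\<^sup>2)) \<partial>M) < \<infinity>" .
  qed measurable
  have "sq_integrable M v"
    using sq_integrable_diff[OF u[of "N 0"] diff[of 0 "N 0"]] by simp
  moreover have "(\<lambda>n. \<integral>x. (u n x - v x)\<^sup>2 \<partial>M) \<longlonglongrightarrow> 0"
  proof (rule LIMSEQ_I)
    fix e :: real assume "0 < e"
    obtain j where j: "(1/4::real)^j < e" using real_arch_pow_inv[OF \<open>0 < e\<close>, of "1/4"] by auto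
    have "norm ((\<integral>x. (u n x - v x)\<^sup>2 \<partial>M) - 0) < e" if "N j \<le> n" for n
    proof -
      have "ennreal (\<integral>x. (u n x - v x)\<^sup>2 \<partial>M) = (\<integral>\<^sup>+x. ennreal ((u n x - v x)\<^sup>2) \<partial>M)"
        by (rule nn_integral_eq_integral[symmetric]) (simp_all add: sq_integrable_square[OF diff[OF that]])
      with fatou[OF that] have "ennreal (\<integral>x. (u n x - v x)\<^sup>2 \<partial>M) \<le> ennreal ((1/4)^j)"
        by (simp only:)
      then have "(\<integral>x. (u n x - v x)\<^sup>2 \<partial>M) \<le> (1/4)^j"
        by (subst (asm) ennreal_le_iff) simp_all
      moreover have "0 \<le> (\<integral>x. (u n x - v x)\<^sup>2 \<partial>M)" by simp
      ultimately show ?thesis using j by simp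
    qed
    then show "\<exists>no. \<forall>n\<ge>no. norm ((\<integral>x. (u n x - v x)\<^sup>2 \<partial>M) - 0) < e" by blast
  qed
  ultimately show thesis
    using that \<open>strict_mono r\<close> lim by blast
qed

section \<open>The jumping nonlinearity\<close>

definition jumping :: "real \<Rightarrow> real \<Rightarrow> real \<Rightarrow> real" where
  "jumping a b t = a * pos_part t - b * neg_part t"

definition jumping_primitive :: "real \<Rightarrow> real \<Rightarrow> real \<Rightarrow> real" where
  "jumping_primitive a b t = (a * (pos_part t)\<^sup>2 + b * (neg_part t)\<^sup>2) / 2"

lemma jumping_eq: "jumping a b t = a * t - (b - a) * neg_part t"
  by (auto simp: jumping_def pos_part_def neg_part_def max_def algebra_simps)

lemma jumping_primitive_eq:
  "jumping_primitive a b t = (a * t\<^sup>2 + (b - a) * (neg_part t)\<^sup>2) / 2"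
  by (auto simp: jumping_primitive_def pos_part_def neg_part_def max_def algebra_simps)

lemma jumping_mult_self: "jumping a b t * t = 2 * jumping_primitive a b t"
  by (auto simp: jumping_primitive_def jumping_def pos_part_def neg_part_def max_def power2_eq_square)

lemma jumping_primitive_mult:
  "0 \<le> r \<Longrightarrow> jumping_primitive a b (r * t) = r\<^sup>2 * jumping_primitive a b t"
  by (auto simp: jumping_primitive_def pos_part_def neg_part_def max_def power_mult_distrib mult_le_0_iff zero_le_mult_iff)

text \<open>
  The nonlinearity is piecewise linear with slopes \<open>a\<close> and \<open>b\<close>, so its difference quotients lie between them.
\<close>

lemma jumping_difference:
  assumes "a \<le> b"
  obtains q where "a \<le> q" "q \<le> b" "jumping a b s - jumping a b t = q * (s - t)"
proof -
  have "\<exists>q. 0 \<le> q \<and> q \<le> 1 \<and> neg_part t - neg_part s = q * (s - t)"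
  proof (cases "s = t")
    case False
    have "0 \<le> (neg_part t - neg_part s) / (s - t)" "(neg_part t - neg_part s) / (s - t) \<le> 1"
      using False by (auto simp: neg_part_def max_def divide_simps)
    with False show ?thesis by (intro exI[of _ "(neg_part t - neg_part s) / (s - t)"]) simp
  qed auto
  then obtain q where q: "0 \<le> q" "q \<le> 1" "neg_part t - neg_part s = q * (s - t)" by blast
  have "jumping a b s - jumping a b t = a * (s - t) + (b - a) * (neg_part t - neg_part s)"
    by (simp add: jumping_eq algebra_simps)
  also have "\<dots> = (a + (b - a) * q) * (s - t)"
    unfolding q(3) by (simp add: algebra_simps)
  finally show thesis
    using q assms mult_left_le[of q "b - a"] by (intro that[of "a + (b - a) * q"]) auto
qed

text \<open>
  The function \<open>t \<mapsto> (neg_part t)\<^sup>2\<close> is convex, and its derivative \<open>- 2 neg_part t\<close> has Lipschitz constant \<open>2\<close>.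
  These two facts carry over to the primitive of the nonlinearity and replace differentiation of the energy.
\<close>

lemma neg_part_sq_taylor:
  "(neg_part s)\<^sup>2 \<ge> (neg_part t)\<^sup>2 - 2 * neg_part t * (s - t)"
  "(neg_part s)\<^sup>2 \<le> (neg_part t)\<^sup>2 - 2 * neg_part t * (s - t) + (s - t)\<^sup>2"
proof -
  have "0 \<le> (neg_part s - neg_part t)\<^sup>2 + 2 * neg_part t * (neg_part s + s) "
    by (simp add: neg_part_def max_def)
  moreover have "(neg_part t)\<^sup>2 + neg_part t * t = 0"
    by (simp add: neg_part_def max_def power2_eq_square)
  ultimately show "(neg_part s)\<^sup>2 \<ge> (neg_part t)\<^sup>2 - 2 * neg_part t * (s - t)"
    by (simp add: power2_eq_square algebra_simps)
  show "(neg_part s)\<^sup>2 \<le> (neg_part t)\<^sup>2 - 2 * neg_part t * (s - t) + (s - t)\<^sup>2"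
  proof (cases "s \<le> 0")
    case True
    have "0 \<le> (max t 0) * (max t 0 - 2 * s)"
      using True by (intro mult_nonneg_nonneg) auto
    then show ?thesis using True by (auto simp: neg_part_def max_def power2_eq_square algebra_simps)
  next
    case False
    then have "neg_part s = 0" by (simp add: neg_part_def)
    moreover have "(neg_part t)\<^sup>2 - 2 * neg_part t * (s - t) + (s - t)\<^sup>2 = (neg_part t - (s - t))\<^sup>2"
      by (simp add: power2_eq_square algebra_simps)
    ultimately show ?thesis by simp
  qed
qed

lemma jumping_primitive_lower:
  assumes "a \<le> b"
  shows "jumping_primitive a b s \<ge> jumping_primitive a b t + jumping a b t * (s - t) + a / 2 * (s - t)\<^sup>2"
  using mult_left_mono[OF neg_part_sq_taylor(1)[of t s], of "b - a"] assms
  unfolding jumping_eq jumping_primitive_eq by (simp add: power2_eq_square field_simps)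

lemma jumping_primitive_upper:
  assumes "a \<le> b"
  shows "jumping_primitive a b s \<le> jumping_primitive a b t + jumping a b t * (s - t) + b / 2 * (s - t)\<^sup>2"
  using mult_left_mono[OF neg_part_sq_taylor(2)[of s t], of "b - a"] assms
  unfolding jumping_eq jumping_primitive_eq by (simp add: power2_eq_square field_simps)

lemma continuous_on_pos_part [continuous_intros]: "continuous_on S pos_part"
  unfolding pos_part_def by (intro continuous_intros)

lemma continuous_on_neg_part [continuous_intros]: "continuous_on S neg_part"
  unfolding neg_part_def by (intro continuous_intros)

lemma borel_measurable_pos_neg_part [measurable]:
  "pos_part \<in> borel_measurable borel" "neg_part \<in> borel_measurable borel"
  "jumping a b \<in> borel_measurable borel" "jumping_primitive a b \<in> borel_measurable borel"
  unfolding pos_part_def[abs_def] neg_part_def[abs_def] jumping_def[abs_def] jumping_primitive_def[abs_def]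
  by measurable

lemma continuous_on_jumping: "continuous_on UNIV (jumping a b)"
  unfolding jumping_def[abs_def] by (intro continuous_intros)

lemma abs_jumping_le:
  assumes "0 \<le> a" "a \<le> b"
  shows "\<bar>jumping a b t\<bar> \<le> b * \<bar>t\<bar>"
proof -
  obtain q where "a \<le> q" "q \<le> b" "jumping a b t - jumping a b 0 = q * (t - 0)"
    using jumping_difference[OF assms(2)] .
  moreover have "jumping a b 0 = 0" by (simp add: jumping_def pos_part_def neg_part_def)
  ultimately show ?thesis using assms by (simp add: abs_mult mult_right_mono)
qed

lemma sq_integrable_jumping:
  assumes "sq_integrable M u" "0 \<le> a" "a \<le> b"
  shows "sq_integrable M (\<lambda>x. jumping a b (u x))"
proof (rule sq_integrable_bound[OF sq_integrable_cmult[OF assms(1), of b]])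
  show "(\<lambda>x. jumping a b (u x)) \<in> borel_measurable M"
    using sq_integrable_measurable[OF assms(1)] by measurable
  show "AE x in M. \<bar>jumping a b (u x)\<bar> \<le> \<bar>b * u x\<bar>"
    using abs_jumping_le[OF assms(2,3)] assms(2,3) by (simp add: abs_mult)
qed

lemma sq_integrable_neg_part:
  assumes "sq_integrable M u"
  shows "sq_integrable M (\<lambda>x. neg_part (u x))"
  by (rule sq_integrable_bound[OF assms])
     (use sq_integrable_measurable[OF assms] in \<open>auto simp: neg_part_def max_def\<close>)

lemma integrable_jumping_primitive:
  assumes "sq_integrable M u" "0 \<le> a" "a \<le> b"
  shows "integrable M (\<lambda>x. jumping_primitive a b (u x))"
  using integrable_mult_right[OF sq_integrable_mult[OF sq_integrable_jumping[OF assms] assms(1)], of "1/2"]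
  by (simp add: jumping_mult_self)

section \<open>Energies in the coefficients of an orthonormal system\<close>

text \<open>
  The first-order condition at a maximum, for functions known only up to a quadratic error.
\<close>

lemma quadratic_nonpos_imp_linear_zero:
  fixes D C :: real
  assumes "\<And>t. t * D + t\<^sup>2 * C \<le> 0"
  shows "D = 0"
proof (rule ccontr)
  assume D: "D \<noteq> 0"
  define s where "s = 1 / (\<bar>C\<bar> + 1)"
  have s: "0 < s" "s * \<bar>C\<bar> < 1" by (simp_all add: s_def)
  have "0 \<ge> s * D\<^sup>2 * (1 + s * C)"
    using assms[of "s * D"] by (simp add: power2_eq_square algebra_simps)
  moreover have "0 < s * D\<^sup>2 * (1 + s * C)"
  proof (intro mult_pos_pos s)
    have "s * - \<bar>C\<bar> \<le> s * C" using s(1) by (intro mult_left_mono) auto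
    then show "0 < 1 + s * C" using s(2) by simp
  qed (use D in simp)
  ultimately show False by linarith
qed

locale orthonormal_system = finite_measure M for M :: "'a measure" +
  fixes e :: "nat \<Rightarrow> 'a \<Rightarrow> real"
  assumes e_sq: "sq_integrable M (e i)"
    and e_orthonormal: "(\<integral>x. e i x * e j x \<partial>M) = (if i = j then 1 else 0)"
begin

definition comb :: "nat \<Rightarrow> (nat \<Rightarrow> real) \<Rightarrow> 'a \<Rightarrow> real" where
  "comb n c x = (\<Sum>i<n. c i * e i x)"

lemma comb_sq: "sq_integrable M (comb n c)"
  unfolding comb_def[abs_def] by (intro sq_integrable_sum sq_integrable_cmult e_sq)

lemma comb_measurable [measurable]: "comb n c \<in> borel_measurable M"
  by (rule sq_integrable_measurable[OF comb_sq])

lemma e_measurable [measurable]: "e i \<in> borel_measurable M"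
  by (rule sq_integrable_measurable[OF e_sq])

lemma comb_add: "comb n (\<lambda>i. c i + d i) x = comb n c x + comb n d x"
  by (simp add: comb_def distrib_right sum.distrib)

lemma comb_diff: "comb n (\<lambda>i. c i - d i) x = comb n c x - comb n d x"
  by (simp add: comb_def left_diff_distrib sum_subtractf)

lemma comb_cmult: "comb n (\<lambda>i. t * c i) x = t * comb n c x"
  by (simp add: comb_def sum_distrib_left mult.assoc)

lemma integral_comb:
  assumes "sq_integrable M g"
  shows "(\<integral>x. g x * comb n c x \<partial>M) = (\<Sum>i<n. (\<integral>x. g x * e i x \<partial>M) * c i)"
proof -
  have "(\<integral>x. g x * comb n c x \<partial>M) = (\<integral>x. (\<Sum>i<n. c i * (g x * e i x)) \<partial>M)"
    by (simp add: comb_def sum_distrib_left algebra_simps)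
  also have "\<dots> = (\<Sum>i<n. c i * (\<integral>x. g x * e i x \<partial>M))"
    using sq_integrable_mult[OF assms e_sq] by (subst Bochner_Integration.integral_sum) auto
  finally show ?thesis by (simp add: mult.commute)
qed

lemma integral_comb_e: "(\<integral>x. comb n c x * e j x \<partial>M) = (if j < n then c j else 0)"
proof -
  have "(\<integral>x. comb n c x * e j x \<partial>M) = (\<Sum>i<n. (\<integral>x. e j x * e i x \<partial>M) * c i)"
    by (subst integral_comb[OF e_sq, symmetric]) (simp add: mult.commute)
  also have "\<dots> = (if j < n then c j else 0)"
    unfolding e_orthonormal by (simp add: if_distrib[of "\<lambda>y. y * _"] cong: if_cong)
  finally show ?thesis .
qed

lemma integral_comb_comb: "(\<integral>x. comb n c x * comb n d x \<partial>M) = (\<Sum>i<n. c i * d i)"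
  unfolding integral_comb[OF comb_sq] integral_comb_e by (simp add: if_distrib[of "\<lambda>y. y * _"] cong: if_cong)

lemma integral_comb_sq: "(\<integral>x. (comb n c x)\<^sup>2 \<partial>M) = (\<Sum>i<n. (c i)\<^sup>2)"
  using integral_comb_comb[of n c c] by (simp add: power2_eq_square)

end

text \<open>
  The quadratic form \<open>\<Sum> \<mu>\<^sub>i c\<^sub>i\<^sup>2\<close> lies below \<open>a\<close> on the low modes \<open>i < k\<close> and above \<open>a\<close> on the high modes \<open>i \<ge> k\<close>, with
  margins \<open>\<kappa>\<close> and \<open>\<gamma>\<close>. In the application \<open>\<mu>\<close> lists the eigenvalues, and \<open>b\<close> is the threshold.
\<close>

locale saddle_gap = orthonormal_system +
  fixes \<mu> :: "nat \<Rightarrow> real" and k :: nat and a b \<kappa> \<gamma> :: real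
  assumes k_pos: "0 < k" and a_pos: "0 < a" and ab: "a \<le> b" and \<kappa>_pos: "0 < \<kappa>" and \<gamma>_pos: "0 < \<gamma>"
    and low_gap: "i < k \<Longrightarrow> \<mu> i \<le> a - \<kappa>"
    and high_gap: "k \<le> i \<Longrightarrow> a + \<gamma> \<le> \<mu> i"
begin

definition Low :: "(nat \<Rightarrow> real) set" where
  "Low = {c. \<forall>i\<ge>k. c i = 0}"

definition High :: "nat \<Rightarrow> (nat \<Rightarrow> real) set" where
  "High n = {d. \<forall>i. i < k \<or> n \<le> i \<longrightarrow> d i = 0}"

definition energy :: "real \<Rightarrow> nat \<Rightarrow> (nat \<Rightarrow> real) \<Rightarrow> real" where
  "energy q n c = (\<Sum>i<n. \<mu> i * (c i)\<^sup>2) / 2 - (\<integral>x. jumping_primitive a q (comb n c x) \<partial>M)"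

text \<open>
  The derivative at \<open>c\<close>, in the direction \<open>z\<close>, of the energy.
\<close>

definition energy_deriv :: "real \<Rightarrow> nat \<Rightarrow> (nat \<Rightarrow> real) \<Rightarrow> (nat \<Rightarrow> real) \<Rightarrow> real" where
  "energy_deriv q n c z = (\<Sum>i<n. \<mu> i * c i * z i) - (\<integral>x. jumping a q (comb n c x) * comb n z x \<partial>M)"

lemma low_form:
  assumes "z \<in> Low"
  shows "(\<Sum>i<n. \<mu> i * (z i)\<^sup>2) \<le> (a - \<kappa>) * (\<Sum>i<n. (z i)\<^sup>2)"
  unfolding sum_distrib_left
proof (rule sum_mono)
  fix i
  show "\<mu> i * (z i)\<^sup>2 \<le> (a - \<kappa>) * (z i)\<^sup>2"
    using assms low_gap[of i] by (cases "i < k") (auto simp: Low_def intro: mult_right_mono)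
qed

lemma high_form:
  assumes "d \<in> High n"
  shows "(a + \<gamma>) * (\<Sum>i<n. (d i)\<^sup>2) \<le> (\<Sum>i<n. \<mu> i * (d i)\<^sup>2)"
  unfolding sum_distrib_left
proof (rule sum_mono)
  fix i
  show "(a + \<gamma>) * (d i)\<^sup>2 \<le> \<mu> i * (d i)\<^sup>2"
    using assms high_gap[of i] by (cases "i < k") (auto simp: High_def intro: mult_right_mono)
qed

lemma Low_High_mult: "c \<in> Low \<Longrightarrow> d \<in> High n \<Longrightarrow> c i * d i = 0"
  by (cases "i < k") (auto simp: Low_def High_def)

lemma Low_High_sq: "c \<in> Low \<Longrightarrow> d \<in> High n \<Longrightarrow> (c i + d i)\<^sup>2 = (c i)\<^sup>2 + (d i)\<^sup>2"
  using Low_High_mult[of c d n i] by (simp add: power2_sum)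

text \<open>
  Euler's identity: the energy is positively homogeneous of degree two.
\<close>

lemma energy_self: "energy_deriv q n c c = 2 * energy q n c"
  by (simp add: energy_deriv_def energy_def jumping_mult_self power2_eq_square mult.assoc)

lemma energy_expand:
  "(\<Sum>i<n. \<mu> i * (c i + z i)\<^sup>2) = (\<Sum>i<n. \<mu> i * (c i)\<^sup>2) + 2 * (\<Sum>i<n. \<mu> i * c i * z i) + (\<Sum>i<n. \<mu> i * (z i)\<^sup>2)"
  by (simp add: power2_sum algebra_simps sum.distrib sum_distrib_left)

text \<open>
  With \<open>low_form\<close> this bound says that the energy is uniformly concave in the low modes.
\<close>

lemma energy_taylor_upper:
  assumes "a \<le> q"
  shows "energy q n (\<lambda>i. c i + z i) \<le> energy q n c + energy_deriv q n c z
    + ((\<Sum>i<n. \<mu> i * (z i)\<^sup>2) - a * (\<Sum>i<n. (z i)\<^sup>2)) / 2"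
proof -
  have aq: "0 \<le> a" using a_pos by simp
  have int: "integrable M (\<lambda>x. jumping_primitive a q (comb n c x))"
    "integrable M (\<lambda>x. jumping a q (comb n c x) * comb n z x)"
    "integrable M (\<lambda>x. (comb n z x)\<^sup>2)"
    "integrable M (\<lambda>x. jumping_primitive a q (comb n (\<lambda>i. c i + z i) x))"
    by (intro integrable_jumping_primitive[OF comb_sq aq assms] sq_integrable_square[OF comb_sq]
        sq_integrable_mult[OF sq_integrable_jumping[OF comb_sq aq assms] comb_sq])+
  have "(\<integral>x. jumping_primitive a q (comb n c x) + jumping a q (comb n c x) * comb n z x + a / 2 * (comb n z x)\<^sup>2 \<partial>M)
      \<le> (\<integral>x. jumping_primitive a q (comb n (\<lambda>i. c i + z i) x) \<partial>M)"
  proof (rule integral_mono)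
    fix x
    show "jumping_primitive a q (comb n c x) + jumping a q (comb n c x) * comb n z x + a / 2 * (comb n z x)\<^sup>2
        \<le> jumping_primitive a q (comb n (\<lambda>i. c i + z i) x)"
      using jumping_primitive_lower[OF assms, of "comb n c x" "comb n c x + comb n z x"] by (simp add: comb_add)
  qed (use int in auto)
  then show ?thesis
    using int unfolding energy_def energy_deriv_def energy_expand integral_comb_sq[symmetric] by (simp add: field_simps)
qed

lemma energy_taylor_lower:
  assumes "a \<le> q"
  shows "energy q n (\<lambda>i. c i + z i) \<ge> energy q n c + energy_deriv q n c z
    + ((\<Sum>i<n. \<mu> i * (z i)\<^sup>2) - q * (\<Sum>i<n. (z i)\<^sup>2)) / 2"
proof -
  have aq: "0 \<le> a" using a_pos by simp
  have int: "integrable M (\<lambda>x. jumping_primitive a q (comb n c x))"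
    "integrable M (\<lambda>x. jumping a q (comb n c x) * comb n z x)"
    "integrable M (\<lambda>x. (comb n z x)\<^sup>2)"
    "integrable M (\<lambda>x. jumping_primitive a q (comb n (\<lambda>i. c i + z i) x))"
    by (intro integrable_jumping_primitive[OF comb_sq aq assms] sq_integrable_square[OF comb_sq]
        sq_integrable_mult[OF sq_integrable_jumping[OF comb_sq aq assms] comb_sq])+
  have "(\<integral>x. jumping_primitive a q (comb n (\<lambda>i. c i + z i) x) \<partial>M)
      \<le> (\<integral>x. jumping_primitive a q (comb n c x) + jumping a q (comb n c x) * comb n z x + q / 2 * (comb n z x)\<^sup>2 \<partial>M)"
  proof (rule integral_mono)
    fix x
    show "jumping_primitive a q (comb n (\<lambda>i. c i + z i) x)
        \<le> jumping_primitive a q (comb n c x) + jumping a q (comb n c x) * comb n z x + q / 2 * (comb n z x)\<^sup>2"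
      using jumping_primitive_upper[OF assms, of "comb n c x + comb n z x" "comb n c x"] by (simp add: comb_add)
  qed (use int in auto)
  then show ?thesis
    using int unfolding energy_def energy_deriv_def energy_expand integral_comb_sq[symmetric] by (simp add: field_simps)
qed

text \<open>
  The low modes \<open>c\<close> are a critical point of the energy with slope \<open>b\<close> when the high modes \<open>d\<close> are held fixed.
  The maximisers are used only through this equation and the sign of the energy.
\<close>

definition low_critical :: "nat \<Rightarrow> (nat \<Rightarrow> real) \<Rightarrow> (nat \<Rightarrow> real) \<Rightarrow> bool" where
  "low_critical n c d \<longleftrightarrow> c \<in> Low \<and> (\<forall>z\<in>Low. energy_deriv b n (\<lambda>i. c i + d i) z = 0)"

lemma energy_deriv_cmult: "energy_deriv q n c (\<lambda>i. t * z i) = t * energy_deriv q n c z"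
  by (simp add: energy_deriv_def comb_cmult sum_distrib_left right_diff_distrib mult.left_commute)

lemma maximizer_low_critical:
  assumes "c \<in> Low"
    and max: "\<And>c'. c' \<in> Low \<Longrightarrow> energy b n (\<lambda>i. c' i + d i) \<le> energy b n (\<lambda>i. c i + d i)"
  shows "low_critical n c d"
  unfolding low_critical_def
proof (intro conjI ballI assms(1))
  fix z assume z: "z \<in> Low"
  let ?D = "energy_deriv b n (\<lambda>i. c i + d i) z"
  let ?C = "((\<Sum>i<n. \<mu> i * (z i)\<^sup>2) - b * (\<Sum>i<n. (z i)\<^sup>2)) / 2"
  have t: "t * ?D + t\<^sup>2 * ?C \<le> 0" for t
  proof -
    have "(\<lambda>i. c i + t * z i) \<in> Low"
      using assms(1) z by (simp add: Low_def)
    from max[OF this] have "energy b n (\<lambda>i. (c i + d i) + t * z i) \<le> energy b n (\<lambda>i. c i + d i)"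
      by (simp add: algebra_simps)
    with energy_taylor_lower[OF ab, of n "\<lambda>i. c i + d i" "\<lambda>i. t * z i"]
    have "energy_deriv b n (\<lambda>i. c i + d i) (\<lambda>i. t * z i) +
        ((\<Sum>i<n. \<mu> i * (t * z i)\<^sup>2) - b * (\<Sum>i<n. (t * z i)\<^sup>2)) / 2 \<le> 0"
      by linarith
    moreover have "(\<Sum>i<n. \<mu> i * (t * z i)\<^sup>2) = t\<^sup>2 * (\<Sum>i<n. \<mu> i * (z i)\<^sup>2)"
      "(\<Sum>i<n. (t * z i)\<^sup>2) = t\<^sup>2 * (\<Sum>i<n. (z i)\<^sup>2)"
      by (simp_all add: power_mult_distrib sum_distrib_left mult.left_commute)
    ultimately show ?thesis by (simp add: energy_deriv_cmult algebra_simps)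
  qed
  show "?D = 0"
    by (rule quadratic_nonpos_imp_linear_zero[OF t])
qed

lemma Low_diff: "c \<in> Low \<Longrightarrow> c' \<in> Low \<Longrightarrow> (\<lambda>i. c i - c' i) \<in> Low"
  by (simp add: Low_def)

lemma High_diff: "c \<in> High n \<Longrightarrow> c' \<in> High n \<Longrightarrow> (\<lambda>i. c i - c' i) \<in> High n"
  by (simp add: High_def)

text \<open>
  Subtract the two equations, test with \<open>c - c'\<close>, and use that the derivative of the energy is strongly monotone
  in the low modes and Lipschitz in the high ones. For \<open>d = d'\<close> this is uniqueness; it also gives
  continuity of the maximiser as a function of \<open>d\<close>.
\<close>

lemma low_critical_lipschitz:
  assumes crit: "low_critical n c d" "low_critical n c' d'" and d: "d \<in> High n" "d' \<in> High n"
  shows "(\<Sum>i<n. (c i - c' i)\<^sup>2) \<le> (b / \<kappa>)\<^sup>2 * (\<Sum>i<n. (d i - d' i)\<^sup>2)"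
proof -
  define z where "z = (\<lambda>i. c i - c' i)"
  define y where "y = (\<lambda>i. d i - d' i)"
  let ?u = "comb n (\<lambda>i. c i + d i)" and ?u' = "comb n (\<lambda>i. c' i + d' i)"
  have z: "z \<in> Low" and y: "y \<in> High n"
    using crit d Low_diff High_diff by (simp_all add: low_critical_def z_def y_def)
  have a0: "0 \<le> a" using a_pos by simp
  have intN: "integrable M (\<lambda>x. jumping a b (comb n w x) * comb n z x)" for w
    by (intro sq_integrable_mult sq_integrable_jumping comb_sq a0 ab)
  have "(\<Sum>i<n. \<mu> i * (z i)\<^sup>2) = (\<Sum>i<n. \<mu> i * (c i + d i) * z i) - (\<Sum>i<n. \<mu> i * (c' i + d' i) * z i)"
    unfolding sum_subtractf[symmetric]
  proof (rule sum.cong[OF refl])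
    fix i
    have "\<mu> i * (c i + d i) * z i - \<mu> i * (c' i + d' i) * z i = \<mu> i * (z i * z i) + \<mu> i * (z i * y i)"
      by (simp add: z_def y_def algebra_simps)
    then show "\<mu> i * (z i)\<^sup>2 = \<mu> i * (c i + d i) * z i - \<mu> i * (c' i + d' i) * z i"
      using Low_High_mult[OF z y] by (simp add: power2_eq_square)
  qed
  also have "\<dots> = (\<integral>x. jumping a b (?u x) * comb n z x \<partial>M) - (\<integral>x. jumping a b (?u' x) * comb n z x \<partial>M)"
    using crit z unfolding low_critical_def energy_deriv_def by force
  also have "\<dots> = (\<integral>x. (jumping a b (?u x) - jumping a b (?u' x)) * comb n z x \<partial>M)"
    using intN by (simp add: left_diff_distrib)
  also have "\<dots> \<ge> (\<integral>x. (a - \<kappa> / 2) * (comb n z x)\<^sup>2 - b\<^sup>2 / (2 * \<kappa>) * (comb n y x)\<^sup>2 \<partial>M)"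
  proof (rule integral_mono)
    show "integrable M (\<lambda>x. (jumping a b (?u x) - jumping a b (?u' x)) * comb n z x)"
      using intN by (simp add: left_diff_distrib)
    show "integrable M (\<lambda>x. (a - \<kappa> / 2) * (comb n z x)\<^sup>2 - b\<^sup>2 / (2 * \<kappa>) * (comb n y x)\<^sup>2)"
      using sq_integrable_square[OF comb_sq] by simp
    fix x
    let ?p = "comb n z x" and ?r = "comb n y x"
    have diff: "?u x - ?u' x = ?p + ?r"
      by (simp add: comb_add comb_diff z_def y_def)
    obtain q where q: "a \<le> q" "q \<le> b" "jumping a b (?u x) - jumping a b (?u' x) = q * (?u x - ?u' x)"
      using jumping_difference[OF ab] .
    have "0 \<le> (\<kappa> * ?p + q * ?r)\<^sup>2" by simp
    then have "- (\<kappa>\<^sup>2 * ?p\<^sup>2 + q\<^sup>2 * ?r\<^sup>2) \<le> 2 * \<kappa> * (q * ?r * ?p)"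
      by (simp add: power2_eq_square algebra_simps)
    then have "- (\<kappa> / 2 * ?p\<^sup>2 + q\<^sup>2 / (2 * \<kappa>) * ?r\<^sup>2) \<le> q * ?r * ?p"
      using \<kappa>_pos by (simp add: field_simps power2_eq_square)
    moreover have "q\<^sup>2 / (2 * \<kappa>) * ?r\<^sup>2 \<le> b\<^sup>2 / (2 * \<kappa>) * ?r\<^sup>2"
      using q a0 \<kappa>_pos by (intro mult_right_mono divide_right_mono power_mono) auto
    moreover have "a * ?p\<^sup>2 \<le> q * ?p\<^sup>2"
      using q by (intro mult_right_mono) auto
    moreover have "(jumping a b (?u x) - jumping a b (?u' x)) * ?p = q * ?p\<^sup>2 + q * ?r * ?p"
      unfolding q(3) diff by (simp add: power2_eq_square algebra_simps)
    ultimately show "(a - \<kappa> / 2) * ?p\<^sup>2 - b\<^sup>2 / (2 * \<kappa>) * ?r\<^sup>2 \<le> (jumping a b (?u x) - jumping a b (?u' x)) * ?p"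
      by (simp add: left_diff_distrib)
  qed
  also have "(\<integral>x. (a - \<kappa> / 2) * (comb n z x)\<^sup>2 - b\<^sup>2 / (2 * \<kappa>) * (comb n y x)\<^sup>2 \<partial>M)
      = (a - \<kappa> / 2) * (\<Sum>i<n. (z i)\<^sup>2) - b\<^sup>2 / (2 * \<kappa>) * (\<Sum>i<n. (y i)\<^sup>2)"
    using sq_integrable_square[OF comb_sq] by (simp add: integral_comb_sq)
  finally have "(a - \<kappa> / 2) * (\<Sum>i<n. (z i)\<^sup>2) - b\<^sup>2 / (2 * \<kappa>) * (\<Sum>i<n. (y i)\<^sup>2) \<le> (a - \<kappa>) * (\<Sum>i<n. (z i)\<^sup>2)"
    using low_form[OF z, of n] by linarith
  then have "\<kappa> / 2 * (\<Sum>i<n. (z i)\<^sup>2) \<le> b\<^sup>2 / (2 * \<kappa>) * (\<Sum>i<n. (y i)\<^sup>2)"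
    by (simp add: algebra_simps)
  then have "(\<Sum>i<n. (z i)\<^sup>2) \<le> (b / \<kappa>)\<^sup>2 * (\<Sum>i<n. (y i)\<^sup>2)"
    using \<kappa>_pos by (simp add: field_simps power2_eq_square)
  then show ?thesis by (simp add: z_def y_def)
qed

lemma energy_neg_part:
  assumes "a \<le> q"
  shows "2 * energy q n c = (\<Sum>i<n. \<mu> i * (c i)\<^sup>2) - a * (\<Sum>i<n. (c i)\<^sup>2)
    - (q - a) * (\<integral>x. (neg_part (comb n c x))\<^sup>2 \<partial>M)"
  using sq_integrable_square[OF comb_sq[of n c]] sq_integrable_square[OF sq_integrable_neg_part[OF comb_sq[of n c]]]
  by (simp add: energy_def jumping_primitive_eq integral_comb_sq field_simps)

text \<open>
  Let \<open>\<eta>\<close> be the squared \<open>L\<^sup>2\<close> norm of the negative part of \<open>u = c + d\<close>. The equation for \<open>c\<close>, tested with \<open>c\<close>, bounds the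
  contribution of the low modes by \<open>\<eta>\<close>, whence \<open>2 E\<^sub>b \<ge> \<gamma> \<bar>d\<bar>\<^sup>2 - A \<eta>\<close> with \<open>A = (b - a)\<^sup>2 / \<kappa> + (b - a)\<close>. On the other hand
  \<open>2 E\<^sub>\<beta> = 2 E\<^sub>b + (b - \<beta>) \<eta>\<close>, and \<open>E\<^sub>b \<ge> 0\<close> may be replaced by \<open>\<theta> E\<^sub>b\<close>. The factor on the left-hand side is \<open>\<theta> \<gamma>\<close>,
  where \<open>\<theta> = (b - \<beta>) / (A + (b - \<beta>))\<close> is chosen so that \<open>(b - \<beta>) \<eta>\<close> absorbs \<open>\<theta> A \<eta>\<close>.
\<close>

lemma low_critical_energy_lower:
  assumes crit: "low_critical n c d" and d: "d \<in> High n"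
    and nonneg: "0 \<le> energy b n (\<lambda>i. c i + d i)" and \<beta>: "a \<le> \<beta>" "\<beta> < b"
  shows "(b - \<beta>) / ((b - a)\<^sup>2 / \<kappa> + (b - a) + (b - \<beta>)) * \<gamma> * (\<Sum>i<n. (d i)\<^sup>2) \<le> 2 * energy \<beta> n (\<lambda>i. c i + d i)"
proof -
  let ?u = "comb n (\<lambda>i. c i + d i)"
  define \<eta> where "\<eta> = (\<integral>x. (neg_part (?u x))\<^sup>2 \<partial>M)"
  define A where "A = (b - a)\<^sup>2 / \<kappa> + (b - a)"
  define \<theta> where "\<theta> = (b - \<beta>) / (A + (b - \<beta>))"
  define C where "C = (\<Sum>i<n. (c i)\<^sup>2)"
  define D where "D = (\<Sum>i<n. (d i)\<^sup>2)"
  define X where "X = (b - a) * (\<integral>x. neg_part (?u x) * comb n c x \<partial>M)"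
  have c: "c \<in> Low" using crit by (simp add: low_critical_def)
  have negsq: "sq_integrable M (\<lambda>x. neg_part (?u x))"
    by (rule sq_integrable_neg_part[OF comb_sq])
  have A: "0 \<le> A" using ab \<kappa>_pos by (simp add: A_def)
  have \<theta>: "0 \<le> \<theta>" "\<theta> \<le> 1" "\<theta> * (A + (b - \<beta>)) = b - \<beta>"
    using A \<beta> by (auto simp: \<theta>_def)
  have \<theta>A: "\<theta> * A \<le> b - \<beta>"
    using \<theta>(3) mult_nonneg_nonneg[OF \<theta>(1), of "b - \<beta>"] \<beta> by (simp add: distrib_left)
  have \<eta>: "0 \<le> \<eta>" by (simp add: \<eta>_def)
  have X_eq: "X = a * C - (\<Sum>i<n. \<mu> i * (c i)\<^sup>2)"
  proof -
    have "(\<Sum>i<n. \<mu> i * (c i + d i) * c i) = (\<Sum>i<n. \<mu> i * (c i)\<^sup>2)"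
      using Low_High_mult[OF c d] by (intro sum.cong) (auto simp: power2_eq_square algebra_simps)
    moreover have "(\<integral>x. jumping a b (?u x) * comb n c x \<partial>M) = a * (\<integral>x. ?u x * comb n c x \<partial>M) - X"
      using sq_integrable_mult[OF negsq comb_sq] sq_integrable_mult[OF comb_sq comb_sq]
      by (simp add: X_def jumping_eq left_diff_distrib mult.assoc)
    moreover have "(\<integral>x. ?u x * comb n c x \<partial>M) = C"
      unfolding integral_comb_comb C_def
      using Low_High_mult[OF c d] by (intro sum.cong) (auto simp: power2_eq_square algebra_simps)
    moreover have "energy_deriv b n (\<lambda>i. c i + d i) c = 0"
      using crit c by (simp add: low_critical_def)
    ultimately show ?thesis by (simp add: energy_deriv_def)
  qed
  then have X_low: "\<kappa> * C \<le> X"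
    using low_form[OF c, of n] by (simp add: C_def left_diff_distrib)
  have "X \<le> (b - a)\<^sup>2 / \<kappa> * \<eta>"
  proof -
    have "X = (\<integral>x. (b - a) * (neg_part (?u x) * comb n c x) \<partial>M)"
      by (simp add: X_def)
    also have "\<dots> \<le> (\<integral>x. (b - a)\<^sup>2 / (2 * \<kappa>) * (neg_part (?u x))\<^sup>2 + \<kappa> / 2 * (comb n c x)\<^sup>2 \<partial>M)"
    proof (rule integral_mono)
      fix x
      have "0 \<le> ((b - a) * neg_part (?u x) - \<kappa> * comb n c x)\<^sup>2" by simp
      then show "(b - a) * (neg_part (?u x) * comb n c x)
          \<le> (b - a)\<^sup>2 / (2 * \<kappa>) * (neg_part (?u x))\<^sup>2 + \<kappa> / 2 * (comb n c x)\<^sup>2"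
        using \<kappa>_pos by (simp add: field_simps power2_eq_square)
    qed (use sq_integrable_mult[OF negsq comb_sq] sq_integrable_square[OF negsq] sq_integrable_square[OF comb_sq] in simp_all)
    also have "\<dots> = (b - a)\<^sup>2 / (2 * \<kappa>) * \<eta> + \<kappa> / 2 * C"
      using sq_integrable_square[OF negsq] sq_integrable_square[OF comb_sq]
      by (simp add: \<eta>_def C_def integral_comb_sq)
    finally show ?thesis using X_low by (simp add: field_simps)
  qed
  moreover have E: "2 * energy q n (\<lambda>i. c i + d i) = - X + ((\<Sum>i<n. \<mu> i * (d i)\<^sup>2) - a * D) - (q - a) * \<eta>"
    if "a \<le> q" for q
    unfolding energy_neg_part[OF that] X_eq C_def D_def \<eta>_def Low_High_sq[OF c d]
    by (simp add: sum.distrib algebra_simps)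
  moreover have "\<gamma> * D \<le> (\<Sum>i<n. \<mu> i * (d i)\<^sup>2) - a * D"
    using high_form[OF d] by (simp add: D_def algebra_simps)
  ultimately have "\<gamma> * D - A * \<eta> \<le> 2 * energy b n (\<lambda>i. c i + d i)"
    using E[OF ab] unfolding A_def distrib_right by linarith
  then have "\<theta> * (\<gamma> * D - A * \<eta>) \<le> \<theta> * (2 * energy b n (\<lambda>i. c i + d i))"
    using \<theta>(1) by (rule mult_left_mono)
  also have "\<dots> \<le> 2 * energy b n (\<lambda>i. c i + d i)"
    using \<theta> nonneg by (intro mult_left_le_one_le) auto
  also have "\<dots> = 2 * energy \<beta> n (\<lambda>i. c i + d i) - (b - \<beta>) * \<eta>"
    unfolding E[OF ab] E[OF \<beta>(1)] by (simp add: algebra_simps)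
  finally have "\<theta> * \<gamma> * D + (b - \<beta> - \<theta> * A) * \<eta> \<le> 2 * energy \<beta> n (\<lambda>i. c i + d i)"
    by (simp add: algebra_simps)
  moreover have "0 \<le> (b - \<beta> - \<theta> * A) * \<eta>"
    using \<theta>A \<eta> by simp
  ultimately show ?thesis
    by (simp add: \<theta>_def A_def D_def)
qed

end

section \<open>Galerkin solutions\<close>

lemma tendsto_coordinate:
  fixes u :: "nat \<Rightarrow> nat \<Rightarrow> real"
  assumes "u \<longlonglongrightarrow> w"
  shows "(\<lambda>m. u m i) \<longlonglongrightarrow> w i"
proof -
  have "isCont (\<lambda>x. x i :: real) w"
    using continuous_on_product_coordinates[of i] continuous_on_eq_continuous_at open_UNIV by blast
  then show ?thesis
    using isCont_tendsto_compose[OF _ assms, of "\<lambda>x. x i"] by blast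
qed

context orthonormal_system
begin

lemma comb_tendsto:
  assumes "\<And>i. (\<lambda>m. u m i) \<longlonglongrightarrow> w i"
  shows "(\<lambda>m. comb n (u m) x) \<longlonglongrightarrow> comb n w x"
  unfolding comb_def by (intro tendsto_sum tendsto_mult_right assms)

text \<open>
  Combinations with converging coefficients converge pointwise, and they stay below a fixed square-integrable
  function as the coefficients are bounded; dominated convergence applies.
\<close>

lemma continuous_on_superposition:
  assumes g: "continuous_on UNIV g" and growth: "\<And>t. \<bar>g t\<bar> \<le> A * \<bar>t\<bar> + B"
    and AB: "0 \<le> A" "0 \<le> B" and h: "sq_integrable M h"
  shows "continuous_on S (\<lambda>c. \<integral>x. (g (comb n c x) + h x) * e j x \<partial>M)"
proof (rule continuous_on_sequentiallyI)
  fix u :: "nat \<Rightarrow> nat \<Rightarrow> real" and w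
  assume "u \<longlonglongrightarrow> w"
  then have u: "(\<lambda>m. u m i) \<longlonglongrightarrow> w i" for i by (rule tendsto_coordinate)
  have [measurable]: "g \<in> borel_measurable borel"
    by (rule borel_measurable_continuous_onI[OF g])
  have [measurable]: "h \<in> borel_measurable M" by (rule sq_integrable_measurable[OF h])
  have "\<forall>i. \<exists>K. \<forall>m. \<bar>u m i\<bar> \<le> K"
    using convergent_imp_Bseq[OF convergentI[OF u]] by (auto simp: Bseq_def)
  then obtain K where K: "\<And>i m. \<bar>u m i\<bar> \<le> K i" by metis
  have "sq_integrable M (\<lambda>x. A * (\<Sum>i<n. K i * \<bar>e i x\<bar>) + B + \<bar>h x\<bar>)"
    by (intro sq_integrable_add sq_integrable_cmult sq_integrable_sum sq_integrable_abs e_sq h sq_integrable_const)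
  note dom = sq_integrable_mult[OF this sq_integrable_abs[OF e_sq[of j]]]
  show "(\<lambda>m. \<integral>x. (g (comb n (u m) x) + h x) * e j x \<partial>M) \<longlonglongrightarrow> (\<integral>x. (g (comb n w x) + h x) * e j x \<partial>M)"
  proof (rule integral_dominated_convergence[OF _ _ dom])
    show "AE x in M. (\<lambda>m. (g (comb n (u m) x) + h x) * e j x) \<longlonglongrightarrow> (g (comb n w x) + h x) * e j x"
    proof (intro AE_I2 tendsto_mult_right tendsto_add tendsto_const)
      fix x
      show "(\<lambda>m. g (comb n (u m) x)) \<longlonglongrightarrow> g (comb n w x)"
        by (rule continuous_on_tendsto_compose[OF g comb_tendsto[OF u]]) auto
    qed
    fix m
    show "AE x in M. norm ((g (comb n (u m) x) + h x) * e j x)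
        \<le> (A * (\<Sum>i<n. K i * \<bar>e i x\<bar>) + B + \<bar>h x\<bar>) * \<bar>e j x\<bar>"
    proof (intro AE_I2)
      fix x
      have "\<bar>comb n (u m) x\<bar> \<le> (\<Sum>i<n. \<bar>u m i * e i x\<bar>)"
        unfolding comb_def by (rule sum_abs)
      also have "\<dots> \<le> (\<Sum>i<n. K i * \<bar>e i x\<bar>)"
        using K by (intro sum_mono) (simp add: abs_mult mult_right_mono)
      finally have "A * \<bar>comb n (u m) x\<bar> \<le> A * (\<Sum>i<n. K i * \<bar>e i x\<bar>)"
        using AB(1) by (rule mult_left_mono)
      then have "\<bar>g (comb n (u m) x) + h x\<bar> \<le> A * (\<Sum>i<n. K i * \<bar>e i x\<bar>) + B + \<bar>h x\<bar>"
        using growth[of "comb n (u m) x"] by linarith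
      then show "norm ((g (comb n (u m) x) + h x) * e j x)
        \<le> (A * (\<Sum>i<n. K i * \<bar>e i x\<bar>) + B + \<bar>h x\<bar>) * \<bar>e j x\<bar>"
        by (simp add: abs_mult mult_right_mono)
    qed
  qed measurable
qed

end

text \<open>
  The saddle hypothesis is the consequence of the threshold condition in coefficients: over any combination
  of high modes, the energy with slope \<open>b\<close> has a nonnegative maximum in the low modes.
\<close>

locale saddle_problem = saddle_gap +
  fixes \<beta> :: real
  assumes \<beta>: "a \<le> \<beta>" "\<beta> < b"
    and saddle: "d \<in> High n \<Longrightarrow> \<exists>c\<in>Low. 0 \<le> energy b n (\<lambda>i. c i + d i) \<and>
      (\<forall>c'\<in>Low. energy b n (\<lambda>i. c' i + d i) \<le> energy b n (\<lambda>i. c i + d i))"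
begin

text \<open>
  The map \<open>S\<close> reflects the low modes at \<open>\<tau>\<close> of the high modes. It is an involution, so that in the
  pairing of \<open>G (S y)\<close> with \<open>y\<close> the point is \<open>c = S y\<close> and the test vector is \<open>S c = c + 2 z\<close> with \<open>z = \<tau> - c\<close> in the low modes.
  The bound \<open>R\<close> is built from \<open>\<kappa>\<close>, \<open>\<delta>\<close>, the Lipschitz constant of \<open>\<tau>\<close> and \<open>L\<^sup>2\<close> norms of the data, hence uniform in \<open>n\<close>.
\<close>

lemma galerkin_solution:
  assumes f: "continuous_on UNIV f" and fB: "\<And>t. \<bar>f t\<bar> \<le> B" and h: "sq_integrable M h"
  obtains R where "\<forall>n\<ge>k. \<exists>c. (\<Sum>i<n. (c i)\<^sup>2) \<le> R \<and>
    (\<forall>j<n. \<mu> j * c j = (\<integral>x. (jumping a \<beta> (comb n c x) + f (comb n c x) + h x) * e j x \<partial>M))"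
proof -
  have B: "0 \<le> B" using fB[of 0] by linarith
  have a0: "0 \<le> a" using a_pos by simp
  define L where "L = (b / \<kappa>)\<^sup>2"
  define \<delta> where "\<delta> = (b - \<beta>) / ((b - a)\<^sup>2 / \<kappa> + (b - a) + (b - \<beta>)) * \<gamma>"
  \<comment> \<open>The energy part of the pairing is at least \<open>\<delta> D + \<kappa> Z\<close> and \<open>\<bar>y\<bar>\<^sup>2 \<le> (2 L + 1) D + 2 Z\<close>, whence this \<open>\<epsilon>\<close>; at
    \<open>\<bar>y\<bar>\<^sup>2 = R2\<close> the quadratic term wins over the forcing by exactly \<open>\<epsilon> / 2\<close>.\<close>
  define \<epsilon> where "\<epsilon> = min (\<kappa> / 2) (\<delta> / (2 * L + 1))"
  define H where "H = (\<integral>x. (B + \<bar>h x\<bar>)\<^sup>2 \<partial>M)"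
  define R2 where "R2 = H / \<epsilon>\<^sup>2 + 1"
  have L: "0 \<le> L" by (simp add: L_def)
  have "0 < (b - a)\<^sup>2 / \<kappa> + (b - a) + (b - \<beta>)"
    using ab \<beta> \<kappa>_pos by (intro add_nonneg_pos add_nonneg_nonneg) auto
  then have \<delta>: "0 < \<delta>" using \<beta> \<gamma>_pos by (simp add: \<delta>_def)
  have \<epsilon>: "0 < \<epsilon>" "2 * \<epsilon> \<le> \<kappa>" "\<epsilon> * (2 * L + 1) \<le> \<delta>"
  proof -
    show "0 < \<epsilon>" using \<kappa>_pos L \<delta> by (simp add: \<epsilon>_def)
    have "\<epsilon> \<le> \<kappa> / 2" unfolding \<epsilon>_def by (rule min.cobounded1)
    then show "2 * \<epsilon> \<le> \<kappa>" by simp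
    have "\<epsilon> \<le> \<delta> / (2 * L + 1)" unfolding \<epsilon>_def by (rule min.cobounded2)
    then show "\<epsilon> * (2 * L + 1) \<le> \<delta>" using L by (simp add: pos_le_divide_eq)
  qed
  have H: "0 \<le> H" by (simp add: H_def)
  have R2: "0 < R2" using H \<epsilon> by (auto simp: R2_def intro: add_nonneg_pos)
  have hB: "sq_integrable M (\<lambda>x. B + \<bar>h x\<bar>)"
    by (intro sq_integrable_add sq_integrable_const sq_integrable_abs h)
  have fm [measurable]: "f \<in> borel_measurable borel"
    by (rule borel_measurable_continuous_onI[OF f])
  have hm [measurable]: "h \<in> borel_measurable M" by (rule sq_integrable_measurable[OF h])
  have force_sq: "sq_integrable M (\<lambda>x. f (comb n c x) + h x)" for n c
  proof (rule sq_integrable_bound[OF hB])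
    show "AE x in M. \<bar>f (comb n c x) + h x\<bar> \<le> \<bar>B + \<bar>h x\<bar>\<bar>"
    proof (intro AE_I2)
      fix x show "\<bar>f (comb n c x) + h x\<bar> \<le> \<bar>B + \<bar>h x\<bar>\<bar>" using fB[of "comb n c x"] by linarith
    qed
  qed measurable
  have "\<exists>c. (\<Sum>i<n. (c i)\<^sup>2) \<le> (8 * L + 3) * R2 \<and>
    (\<forall>j<n. \<mu> j * c j = (\<integral>x. (jumping a \<beta> (comb n c x) + f (comb n c x) + h x) * e j x \<partial>M))"
    if n: "k \<le> n" for n
  proof -
    have "\<forall>d\<in>High n. \<exists>c. low_critical n c d \<and> 0 \<le> energy b n (\<lambda>i. c i + d i)"
      using saddle maximizer_low_critical by meson
    then obtain \<tau> where \<tau>: "\<And>d. d \<in> High n \<Longrightarrow> low_critical n (\<tau> d) d"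
      "\<And>d. d \<in> High n \<Longrightarrow> 0 \<le> energy b n (\<lambda>i. \<tau> d i + d i)"
      by metis
    have \<tau>Low: "\<tau> d \<in> Low" if "d \<in> High n" for d
      using \<tau>(1)[OF that] by (simp add: low_critical_def)
    have \<tau>_lip: "(\<Sum>i<n. (\<tau> d i - \<tau> d' i)\<^sup>2) \<le> L * (\<Sum>i<n. (d i - d' i)\<^sup>2)"
      if "d \<in> High n" "d' \<in> High n" for d d'
      using low_critical_lipschitz[OF \<tau>(1)[OF that(1)] \<tau>(1)[OF that(2)] that] by (simp add: L_def)
    have zero_crit: "low_critical n (\<lambda>_. 0) (\<lambda>_. 0)"
      by (simp add: low_critical_def Low_def energy_deriv_def comb_def jumping_def pos_part_def neg_part_def)
    have \<tau>_bound: "(\<Sum>i<n. (\<tau> d i)\<^sup>2) \<le> L * (\<Sum>i<n. (d i)\<^sup>2)" if "d \<in> High n" for d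
      using low_critical_lipschitz[OF \<tau>(1)[OF that] zero_crit that] by (simp add: High_def L_def)
    define V where "V = {c::nat \<Rightarrow> real. \<forall>i\<ge>n. c i = 0}"
    define hi :: "(nat \<Rightarrow> real) \<Rightarrow> nat \<Rightarrow> real" where "hi = (\<lambda>c i. if i < k then 0 else c i)"
    define S where "S = (\<lambda>c i. if i < k then 2 * \<tau> (hi c) i - c i else c i)"
    define G where "G = (\<lambda>c j. \<mu> j * c j - (\<integral>x. (jumping a \<beta> (comb n c x) + f (comb n c x) + h x) * e j x \<partial>M))"
    have hiH: "hi c \<in> High n" if "c \<in> V" for c
      using that by (simp add: hi_def High_def V_def)
    have SV: "S c \<in> V" if "c \<in> V" for c
      using that n by (auto simp: S_def V_def)
    have hiS: "hi (S c) = hi c" for c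
      by (auto simp: hi_def S_def)
    have SS: "S (S c) = c" for c
    proof
      fix i
      have "S (S c) i = (if i < k then 2 * \<tau> (hi (S c)) i - S c i else S c i)"
        by (simp add: S_def)
      then show "S (S c) i = c i" unfolding hiS by (simp add: S_def)
    qed
    have low_sum: "(\<Sum>i<n. (c i)\<^sup>2) = (\<Sum>i<k. (c i)\<^sup>2) + (\<Sum>i<n. (hi c i)\<^sup>2)" for c :: "nat \<Rightarrow> real"
    proof -
      have split: "{..<n} = {..<k} \<union> {k..<n}" using n by auto
      show ?thesis
        unfolding split by (subst (1 2) sum.union_disjoint) (auto simp: hi_def intro!: sum.cong)
    qed
    have cont_coord: "continuous_on V (\<lambda>c. c i)" for i
      by (rule continuous_on_subset[OF continuous_on_product_coordinates subset_UNIV])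
    have \<tau>_cont: "continuous_on V (\<lambda>c. \<tau> (hi c) i)" for i
    proof (cases "i < n")
      case True
      show ?thesis
        unfolding continuous_on_def
      proof (intro ballI)
        fix c assume c: "c \<in> V"
        let ?D = "\<lambda>y. sqrt (L * (\<Sum>i<n. (hi y i - hi c i)\<^sup>2))"
        have "((\<lambda>y. y i) \<longlongrightarrow> c i) (at c within V)" for i
          using cont_coord[unfolded continuous_on_def, THEN bspec, OF c] .
        then have "((\<lambda>y. hi y i) \<longlongrightarrow> hi c i) (at c within V)" for i
          by (cases "i < k") (simp_all add: hi_def)
        then have "(?D \<longlongrightarrow> sqrt (L * (\<Sum>i<n. (hi c i - hi c i)\<^sup>2))) (at c within V)"
          by (intro tendsto_real_sqrt tendsto_mult_left tendsto_sum tendsto_power tendsto_diff tendsto_const)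
        then have lim: "(?D \<longlongrightarrow> 0) (at c within V)" by simp
        show "((\<lambda>y. \<tau> (hi y) i) \<longlongrightarrow> \<tau> (hi c) i) (at c within V)"
        proof (rule LIM_zero_cancel, rule Lim_null_comparison[OF _ lim])
          have "norm (\<tau> (hi y) i - \<tau> (hi c) i) \<le> ?D y" if "y \<in> V" for y
          proof -
            have "(\<tau> (hi y) i - \<tau> (hi c) i)\<^sup>2 \<le> (\<Sum>i<n. (\<tau> (hi y) i - \<tau> (hi c) i)\<^sup>2)"
              using True by (intro member_le_sum) auto
            also have "\<dots> \<le> L * (\<Sum>i<n. (hi y i - hi c i)\<^sup>2)"
              by (rule \<tau>_lip[OF hiH[OF that] hiH[OF c]])
            finally show ?thesis by (simp add: real_le_rsqrt)
          qed
          then show "\<forall>\<^sub>F y in at c within V. norm (\<tau> (hi y) i - \<tau> (hi c) i) \<le> ?D y"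
            by (simp add: eventually_at_filter)
        qed
      qed
    next
      case False
      have "continuous_on V (\<lambda>c. 0::real)" by (rule continuous_on_const)
      moreover have "\<tau> (hi c) i = 0" if "c \<in> V" for c
        using \<tau>Low[OF hiH[OF that]] False n by (simp add: Low_def)
      ultimately show ?thesis by (simp cong: continuous_on_cong)
    qed
    have S_cont: "continuous_on V S"
    proof (rule continuous_on_coordinatewise_then_product)
      fix i show "continuous_on V (\<lambda>c. S c i)"
        by (cases "i < k") (auto simp: S_def intro!: continuous_intros \<tau>_cont cont_coord)
    qed
    have G_cont: "continuous_on V (\<lambda>c. G c j)" for j
    proof -
      have "continuous_on V (\<lambda>c. \<integral>x. (jumping a \<beta> (comb n c x) + f (comb n c x) + h x) * e j x \<partial>M)"
      proof (rule continuous_on_superposition[where g = "\<lambda>t. jumping a \<beta> t + f t" and A = \<beta> and B = B])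
        show "continuous_on UNIV (\<lambda>t. jumping a \<beta> t + f t)"
          by (intro continuous_on_add continuous_on_jumping f)
        show "\<bar>jumping a \<beta> t + f t\<bar> \<le> \<beta> * \<bar>t\<bar> + B" for t
          using abs_jumping_le[OF a0 \<beta>(1), of t] fB[of t] by linarith
      qed (use a0 \<beta> B h in auto)
      then show ?thesis unfolding G_def by (intro continuous_intros cont_coord)
    qed
    have pairing: "(\<Sum>j<n. G c j * y j) = energy_deriv \<beta> n c y - (\<integral>x. (f (comb n c x) + h x) * comb n y x \<partial>M)" for c y
    proof -
      have Nsq: "sq_integrable M (\<lambda>x. jumping a \<beta> (comb n c x))"
        by (rule sq_integrable_jumping[OF comb_sq a0 \<beta>(1)])
      have sq: "sq_integrable M (\<lambda>x. jumping a \<beta> (comb n c x) + (f (comb n c x) + h x))"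
        by (intro sq_integrable_add[OF Nsq force_sq])
      have "(\<integral>x. (jumping a \<beta> (comb n c x) + (f (comb n c x) + h x)) * comb n y x \<partial>M)
          = (\<integral>x. jumping a \<beta> (comb n c x) * comb n y x \<partial>M) + (\<integral>x. (f (comb n c x) + h x) * comb n y x \<partial>M)"
        unfolding distrib_right
        using sq_integrable_mult[OF Nsq comb_sq] sq_integrable_mult[OF force_sq comb_sq]
        by (subst Bochner_Integration.integral_add) (simp_all add: distrib_right)
      then show ?thesis
        unfolding energy_deriv_def integral_comb[OF sq] G_def
        by (simp add: left_diff_distrib sum_subtractf add.assoc)
    qed
    have acute: "\<epsilon> / 2 * (\<Sum>i<n. (y i)\<^sup>2) - H / (2 * \<epsilon>) \<le> (\<Sum>j<n. G (S y) j * y j)" if y: "y \<in> V" for y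
    proof -
      define c where "c = S y"
      define d where "d = hi c"
      define z where "z = (\<lambda>i. if i < k then \<tau> d i - c i else 0)"
      have c: "c \<in> V" using SV[OF y] by (simp add: c_def)
      have d: "d \<in> High n" using hiH[OF c] by (simp add: d_def)
      have z: "z \<in> Low" by (simp add: z_def Low_def)
      have yc: "y = S c" by (simp add: c_def SS)
      have y_eq: "y = (\<lambda>i. c i + 2 * z i)"
        unfolding yc by (auto simp: S_def z_def d_def)
      have \<tau>d: "\<tau> d i = 0" if "k \<le> i" for i using \<tau>Low[OF d] that by (simp add: Low_def)
      have cz: "(\<lambda>i. c i + z i) = (\<lambda>i. \<tau> d i + d i)"
      proof
        fix i show "c i + z i = \<tau> d i + d i"
          using \<tau>d[of i] by (auto simp: z_def d_def hi_def)
      qed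
      define D where "D = (\<Sum>i<n. (d i)\<^sup>2)"
      define Z where "Z = (\<Sum>i<n. (z i)\<^sup>2)"
      have "energy_deriv \<beta> n c y = energy_deriv \<beta> n c c + 2 * energy_deriv \<beta> n c z"
      proof -
        have "comb n y x = comb n c x + 2 * comb n z x" for x
          unfolding y_eq by (simp add: comb_add comb_cmult)
        moreover have "integrable M (\<lambda>x. jumping a \<beta> (comb n c x) * comb n w x)" for w
          by (intro sq_integrable_mult sq_integrable_jumping comb_sq a0 \<beta>)
        ultimately have "(\<integral>x. jumping a \<beta> (comb n c x) * comb n y x \<partial>M)
            = (\<integral>x. jumping a \<beta> (comb n c x) * comb n c x \<partial>M) + 2 * (\<integral>x. jumping a \<beta> (comb n c x) * comb n z x \<partial>M)"
          by (simp add: distrib_left mult.left_commute[of _ 2])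
        then show ?thesis
          by (simp add: energy_deriv_def y_eq distrib_left sum.distrib sum_distrib_left algebra_simps)
      qed
      moreover have "energy_deriv \<beta> n c c + 2 * energy_deriv \<beta> n c z \<ge> 2 * energy \<beta> n (\<lambda>i. c i + z i) + \<kappa> * Z"
      proof -
        define X where "X = (\<Sum>i<n. \<mu> i * (z i)\<^sup>2) - a * Z"
        have "X \<le> - (\<kappa> * Z)"
          using low_form[OF z, of n] by (simp add: X_def Z_def left_diff_distrib)
        moreover have "energy \<beta> n (\<lambda>i. c i + z i) \<le> energy \<beta> n c + energy_deriv \<beta> n c z + X / 2"
          unfolding X_def Z_def by (rule energy_taylor_upper[OF \<beta>(1)])
        ultimately show ?thesis unfolding energy_self by linarith
      qed
      moreover have "2 * energy \<beta> n (\<lambda>i. c i + z i) \<ge> \<delta> * D"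
        using low_critical_energy_lower[OF \<tau>(1)[OF d] d \<tau>(2)[OF d] \<beta>] by (simp add: cz \<delta>_def D_def)
      ultimately have E: "\<delta> * D + \<kappa> * Z \<le> energy_deriv \<beta> n c y" by linarith
      have Y: "(\<Sum>i<n. (y i)\<^sup>2) \<le> (2 * L + 1) * D + 2 * Z"
      proof -
        have "(\<Sum>i<n. (y i)\<^sup>2) \<le> (\<Sum>i<n. 2 * (\<tau> d i)\<^sup>2 + 2 * (z i)\<^sup>2 + (d i)\<^sup>2)"
        proof (rule sum_mono)
          fix i
          show "(y i)\<^sup>2 \<le> 2 * (\<tau> d i)\<^sup>2 + 2 * (z i)\<^sup>2 + (d i)\<^sup>2"
          proof (cases "i < k")
            case True
            then have "(y i)\<^sup>2 = (\<tau> d i)\<^sup>2 + (z i)\<^sup>2 + 2 * \<tau> d i * z i"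
              by (simp add: y_eq z_def power2_sum[symmetric])
            moreover have "0 \<le> (\<tau> d i - z i)\<^sup>2" "0 \<le> (d i)\<^sup>2" by simp_all
            ultimately show ?thesis unfolding power2_diff by linarith
          next
            case False
            then show ?thesis by (simp add: y_eq z_def d_def hi_def)
          qed
        qed
        also have "\<dots> = 2 * (\<Sum>i<n. (\<tau> d i)\<^sup>2) + 2 * Z + D"
          by (simp add: sum.distrib sum_distrib_left Z_def D_def)
        finally show ?thesis using \<tau>_bound[OF d] by (simp add: D_def algebra_simps)
      qed
      have D0: "0 \<le> D" and Z0: "0 \<le> Z" by (simp_all add: D_def Z_def sum_nonneg)
      have "\<epsilon> * (\<Sum>i<n. (y i)\<^sup>2) \<le> \<epsilon> * ((2 * L + 1) * D + 2 * Z)"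
        using Y \<epsilon>(1) by (intro mult_left_mono) auto
      also have "\<dots> = \<epsilon> * (2 * L + 1) * D + 2 * \<epsilon> * Z" by (simp add: algebra_simps)
      also have "\<dots> \<le> \<delta> * D + \<kappa> * Z"
        by (intro add_mono mult_right_mono \<epsilon> D0 Z0)
      finally have main: "\<epsilon> * (\<Sum>i<n. (y i)\<^sup>2) \<le> energy_deriv \<beta> n c y" using E by simp
      have "(\<integral>x. (f (comb n c x) + h x) * comb n y x \<partial>M) \<le> (\<integral>x. (B + \<bar>h x\<bar>)\<^sup>2 / (2 * \<epsilon>) + \<epsilon> / 2 * (comb n y x)\<^sup>2 \<partial>M)"
      proof (rule integral_mono)
        show "integrable M (\<lambda>x. (f (comb n c x) + h x) * comb n y x)"
          by (rule sq_integrable_mult[OF force_sq comb_sq])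
        show "integrable M (\<lambda>x. (B + \<bar>h x\<bar>)\<^sup>2 / (2 * \<epsilon>) + \<epsilon> / 2 * (comb n y x)\<^sup>2)"
          using sq_integrable_square[OF hB] sq_integrable_square[OF comb_sq] by simp
        fix x
        let ?g = "f (comb n c x) + h x"
        have "\<bar>?g\<bar> \<le> B + \<bar>h x\<bar>" using fB[of "comb n c x"] by linarith
        then have "?g\<^sup>2 \<le> (B + \<bar>h x\<bar>)\<^sup>2" using B by (simp add: abs_le_square_iff[symmetric])
        then have "?g\<^sup>2 / (2 * \<epsilon>) \<le> (B + \<bar>h x\<bar>)\<^sup>2 / (2 * \<epsilon>)" using \<epsilon>(1) by (simp add: divide_right_mono)
        moreover have "0 \<le> (?g - \<epsilon> * comb n y x)\<^sup>2 / (2 * \<epsilon>)" using \<epsilon>(1) by simp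
        moreover have "(?g - \<epsilon> * comb n y x)\<^sup>2 / (2 * \<epsilon>)
            = ?g\<^sup>2 / (2 * \<epsilon>) + \<epsilon> / 2 * (comb n y x)\<^sup>2 - ?g * comb n y x"
          using \<epsilon>(1) unfolding power2_diff by (simp add: field_simps power2_eq_square)
        ultimately show "?g * comb n y x \<le> (B + \<bar>h x\<bar>)\<^sup>2 / (2 * \<epsilon>) + \<epsilon> / 2 * (comb n y x)\<^sup>2"
          by linarith
      qed
      also have "\<dots> = H / (2 * \<epsilon>) + \<epsilon> / 2 * (\<Sum>i<n. (y i)\<^sup>2)"
        using sq_integrable_square[OF hB] sq_integrable_square[OF comb_sq[of n y]]
        by (simp add: H_def integral_comb_sq)
      finally have "(\<integral>x. (f (comb n c x) + h x) * comb n y x \<partial>M) \<le> H / (2 * \<epsilon>) + \<epsilon> / 2 * (\<Sum>i<n. (y i)\<^sup>2)" .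
      then show ?thesis
        unfolding c_def[symmetric] pairing using main by (simp add: field_simps)
    qed
    have "\<exists>y\<in>V. (\<Sum>i<n. (y i)\<^sup>2) \<le> (sqrt R2)\<^sup>2 \<and> (\<forall>j<n. G (S y) j = 0)"
      unfolding V_def
    proof (rule acute_angle_zero)
      show "0 < n" using n k_pos by simp
      show "0 < sqrt R2" using R2 by simp
      fix j
      show "continuous_on {c. \<forall>i\<ge>n. c i = 0} (\<lambda>c. G (S c) j)"
        unfolding V_def[symmetric]
        by (rule continuous_on_compose2[OF G_cont S_cont]) (use SV in auto)
    next
      fix y assume "y \<in> {c. \<forall>i\<ge>n. c i = 0}" and sum: "(\<Sum>i<n. (y i)\<^sup>2) = (sqrt R2)\<^sup>2"
      then have "y \<in> V" by (simp add: V_def)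
      have "0 < \<epsilon> / 2 * R2 - H / (2 * \<epsilon>)"
      proof -
        have "\<epsilon> / 2 * R2 - H / (2 * \<epsilon>) = \<epsilon> / 2"
          using \<epsilon>(1) by (simp add: R2_def field_simps power2_eq_square)
        then show ?thesis using \<epsilon>(1) by simp
      qed
      then show "0 < (\<Sum>i<n. G (S y) i * y i)"
        using acute[OF \<open>y \<in> V\<close>] sum R2 by simp
    qed
    then obtain y where y: "y \<in> V" "(\<Sum>i<n. (y i)\<^sup>2) \<le> R2" "\<And>j. j < n \<Longrightarrow> G (S y) j = 0"
      using R2 by auto
    have "(\<Sum>i<n. (S y i)\<^sup>2) \<le> (8 * L + 3) * R2"
    proof -
      have "(S y i)\<^sup>2 \<le> 8 * (\<tau> (hi y) i)\<^sup>2 + 2 * (y i)\<^sup>2" for i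
      proof (cases "i < k")
        case True
        have "0 \<le> (2 * \<tau> (hi y) i + y i)\<^sup>2" by simp
        with True show ?thesis by (simp add: S_def power2_sum power2_diff power_mult_distrib)
      next
        case False
        then have "(S y i)\<^sup>2 = (y i)\<^sup>2" by (simp add: S_def)
        moreover have "0 \<le> (y i)\<^sup>2" "0 \<le> (\<tau> (hi y) i)\<^sup>2" by simp_all
        ultimately show ?thesis by linarith
      qed
      then have "(\<Sum>i<n. (S y i)\<^sup>2) \<le> (\<Sum>i<n. 8 * (\<tau> (hi y) i)\<^sup>2 + 2 * (y i)\<^sup>2)"
        by (intro sum_mono)
      also have "\<dots> = 8 * (\<Sum>i<n. (\<tau> (hi y) i)\<^sup>2) + 2 * (\<Sum>i<n. (y i)\<^sup>2)"
        by (simp add: sum.distrib sum_distrib_left)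
      also have "\<dots> \<le> 8 * (L * R2) + 2 * R2"
      proof -
        have "(\<Sum>i<n. (hi y i)\<^sup>2) \<le> R2"
          using y(2) low_sum[of y] sum_nonneg[of "{..<k}" "\<lambda>i. (y i)\<^sup>2"] by simp
        then have "(\<Sum>i<n. (\<tau> (hi y) i)\<^sup>2) \<le> L * R2"
          using \<tau>_bound[OF hiH[OF y(1)]] mult_left_mono[OF _ L] by (meson order_trans)
        then show ?thesis using y(2) by simp
      qed
      also have "\<dots> \<le> (8 * L + 3) * R2" using R2 by (simp add: algebra_simps)
      finally show ?thesis .
    qed
    moreover have "\<mu> j * S y j = (\<integral>x. (jumping a \<beta> (comb n (S y) x) + f (comb n (S y) x) + h x) * e j x \<partial>M)" if "j < n" for j
      using y(3)[OF that] by (simp add: G_def)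
    ultimately show ?thesis by blast
  qed
  then show thesis using that by blast
qed

end

section \<open>Compactness and passage to the limit\<close>

text \<open>
  A product of compact intervals is compact and metrisable, hence sequentially compact.
\<close>

lemma bounded_coordinates_subsequence:
  fixes c :: "nat \<Rightarrow> nat \<Rightarrow> real"
  assumes "\<And>m i. \<bar>c m i\<bar> \<le> B i"
  obtains r l where "strict_mono r" "\<forall>i. (\<lambda>m. c (r m) i) \<longlonglongrightarrow> l i"
proof -
  let ?S = "Pi\<^sub>E UNIV (\<lambda>i. {- B i..B i})"
  have "compact ?S"
    unfolding compactin_euclidean_iff[symmetric] euclidean_product_topology[symmetric]
    by (simp add: compactin_PiE compactin_euclidean_iff)
  then have "seq_compact ?S" by (rule compact_imp_seq_compact)
  moreover have "\<forall>m. c m \<in> ?S"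
    using assms by (auto simp: abs_le_iff minus_le_iff)
  ultimately obtain l r where "strict_mono r" "(c \<circ> r) \<longlonglongrightarrow> l"
    unfolding seq_compact_def by blast
  then show thesis
    using tendsto_coordinate[of "c \<circ> r" l] by (intro that[of r l]) (auto simp: o_def)
qed

context orthonormal_system
begin

text \<open>
  Each coefficient converges along a common subsequence, and the modes beyond \<open>j\<close> contribute at most \<open>R / \<Lambda>\<close> to the
  squared norm once \<open>\<mu>\<^sub>i \<ge> \<Lambda>\<close> for \<open>i \<ge> j\<close>; so the subsequence is Cauchy.
\<close>

lemma L2_compactness:
  fixes \<mu> :: "nat \<Rightarrow> real" and c :: "nat \<Rightarrow> nat \<Rightarrow> real"
  assumes \<mu>: "\<And>i. 0 < \<mu> i" "filterlim \<mu> at_top sequentially"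
    and bound: "\<And>m. (\<Sum>i<N m. \<mu> i * (c m i)\<^sup>2) \<le> R"
  obtains v r where "sq_integrable M v" "strict_mono r"
    "AE x in M. (\<lambda>m. comb (N (r m)) (c (r m)) x) \<longlonglongrightarrow> v x"
    "(\<lambda>m. \<integral>x. (comb (N (r m)) (c (r m)) x - v x)\<^sup>2 \<partial>M) \<longlonglongrightarrow> 0"
proof -
  define C where "C m i = (if i < N m then c m i else 0)" for m i
  have C_bound: "(\<Sum>i\<in>I. \<mu> i * (C m i)\<^sup>2) \<le> R" if "finite I" for m I
  proof -
    have "(\<Sum>i\<in>I. \<mu> i * (C m i)\<^sup>2) = (\<Sum>i\<in>I \<inter> {..<N m}. \<mu> i * (c m i)\<^sup>2)"
      using that by (intro sum.mono_neutral_cong_right) (auto simp: C_def)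
    also have "\<dots> \<le> (\<Sum>i<N m. \<mu> i * (c m i)\<^sup>2)"
      using \<mu>(1) by (intro sum_mono2) (auto simp: less_imp_le)
    finally show ?thesis using bound[of m] by simp
  qed
  have R: "0 \<le> R" using C_bound[of "{}"] by simp
  have "\<bar>C m i\<bar> \<le> sqrt (R / \<mu> i)" for m i
  proof -
    have "\<mu> i * (C m i)\<^sup>2 \<le> R" using C_bound[of "{i}"] by simp
    then have "(C m i)\<^sup>2 \<le> R / \<mu> i" using \<mu>(1)[of i] by (simp add: pos_le_divide_eq mult.commute)
    then show ?thesis using real_sqrt_le_mono[of "(C m i)\<^sup>2"] by simp
  qed
  then obtain s l where s: "strict_mono s" and "\<forall>i. (\<lambda>m. C (s m) i) \<longlonglongrightarrow> l i"
    by (rule bounded_coordinates_subsequence[of C "\<lambda>i. sqrt (R / \<mu> i)"])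
  then have l: "(\<lambda>m. C (s m) i) \<longlonglongrightarrow> l i" for i by simp
  define u where "u m = comb (N (s m)) (c (s m))" for m
  have u_eq: "u m x = comb K (C (s m)) x" if "N (s m) \<le> K" for m K x
    unfolding u_def comb_def using that
    by (intro sum.mono_neutral_cong_left) (auto simp: C_def)
  have dist: "(\<integral>x. (u m x - u p x)\<^sup>2 \<partial>M) \<le> (\<Sum>i<j. (C (s m) i - C (s p) i)\<^sup>2) + 4 * (R / \<Lambda>)"
    if \<Lambda>: "0 < \<Lambda>" "\<And>i. j \<le> i \<Longrightarrow> \<Lambda> \<le> \<mu> i" for m p j \<Lambda>
  proof -
    define K where "K = max j (max (N (s m)) (N (s p)))"
    have tail: "(\<Sum>i=j..<K. (C q i)\<^sup>2) \<le> R / \<Lambda>" for q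
    proof -
      have "\<Lambda> * (\<Sum>i=j..<K. (C q i)\<^sup>2) \<le> (\<Sum>i=j..<K. \<mu> i * (C q i)\<^sup>2)"
        unfolding sum_distrib_left using \<Lambda>(2) by (intro sum_mono mult_right_mono) auto
      also have "\<dots> \<le> R" by (rule C_bound) simp
      finally show ?thesis using \<Lambda>(1) by (simp add: pos_le_divide_eq mult.commute)
    qed
    have "(\<integral>x. (u m x - u p x)\<^sup>2 \<partial>M) = (\<Sum>i<K. (C (s m) i - C (s p) i)\<^sup>2)"
      using u_eq[of m K] u_eq[of p K] unfolding integral_comb_sq[symmetric] comb_diff by (simp add: K_def)
    also have "\<dots> = (\<Sum>i<j. (C (s m) i - C (s p) i)\<^sup>2) + (\<Sum>i=j..<K. (C (s m) i - C (s p) i)\<^sup>2)"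
      using sum.atLeastLessThan_concat[of 0 j K "\<lambda>i. (C (s m) i - C (s p) i)\<^sup>2"]
      by (simp add: K_def atLeast0LessThan)
    also have "(\<Sum>i=j..<K. (C (s m) i - C (s p) i)\<^sup>2) \<le> (\<Sum>i=j..<K. 2 * (C (s m) i)\<^sup>2 + 2 * (C (s p) i)\<^sup>2)"
    proof (rule sum_mono)
      fix i
      have "0 \<le> (C (s m) i + C (s p) i)\<^sup>2" by simp
      then show "(C (s m) i - C (s p) i)\<^sup>2 \<le> 2 * (C (s m) i)\<^sup>2 + 2 * (C (s p) i)\<^sup>2"
        unfolding power2_diff power2_sum by linarith
    qed
    also have "\<dots> = 2 * (\<Sum>i=j..<K. (C (s m) i)\<^sup>2) + 2 * (\<Sum>i=j..<K. (C (s p) i)\<^sup>2)"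
      by (simp add: sum.distrib sum_distrib_left)
    finally show ?thesis using tail[of "s m"] tail[of "s p"] by linarith
  qed
  have u_sq: "sq_integrable M (u m)" for m unfolding u_def by (rule comb_sq)
  have "\<exists>n0. \<forall>m\<ge>n0. \<forall>p\<ge>n0. (\<integral>x. (u m x - u p x)\<^sup>2 \<partial>M) \<le> \<epsilon>" if "0 < \<epsilon>" for \<epsilon>
  proof -
    define \<Lambda> where "\<Lambda> = 8 * (R + 1) / \<epsilon>"
    have \<Lambda>: "0 < \<Lambda>" using that R by (simp add: \<Lambda>_def)
    have "\<forall>\<^sub>F i in sequentially. \<Lambda> \<le> \<mu> i" using \<mu>(2) by (simp add: filterlim_at_top)
    then obtain j where j: "\<And>i. j \<le> i \<Longrightarrow> \<Lambda> \<le> \<mu> i" by (auto simp: eventually_sequentially)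
    have "4 * (R / \<Lambda>) \<le> \<epsilon> / 2"
      using that R by (simp add: \<Lambda>_def field_simps)
    define \<eta> where "\<eta> = sqrt (\<epsilon> / (2 * (real j + 1)))"
    have \<eta>: "0 < \<eta>" "\<eta>\<^sup>2 = \<epsilon> / (2 * (real j + 1))" using that by (simp_all add: \<eta>_def)
    have "\<forall>i. \<exists>n0. \<forall>m\<ge>n0. \<forall>p\<ge>n0. dist (C (s m) i) (C (s p) i) < \<eta>"
      using LIMSEQ_imp_Cauchy[OF l] \<eta>(1) unfolding Cauchy_def by blast
    then obtain n where n: "\<And>i m p. n i \<le> m \<Longrightarrow> n i \<le> p \<Longrightarrow> dist (C (s m) i) (C (s p) i) < \<eta>"
      by metis
    define n0 where "n0 = (\<Sum>i<j. n i)"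
    have "(\<integral>x. (u m x - u p x)\<^sup>2 \<partial>M) \<le> \<epsilon>" if mp: "n0 \<le> m" "n0 \<le> p" for m p
    proof -
      have "(\<Sum>i<j. (C (s m) i - C (s p) i)\<^sup>2) \<le> (\<Sum>i<j. \<eta>\<^sup>2)"
      proof (rule sum_mono)
        fix i assume "i \<in> {..<j}"
        then have "n i \<le> n0" unfolding n0_def by (intro member_le_sum) auto
        then have "\<bar>C (s m) i - C (s p) i\<bar> < \<eta>"
          using n[of i m p] mp by (simp add: dist_real_def)
        then show "(C (s m) i - C (s p) i)\<^sup>2 \<le> \<eta>\<^sup>2"
          using \<eta>(1) by (simp add: abs_le_square_iff[symmetric])
      qed
      also have "\<dots> = j * \<epsilon> / (2 * (real j + 1))" by (simp add: \<eta>(2))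
      also have "\<dots> \<le> \<epsilon> / 2" using \<open>0 < \<epsilon>\<close> by (simp add: field_simps)
      finally show ?thesis
        using dist[where m = m and p = p and j = j and \<Lambda> = \<Lambda>, OF \<Lambda> j] \<open>4 * (R / \<Lambda>) \<le> \<epsilon> / 2\<close> by linarith
    qed
    then show ?thesis by blast
  qed
  then obtain v r where v: "sq_integrable M v" "strict_mono r"
    "AE x in M. (\<lambda>n. u (r n) x) \<longlonglongrightarrow> v x" "(\<lambda>n. \<integral>x. (u n x - v x)\<^sup>2 \<partial>M) \<longlonglongrightarrow> 0"
    by (rule L2_complete[where u = u, OF u_sq])
  show thesis
  proof (rule that[OF v(1), of "s \<circ> r"])
    show "strict_mono (s \<circ> r)" using s v(2) by (rule strict_mono_o)
    show "AE x in M. (\<lambda>m. comb (N ((s \<circ> r) m)) (c ((s \<circ> r) m)) x) \<longlonglongrightarrow> v x"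
      using v(3) by (simp add: u_def)
    show "(\<lambda>m. \<integral>x. (comb (N ((s \<circ> r) m)) (c ((s \<circ> r) m)) x - v x)\<^sup>2 \<partial>M) \<longlonglongrightarrow> 0"
      using LIMSEQ_subseq_LIMSEQ[OF v(4) v(2)] by (simp add: u_def o_def)
  qed
qed

end

context saddle_problem
begin

text \<open>
  Testing a Galerkin solution with itself turns its \<open>L\<^sup>2\<close> bound into a bound on \<open>\<Sum> \<mu>\<^sub>i c\<^sub>i\<^sup>2\<close>. In the limit, the jumping term
  converges in \<open>L\<^sup>2\<close> because it is Lipschitz, and the bounded term by dominated convergence. The approximations
  and their energy bound are part of the result, as they are what places the limit in the energy space.
\<close>

lemma limit_solution:
  assumes \<mu>: "\<And>i. 0 < \<mu> i" "filterlim \<mu> at_top sequentially"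
    and f: "continuous_on UNIV f" and fB: "\<And>t. \<bar>f t\<bar> \<le> B" and h: "sq_integrable M h"
  obtains v N c R where "sq_integrable M v"
    "\<forall>m. (\<Sum>i<N m. \<mu> i * (c m i)\<^sup>2) \<le> R"
    "AE x in M. (\<lambda>m::nat. comb (N m) (c m) x) \<longlonglongrightarrow> v x"
    "\<forall>j. \<mu> j * (\<integral>x. v x * e j x \<partial>M) = (\<integral>x. (jumping a \<beta> (v x) + f (v x) + h x) * e j x \<partial>M)"
proof -
  have B: "0 \<le> B" using fB[of 0] by linarith
  have a0: "0 \<le> a" and \<beta>0: "0 \<le> \<beta>" using a_pos \<beta> by simp_all
  have fm [measurable]: "f \<in> borel_measurable borel"
    by (rule borel_measurable_continuous_onI[OF f])
  have hm [measurable]: "h \<in> borel_measurable M" by (rule sq_integrable_measurable[OF h])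
  obtain R where R: "\<forall>n\<ge>k. \<exists>c. (\<Sum>i<n. (c i)\<^sup>2) \<le> R \<and>
    (\<forall>j<n. \<mu> j * c j = (\<integral>x. (jumping a \<beta> (comb n c x) + f (comb n c x) + h x) * e j x \<partial>M))"
    by (rule galerkin_solution[OF f fB h])
  define sol where "sol n c \<longleftrightarrow> (\<Sum>i<n. (c i)\<^sup>2) \<le> R \<and>
    (\<forall>j<n. \<mu> j * c j = (\<integral>x. (jumping a \<beta> (comb n c x) + f (comb n c x) + h x) * e j x \<partial>M))" for n c
  have "\<exists>c. sol (k + m) c" for m
    using R unfolding sol_def by simp
  then obtain c where sol: "\<And>m. sol (k + m) (c m)" by metis
  have c: "(\<Sum>i<k + m. (c m i)\<^sup>2) \<le> R" for m
    using sol[of m] by (simp add: sol_def)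
  have c_eq: "\<mu> j * c m j =
      (\<integral>x. (jumping a \<beta> (comb (k + m) (c m) x) + f (comb (k + m) (c m) x) + h x) * e j x \<partial>M)"
    if "j < k + m" for m j
    using sol[of m] that by (simp add: sol_def)
  have hB: "sq_integrable M (\<lambda>x. B + \<bar>h x\<bar>)"
    by (intro sq_integrable_add sq_integrable_const sq_integrable_abs h)
  have fsq: "sq_integrable M (\<lambda>x. f (w x))" if "w \<in> borel_measurable M" for w
  proof (rule sq_integrable_bound[OF sq_integrable_const[of B]])
    show "(\<lambda>x. f (w x)) \<in> borel_measurable M" using that by measurable
    show "AE x in M. \<bar>f (w x)\<bar> \<le> \<bar>B\<bar>" using fB B by simp
  qed
  define H where "H = (\<integral>x. (B + \<bar>h x\<bar>)\<^sup>2 \<partial>M)"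
  have energy_bound: "(\<Sum>i<k + m. \<mu> i * (c m i)\<^sup>2) \<le> (\<beta> + 1/2) * R + H / 2" for m
  proof -
    let ?u = "comb (k + m) (c m)"
    have gsq: "sq_integrable M (\<lambda>x. jumping a \<beta> (?u x) + f (?u x) + h x)"
      by (intro sq_integrable_add sq_integrable_jumping comb_sq a0 \<beta> fsq h comb_measurable)
    have "(\<Sum>i<k + m. \<mu> i * (c m i)\<^sup>2) = (\<Sum>i<k + m. (\<mu> i * c m i) * c m i)"
      by (simp add: power2_eq_square mult.assoc)
    also have "\<dots> = (\<integral>x. (jumping a \<beta> (?u x) + f (?u x) + h x) * ?u x \<partial>M)"
      unfolding integral_comb[OF gsq] by (intro sum.cong) (simp_all add: c_eq)
    also have "\<dots> \<le> (\<integral>x. (\<beta> + 1/2) * (?u x)\<^sup>2 + (B + \<bar>h x\<bar>)\<^sup>2 / 2 \<partial>M)"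
    proof (rule integral_mono)
      show "integrable M (\<lambda>x. (jumping a \<beta> (?u x) + f (?u x) + h x) * ?u x)"
        by (rule sq_integrable_mult[OF gsq comb_sq])
      show "integrable M (\<lambda>x. (\<beta> + 1/2) * (?u x)\<^sup>2 + (B + \<bar>h x\<bar>)\<^sup>2 / 2)"
        using sq_integrable_square[OF comb_sq] sq_integrable_square[OF hB] by simp
      fix x
      let ?t = "?u x"
      have "(jumping a \<beta> ?t + f ?t + h x) * ?t \<le> \<bar>jumping a \<beta> ?t + f ?t + h x\<bar> * \<bar>?t\<bar>"
        by (metis abs_ge_self abs_mult)
      also have "\<dots> \<le> (\<beta> * \<bar>?t\<bar> + (B + \<bar>h x\<bar>)) * \<bar>?t\<bar>"
        using abs_jumping_le[OF a0 \<beta>(1), of ?t] fB[of ?t] by (intro mult_right_mono) linarith+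
      also have "\<dots> = \<beta> * ?t\<^sup>2 + (B + \<bar>h x\<bar>) * \<bar>?t\<bar>"
        by (simp add: distrib_right power2_eq_square mult.assoc)
      also have "(B + \<bar>h x\<bar>) * \<bar>?t\<bar> \<le> (B + \<bar>h x\<bar>)\<^sup>2 / 2 + ?t\<^sup>2 / 2"
      proof -
        have "0 \<le> ((B + \<bar>h x\<bar>) - \<bar>?t\<bar>)\<^sup>2" by simp
        then have "2 * ((B + \<bar>h x\<bar>) * \<bar>?t\<bar>) \<le> (B + \<bar>h x\<bar>)\<^sup>2 + ?t\<^sup>2"
          unfolding power2_diff[of "B + \<bar>h x\<bar>"] mult.assoc power2_abs by linarith
        then show ?thesis by linarith
      qed
      finally show "(jumping a \<beta> ?t + f ?t + h x) * ?t \<le> (\<beta> + 1/2) * ?t\<^sup>2 + (B + \<bar>h x\<bar>)\<^sup>2 / 2"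
        by (simp add: distrib_right)
    qed
    also have "\<dots> = (\<beta> + 1/2) * (\<Sum>i<k + m. (c m i)\<^sup>2) + H / 2"
      using sq_integrable_square[OF comb_sq] sq_integrable_square[OF hB]
      by (simp add: integral_comb_sq H_def)
    also have "\<dots> \<le> (\<beta> + 1/2) * R + H / 2"
      using c \<beta>0 by (intro add_right_mono mult_left_mono) auto
    finally show ?thesis .
  qed
  obtain v r where v: "sq_integrable M v" and r: "strict_mono r"
    and ae: "AE x in M. (\<lambda>m. comb (k + r m) (c (r m)) x) \<longlonglongrightarrow> v x"
    and L2: "(\<lambda>m. \<integral>x. (comb (k + r m) (c (r m)) x - v x)\<^sup>2 \<partial>M) \<longlonglongrightarrow> 0"
    by (rule L2_compactness[OF \<mu> energy_bound])
  define u where "u m = comb (k + r m) (c (r m))" for m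
  have usq: "sq_integrable M (u m)" for m unfolding u_def by (rule comb_sq)
  have um [measurable]: "u m \<in> borel_measurable M" for m by (rule sq_integrable_measurable[OF usq])
  have vm [measurable]: "v \<in> borel_measurable M" by (rule sq_integrable_measurable[OF v])
  note Nu = sq_integrable_jumping[OF usq a0 \<beta>(1)] and Nv = sq_integrable_jumping[OF v a0 \<beta>(1)]
  have lim_f: "(\<lambda>m. \<integral>x. f (u m x) * e j x \<partial>M) \<longlonglongrightarrow> (\<integral>x. f (v x) * e j x \<partial>M)" for j
  proof (rule integral_dominated_convergence[where w = "\<lambda>x. B * \<bar>e j x\<bar>"])
    show "integrable M (\<lambda>x. B * \<bar>e j x\<bar>)"
      using sq_integrable_mult[OF sq_integrable_const[of B] sq_integrable_abs[OF e_sq]] .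
    show "AE x in M. (\<lambda>m. f (u m x) * e j x) \<longlonglongrightarrow> f (v x) * e j x"
      using ae unfolding u_def[symmetric]
      by eventually_elim (intro tendsto_mult_right continuous_on_tendsto_compose[OF f], auto)
    show "AE x in M. norm (f (u m x) * e j x) \<le> B * \<bar>e j x\<bar>" for m
      using fB by (simp add: abs_mult mult_right_mono)
  qed measurable
  have lim_N2: "(\<lambda>m. \<integral>x. (jumping a \<beta> (u m x) - jumping a \<beta> (v x))\<^sup>2 \<partial>M) \<longlonglongrightarrow> 0"
  proof (rule tendsto_sandwich[OF _ _ tendsto_const])
    show "(\<lambda>m. \<beta>\<^sup>2 * (\<integral>x. (u m x - v x)\<^sup>2 \<partial>M)) \<longlonglongrightarrow> 0"
      using tendsto_mult_left[OF L2, of "\<beta>\<^sup>2"] by (simp add: u_def)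
    have "(\<integral>x. (jumping a \<beta> (u m x) - jumping a \<beta> (v x))\<^sup>2 \<partial>M) \<le> (\<integral>x. \<beta>\<^sup>2 * (u m x - v x)\<^sup>2 \<partial>M)" for m
    proof (rule integral_mono)
      fix x
      obtain q where q: "a \<le> q" "q \<le> \<beta>" "jumping a \<beta> (u m x) - jumping a \<beta> (v x) = q * (u m x - v x)"
        using jumping_difference[OF \<beta>(1)] .
      then show "(jumping a \<beta> (u m x) - jumping a \<beta> (v x))\<^sup>2 \<le> \<beta>\<^sup>2 * (u m x - v x)\<^sup>2"
        using a0 by (simp add: power_mult_distrib mult_right_mono power_mono)
    qed (use sq_integrable_square[OF sq_integrable_diff[OF Nu Nv]]
          sq_integrable_square[OF sq_integrable_diff[OF usq v]] in auto)
    then show "\<forall>\<^sub>F m in sequentially. (\<integral>x. (jumping a \<beta> (u m x) - jumping a \<beta> (v x))\<^sup>2 \<partial>M)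
        \<le> \<beta>\<^sup>2 * (\<integral>x. (u m x - v x)\<^sup>2 \<partial>M)" by simp
  qed simp
  have split: "(\<integral>x. (jumping a \<beta> (w x) + f (w x) + h x) * e j x \<partial>M)
      = (\<integral>x. jumping a \<beta> (w x) * e j x \<partial>M) + (\<integral>x. f (w x) * e j x \<partial>M) + (\<integral>x. h x * e j x \<partial>M)"
    if w: "sq_integrable M w" for w j
    using sq_integrable_mult[OF sq_integrable_jumping[OF w a0 \<beta>(1)] e_sq]
      sq_integrable_mult[OF fsq[OF sq_integrable_measurable[OF w]] e_sq] sq_integrable_mult[OF h e_sq]
    by (simp add: distrib_right)
  have eq: "\<mu> j * (\<integral>x. v x * e j x \<partial>M) = (\<integral>x. (jumping a \<beta> (v x) + f (v x) + h x) * e j x \<partial>M)" for j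
  proof (rule LIMSEQ_unique)
    have "(\<lambda>m. (\<integral>x. jumping a \<beta> (u m x) * e j x \<partial>M) + (\<integral>x. f (u m x) * e j x \<partial>M) + (\<integral>x. h x * e j x \<partial>M))
        \<longlonglongrightarrow> (\<integral>x. jumping a \<beta> (v x) * e j x \<partial>M) + (\<integral>x. f (v x) * e j x \<partial>M) + (\<integral>x. h x * e j x \<partial>M)"
      by (intro tendsto_add tendsto_const lim_f L2_tendsto_inner[OF Nu Nv e_sq lim_N2])
    then show "(\<lambda>m. \<integral>x. (jumping a \<beta> (u m x) + f (u m x) + h x) * e j x \<partial>M)
        \<longlonglongrightarrow> (\<integral>x. (jumping a \<beta> (v x) + f (v x) + h x) * e j x \<partial>M)"
      by (simp only: split[OF usq] split[OF v])
    have lim: "(\<lambda>m. \<mu> j * (\<integral>x. u m x * e j x \<partial>M)) \<longlonglongrightarrow> \<mu> j * (\<integral>x. v x * e j x \<partial>M)"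
      using L2_tendsto_inner[OF usq v e_sq] L2 unfolding u_def by (intro tendsto_mult_left) auto
    have "\<forall>\<^sub>F m in sequentially. \<mu> j * (\<integral>x. u m x * e j x \<partial>M) = (\<integral>x. (jumping a \<beta> (u m x) + f (u m x) + h x) * e j x \<partial>M)"
    proof (rule eventually_sequentiallyI[of j])
      fix m assume "j \<le> m"
      then have "j < k + r m" using seq_suble[OF r, of m] k_pos by linarith
      then show "\<mu> j * (\<integral>x. u m x * e j x \<partial>M) = (\<integral>x. (jumping a \<beta> (u m x) + f (u m x) + h x) * e j x \<partial>M)"
        unfolding u_def integral_comb_e by (simp add: c_eq)
    qed
    then show "(\<lambda>m. \<integral>x. (jumping a \<beta> (u m x) + f (u m x) + h x) * e j x \<partial>M) \<longlonglongrightarrow> \<mu> j * (\<integral>x. v x * e j x \<partial>M)"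
      using lim by (rule Lim_transform_eventually[rotated])
  qed
  show thesis
    by (rule that[where N = "\<lambda>m. k + r m" and c = "\<lambda>m. c (r m)", OF v _ ae])
      (use energy_bound eq in auto)
qed

end

section \<open>The nonlocal function space\<close>

lemma L2_on_iff:
  assumes "S \<in> sets lebesgue"
  shows "L2_on S f \<longleftrightarrow> sq_integrable (lebesgue_on S) f"
  using assms
  by (simp add: L2_on_def sq_integrable_def set_borel_measurable_def set_integrable_def
      borel_measurable_restrict_space_iff integrable_restrict_space)

text \<open>
  A null set times the whole space is a null set of the product.
\<close>

lemma AE_lebesgue_pair:
  fixes P :: "'a::euclidean_space \<Rightarrow> bool"
  assumes "AE x in lebesgue. P x"
  shows "AE z in (lebesgue :: ('a \<times> 'a) measure). P (fst z) \<and> P (snd z)"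
proof -
  have "AE x in lborel. P x" using assms by (simp add: AE_completion_iff)
  then obtain N where N: "N \<in> null_sets lborel" "{x. \<not> P x} \<subseteq> N"
    by (auto elim!: AE_E simp: null_sets_def)
  have null: "N \<times> UNIV \<in> null_sets (lborel :: ('a \<times> 'a) measure)"
    "UNIV \<times> N \<in> null_sets (lborel :: ('a \<times> 'a) measure)"
    unfolding lborel_prod[symmetric] using N(1)
    by (auto simp: null_sets_def lborel.emeasure_pair_measure_Times)
  have "AE z in (lborel :: ('a \<times> 'a) measure). P (fst z) \<and> P (snd z)"
  proof (rule AE_I'[OF null_sets.Un[OF null]])
    show "{z \<in> space lborel. \<not> (P (fst z) \<and> P (snd z))} \<subseteq> N \<times> UNIV \<union> UNIV \<times> N"
      using N(2) by (auto simp: mem_Times_iff)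
  qed
  then show ?thesis by (rule AE_completion)
qed

locale nonlocal_space =
  fixes K :: "real^'n \<Rightarrow> real" and \<Omega> :: "(real^'n) set"
  assumes open_\<Omega>: "open \<Omega>" and K_nonneg: "x \<noteq> 0 \<Longrightarrow> 0 \<le> K x"
begin

lemma \<Omega>_lebesgue [simp, measurable]: "\<Omega> \<in> sets lebesgue"
  using open_\<Omega> by (simp add: borel_open)

lemma Q_lebesgue [simp, measurable]: "Q_set \<Omega> \<in> sets lebesgue"
proof -
  have "Q_set \<Omega> = - ((- \<Omega>) \<times> (- \<Omega>))" by (auto simp: Q_set_def)
  moreover have "closed ((- \<Omega>) \<times> (- \<Omega>))" using open_\<Omega> by (intro closed_Times) (auto simp: closed_def)
  ultimately show ?thesis by (simp add: borel_open open_Compl)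
qed

text \<open>
  The map \<open>u \<mapsto> increment u\<close> embeds the function space into \<open>L\<^sup>2(Q)\<close>, and \<open>inner_X0\<close> is the scalar product carried back
  from there. On the diagonal the factor \<open>u x - u y\<close> hides the arbitrary value of \<open>K\<close> at \<open>0\<close>.
\<close>

definition increment :: "(real^'n \<Rightarrow> real) \<Rightarrow> (real^'n) \<times> (real^'n) \<Rightarrow> real" where
  "increment u = (\<lambda>(x, y). (u x - u y) * sqrt (K (x - y)))"

lemma increment_mult:
  "increment u (x, y) * increment v (x, y) = (u x - u y) * (v x - v y) * K (x - y)"
  by (cases "x = y") (simp_all add: increment_def K_nonneg)

lemma inner_X0_eq: "inner_X0 K \<Omega> u v = (\<integral>z. increment u z * increment v z \<partial>lebesgue_on (Q_set \<Omega>))"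
  unfolding inner_X0_def set_lebesgue_integral_def
  by (subst integral_restrict_space) (auto simp: increment_mult split_beta intro!: Bochner_Integration.integral_cong)

lemma inner_L2_eq: "inner_L2 \<Omega> u v = (\<integral>x. u x * v x \<partial>lebesgue_on \<Omega>)"
  unfolding inner_L2_def set_lebesgue_integral_def by (subst integral_restrict_space) auto

lemma integral_\<Omega>_eq:
  fixes g :: "real^'n \<Rightarrow> real"
  shows "set_lebesgue_integral lebesgue \<Omega> g = (\<integral>x. g x \<partial>lebesgue_on \<Omega>)"
  by (simp add: set_lebesgue_integral_def integral_restrict_space)

lemma space_X0_iff:
  "u \<in> space_X0 K \<Omega> \<longleftrightarrow> u \<in> borel_measurable lebesgue \<and> sq_integrable (lebesgue_on \<Omega>) u \<and>
    sq_integrable (lebesgue_on (Q_set \<Omega>)) (increment u) \<and> (AE x in lebesgue. x \<notin> \<Omega> \<longrightarrow> u x = 0)"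
  by (auto simp: space_X0_def space_X_def L2_on_iff increment_def)

lemma X0_sq: "u \<in> space_X0 K \<Omega> \<Longrightarrow> sq_integrable (lebesgue_on \<Omega>) u"
  by (simp add: space_X0_iff)

lemma X0_increment: "u \<in> space_X0 K \<Omega> \<Longrightarrow> sq_integrable (lebesgue_on (Q_set \<Omega>)) (increment u)"
  by (simp add: space_X0_iff)

lemma increment_add: "increment (\<lambda>x. u x + v x) z = increment u z + increment v z"
  by (simp add: increment_def split_beta algebra_simps)

lemma increment_cmult: "increment (\<lambda>x. t * u x) z = t * increment u z"
  by (simp add: increment_def split_beta algebra_simps)

lemma increment_sum: "increment (\<lambda>x. \<Sum>i\<in>I. c i * u i x) z = (\<Sum>i\<in>I. c i * increment (u i) z)"
proof (induction I rule: infinite_finite_induct)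
  case (insert i I)
  then show ?case
    using increment_add[of "\<lambda>x. c i * u i x" "\<lambda>x. \<Sum>i\<in>I. c i * u i x" z] increment_cmult[of "c i" "u i" z]
    by simp
qed (simp_all add: increment_def split_beta)

lemma X0_add:
  assumes "u \<in> space_X0 K \<Omega>" "v \<in> space_X0 K \<Omega>"
  shows "(\<lambda>x. u x + v x) \<in> space_X0 K \<Omega>"
  unfolding space_X0_iff
proof (intro conjI)
  have [measurable]: "u \<in> borel_measurable lebesgue" "v \<in> borel_measurable lebesgue"
    using assms by (simp_all add: space_X0_iff)
  show "(\<lambda>x. u x + v x) \<in> borel_measurable lebesgue" by measurable
  have "AE x in lebesgue. x \<notin> \<Omega> \<longrightarrow> u x = 0" "AE x in lebesgue. x \<notin> \<Omega> \<longrightarrow> v x = 0"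
    using assms by (simp_all add: space_X0_iff)
  then show "AE x in lebesgue. x \<notin> \<Omega> \<longrightarrow> u x + v x = 0" by eventually_elim simp
  show "sq_integrable (lebesgue_on (Q_set \<Omega>)) (increment (\<lambda>x. u x + v x))"
    using sq_integrable_add[OF assms[THEN X0_increment]] by (simp add: increment_add[abs_def])
qed (intro sq_integrable_add assms[THEN X0_sq])

lemma X0_cmult:
  assumes "u \<in> space_X0 K \<Omega>"
  shows "(\<lambda>x. t * u x) \<in> space_X0 K \<Omega>"
  unfolding space_X0_iff
proof (intro conjI)
  have [measurable]: "u \<in> borel_measurable lebesgue"
    using assms by (simp_all add: space_X0_iff)
  show "(\<lambda>x. t * u x) \<in> borel_measurable lebesgue" by measurable
  show "AE x in lebesgue. x \<notin> \<Omega> \<longrightarrow> t * u x = 0"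
    using assms by (auto simp: space_X0_iff)
  show "sq_integrable (lebesgue_on (Q_set \<Omega>)) (increment (\<lambda>x. t * u x))"
    using sq_integrable_cmult[OF X0_increment[OF assms], of t] by (simp add: increment_cmult[abs_def])
qed (intro sq_integrable_cmult X0_sq[OF assms])

lemma X0_zero: "(\<lambda>x. 0) \<in> space_X0 K \<Omega>"
  by (simp add: space_X0_iff sq_integrable_def increment_def split_beta)

lemma X0_sum:
  assumes "\<And>i. i \<in> I \<Longrightarrow> u i \<in> space_X0 K \<Omega>"
  shows "(\<lambda>x. \<Sum>i\<in>I. c i * u i x) \<in> space_X0 K \<Omega>"
  using assms
proof (induction I rule: infinite_finite_induct)
  case (insert i I)
  then show ?case by (simp add: X0_add X0_cmult)
qed (simp_all add: X0_zero)

lemma X0_diff: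
  assumes "u \<in> space_X0 K \<Omega>" "v \<in> space_X0 K \<Omega>"
  shows "(\<lambda>x. u x - v x) \<in> space_X0 K \<Omega>"
  using X0_add[OF assms(1) X0_cmult[OF assms(2), of "-1"]] by simp

lemma inner_X0_commute: "inner_X0 K \<Omega> u v = inner_X0 K \<Omega> v u"
  by (simp add: inner_X0_eq mult.commute)

lemma inner_X0_nonneg: "0 \<le> inner_X0 K \<Omega> u u"
  unfolding inner_X0_eq by (rule integral_nonneg_AE) simp

lemma norm_X0_sq: "(norm_X0 K \<Omega> u)\<^sup>2 = inner_X0 K \<Omega> u u"
  by (simp add: norm_X0_def inner_X0_nonneg)

lemma inner_X0_diff:
  assumes "u \<in> space_X0 K \<Omega>" "v \<in> space_X0 K \<Omega>" "w \<in> space_X0 K \<Omega>"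
  shows "inner_X0 K \<Omega> w (\<lambda>x. u x - v x) = inner_X0 K \<Omega> w u - inner_X0 K \<Omega> w v"
proof -
  have "increment (\<lambda>x. u x - v x) z = increment u z - increment v z" for z
    by (simp add: increment_def split_beta algebra_simps)
  then show ?thesis
    using sq_integrable_mult[OF X0_increment[OF assms(3)] X0_increment[OF assms(1)]]
      sq_integrable_mult[OF X0_increment[OF assms(3)] X0_increment[OF assms(2)]]
    by (simp add: inner_X0_eq right_diff_distrib)
qed

lemma inner_X0_sum:
  assumes "\<And>i. i \<in> I \<Longrightarrow> u i \<in> space_X0 K \<Omega>" "w \<in> space_X0 K \<Omega>"
  shows "inner_X0 K \<Omega> (\<lambda>x. \<Sum>i\<in>I. c i * u i x) w = (\<Sum>i\<in>I. c i * inner_X0 K \<Omega> (u i) w)"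
proof -
  have "inner_X0 K \<Omega> (\<lambda>x. \<Sum>i\<in>I. c i * u i x) w
      = (\<integral>z. (\<Sum>i\<in>I. c i * (increment (u i) z * increment w z)) \<partial>lebesgue_on (Q_set \<Omega>))"
    by (simp add: inner_X0_eq increment_sum sum_distrib_right mult.assoc)
  also have "\<dots> = (\<Sum>i\<in>I. c i * inner_X0 K \<Omega> (u i) w)"
    unfolding inner_X0_eq using sq_integrable_mult[OF X0_increment[OF assms(1)] X0_increment[OF assms(2)]]
    by (subst Bochner_Integration.integral_sum) auto
  finally show ?thesis .
qed

lemma inner_X0_Cauchy_Schwarz:
  assumes "u \<in> space_X0 K \<Omega>" "v \<in> space_X0 K \<Omega>"
  shows "\<bar>inner_X0 K \<Omega> u v\<bar> \<le> norm_X0 K \<Omega> u * norm_X0 K \<Omega> v"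
  using L2_Cauchy_Schwarz_abs[OF X0_increment[OF assms(1)] X0_increment[OF assms(2)]]
  by (simp add: inner_X0_eq norm_X0_def power2_eq_square)

text \<open>
  Fatou's lemma for the energies. Measurability of the increment of the limit comes from its being an almost everywhere
  limit of measurable functions.
\<close>

lemma X0_closed:
  assumes p: "\<And>m. p m \<in> space_X0 K \<Omega>" "\<And>m. inner_X0 K \<Omega> (p m) (p m) \<le> R"
    and lim: "AE x in lebesgue_on \<Omega>. (\<lambda>m::nat. p m x) \<longlonglongrightarrow> w x"
    and w: "w \<in> borel_measurable lebesgue" "sq_integrable (lebesgue_on \<Omega>) w"
      "\<And>x. x \<notin> \<Omega> \<Longrightarrow> w x = 0"
  shows "w \<in> space_X0 K \<Omega>" "inner_X0 K \<Omega> w w \<le> R"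
proof -
  let ?Q = "Q_set \<Omega>" and ?MQ = "lebesgue_on (Q_set \<Omega>)"
  have R: "0 \<le> R" using inner_X0_nonneg[of "p 0"] p(2)[of 0] by linarith
  have "AE x in lebesgue. x \<in> \<Omega> \<longrightarrow> (\<lambda>m. p m x) \<longlonglongrightarrow> w x"
    using lim by (simp add: AE_restrict_space_iff)
  moreover have "AE x in lebesgue. \<forall>m. x \<notin> \<Omega> \<longrightarrow> p m x = 0"
    unfolding AE_all_countable using p(1) by (simp add: space_X0_iff)
  ultimately have "AE x in lebesgue. (\<lambda>m. p m x) \<longlonglongrightarrow> w x"
  proof eventually_elim
    case (elim x)
    then show ?case by (cases "x \<in> \<Omega>") (simp_all add: w(3))
  qed
  from AE_lebesgue_pair[OF this]
  have conv: "AE z in lebesgue. (\<lambda>m. increment (p m) z) \<longlonglongrightarrow> increment w z"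
  proof eventually_elim
    case (elim z)
    then show ?case
      unfolding increment_def split_beta by (intro tendsto_mult_right tendsto_diff) auto
  qed
  have pm: "(\<lambda>z. indicator ?Q z *\<^sub>R increment (p m) z) \<in> borel_measurable lebesgue" for m
    using sq_integrable_measurable[OF X0_increment[OF p(1)]] by (simp add: borel_measurable_restrict_space_iff)
  have "(\<lambda>z. indicator ?Q z *\<^sub>R increment w z) \<in> borel_measurable lebesgue"
  proof (rule borel_measurable_AE)
    show "(\<lambda>z. lim (\<lambda>m. indicator ?Q z *\<^sub>R increment (p m) z)) \<in> borel_measurable lebesgue"
      by (rule borel_measurable_lim_metric[OF pm])
    show "AE z in lebesgue. lim (\<lambda>m. indicator ?Q z *\<^sub>R increment (p m) z) = indicator ?Q z *\<^sub>R increment w z"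
      using conv by eventually_elim (intro limI tendsto_scaleR tendsto_const)
  qed
  then have wm: "increment w \<in> borel_measurable ?MQ"
    by (simp add: borel_measurable_restrict_space_iff)
  have pm' [measurable]: "increment (p m) \<in> borel_measurable ?MQ" for m
    by (rule sq_integrable_measurable[OF X0_increment[OF p(1)]])
  have "(\<integral>\<^sup>+z. ennreal ((increment w z)\<^sup>2) \<partial>?MQ) \<le> (\<integral>\<^sup>+z. liminf (\<lambda>m. ennreal ((increment (p m) z)\<^sup>2)) \<partial>?MQ)"
  proof (rule nn_integral_mono_AE)
    have "AE z in ?MQ. (\<lambda>m. increment (p m) z) \<longlonglongrightarrow> increment w z"
      using conv by (auto simp: AE_restrict_space_iff)
    then show "AE z in ?MQ. ennreal ((increment w z)\<^sup>2) \<le> liminf (\<lambda>m. ennreal ((increment (p m) z)\<^sup>2))"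
    proof eventually_elim
      case (elim z)
      have "(\<lambda>m. ennreal ((increment (p m) z)\<^sup>2)) \<longlonglongrightarrow> ennreal ((increment w z)\<^sup>2)"
        by (intro tendsto_ennrealI tendsto_power elim)
      then show ?case
        by (intro eq_refl lim_imp_Liminf[OF trivial_limit_sequentially, symmetric])
    qed
  qed
  also have "\<dots> \<le> liminf (\<lambda>m. \<integral>\<^sup>+z. ennreal ((increment (p m) z)\<^sup>2) \<partial>?MQ)"
    by (rule nn_integral_liminf) measurable
  also have "\<dots> \<le> liminf (\<lambda>m::nat. ennreal R)"
  proof (rule Liminf_mono, rule always_eventually, rule allI)
    fix m
    have "(\<integral>\<^sup>+z. ennreal ((increment (p m) z)\<^sup>2) \<partial>?MQ) = ennreal (inner_X0 K \<Omega> (p m) (p m))"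
      unfolding inner_X0_eq power2_eq_square[symmetric]
      by (rule nn_integral_eq_integral) (simp_all add: sq_integrable_square[OF X0_increment[OF p(1)]])
    then show "(\<integral>\<^sup>+z. ennreal ((increment (p m) z)\<^sup>2) \<partial>?MQ) \<le> ennreal R"
      using p(2)[of m] by (simp add: ennreal_leI)
  qed
  also have "\<dots> = ennreal R" by (simp add: Liminf_const)
  finally have bound: "(\<integral>\<^sup>+z. ennreal ((increment w z)\<^sup>2) \<partial>?MQ) \<le> ennreal R" .
  have w_sq: "sq_integrable ?MQ (increment w)"
    unfolding sq_integrable_def
  proof (intro conjI wm integrableI_bounded)
    have "(\<integral>\<^sup>+z. ennreal (norm ((increment w z)\<^sup>2)) \<partial>?MQ) \<le> ennreal R" using bound by simp
    also have "\<dots> < \<infinity>" by simp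
    finally show "(\<integral>\<^sup>+z. ennreal (norm ((increment w z)\<^sup>2)) \<partial>?MQ) < \<infinity>" .
  qed (use wm in measurable)
  show "w \<in> space_X0 K \<Omega>"
    using w w_sq by (simp add: space_X0_iff)
  have "ennreal (inner_X0 K \<Omega> w w) = (\<integral>\<^sup>+z. ennreal ((increment w z)\<^sup>2) \<partial>?MQ)"
    unfolding inner_X0_eq power2_eq_square[symmetric]
    by (rule nn_integral_eq_integral[symmetric]) (simp_all add: sq_integrable_square[OF w_sq])
  with bound have "ennreal (inner_X0 K \<Omega> w w) \<le> ennreal R" by (simp only:)
  then show "inner_X0 K \<Omega> w w \<le> R" using R by (simp add: ennreal_le_iff)
qed

end

section \<open>Eigenfunction expansions\<close>

locale eigen_expansion = nonlocal_space K \<Omega> for K :: "real^'n \<Rightarrow> real" and \<Omega> +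
  fixes ev :: "nat \<Rightarrow> real" and \<phi> :: "nat \<Rightarrow> real^'n \<Rightarrow> real"
  assumes bounded_\<Omega>: "bounded \<Omega>" and eigen: "eigensystem K \<Omega> ev \<phi>"
begin

lemma \<phi>_X0: "\<phi> (Suc i) \<in> space_X0 K \<Omega>"
  using eigen by (simp add: eigensystem_def weak_solution_def)

sublocale orthonormal_system "lebesgue_on \<Omega>" "\<lambda>i. \<phi> (Suc i)"
proof -
  have "\<Omega> \<in> lmeasurable"
    using bounded_\<Omega> open_\<Omega> by (simp add: lmeasurable_open)
  then interpret finite_measure "lebesgue_on \<Omega>" by (rule finite_measure_lebesgue_on)
  show "orthonormal_system (lebesgue_on \<Omega>) (\<lambda>i. \<phi> (Suc i))"
  proof
    show "sq_integrable (lebesgue_on \<Omega>) (\<phi> (Suc i))" for i by (rule X0_sq[OF \<phi>_X0])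
    show "(\<integral>x. \<phi> (Suc i) x * \<phi> (Suc j) x \<partial>lebesgue_on \<Omega>) = (if i = j then 1 else 0)" for i j
      using eigen by (simp add: eigensystem_def inner_L2_eq)
  qed
qed

lemma ev_mono: "mono (\<lambda>i. ev (Suc i))"
proof (rule mono_iff_le_Suc[THEN iffD2], rule allI)
  fix i
  show "ev (Suc i) \<le> ev (Suc (Suc i))"
    using eigen by (cases i) (auto simp: eigensystem_def numeral_2_eq_2)
qed

lemma ev_pos: "0 < ev (Suc i)"
proof -
  have "0 < ev (Suc 0)" using eigen by (simp add: eigensystem_def)
  also have "\<dots> \<le> ev (Suc i)" using monoD[OF ev_mono, of 0 i] by simp
  finally show ?thesis .
qed

lemma comb_X0: "comb n c \<in> space_X0 K \<Omega>"
  unfolding comb_def[abs_def] by (intro X0_sum \<phi>_X0)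

lemma inner_X0_\<phi>:
  assumes "v \<in> space_X0 K \<Omega>"
  shows "inner_X0 K \<Omega> (\<phi> (Suc i)) v = ev (Suc i) * (\<integral>x. v x * \<phi> (Suc i) x \<partial>lebesgue_on \<Omega>)"
proof -
  have "weak_solution K \<Omega> (\<lambda>x. ev (Suc i) * \<phi> (Suc i) x) (\<phi> (Suc i))"
    using eigen by (simp add: eigensystem_def)
  then have "inner_X0 K \<Omega> (\<phi> (Suc i)) v = (\<integral>x. ev (Suc i) * \<phi> (Suc i) x * v x \<partial>lebesgue_on \<Omega>)"
    using assms by (simp add: weak_solution_def integral_\<Omega>_eq)
  also have "\<dots> = (\<integral>x. ev (Suc i) * (v x * \<phi> (Suc i) x) \<partial>lebesgue_on \<Omega>)"
    by (simp only: mult.assoc mult.commute[of "\<phi> (Suc i) _"])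
  finally show ?thesis by simp
qed

lemma inner_X0_comb:
  assumes "v \<in> space_X0 K \<Omega>"
  shows "inner_X0 K \<Omega> (comb n c) v = (\<Sum>i<n. ev (Suc i) * c i * (\<integral>x. v x * \<phi> (Suc i) x \<partial>lebesgue_on \<Omega>))"
  unfolding comb_def[abs_def] inner_X0_sum[OF \<phi>_X0 assms] inner_X0_\<phi>[OF assms]
  by (simp add: mult.assoc mult.left_commute)

lemma inner_X0_comb_comb: "inner_X0 K \<Omega> (comb n c) (comb n d) = (\<Sum>i<n. ev (Suc i) * c i * d i)"
  unfolding inner_X0_comb[OF comb_X0] integral_comb_e by simp

lemma eigen_sum_eq_comb: "(\<lambda>x. \<Sum>i=1..m. c i * \<phi> i x) = comb m (\<lambda>i. c (Suc i))"
  by (simp add: comb_def fun_eq_iff sum.atLeast1_atMost_eq)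

lemma L2_approximation:
  assumes "sq_integrable (lebesgue_on \<Omega>) w" "0 < \<epsilon>"
  obtains m c where "(\<integral>x. (w x - comb m c x)\<^sup>2 \<partial>lebesgue_on \<Omega>) < \<epsilon>"
proof -
  have total: "total_in {w. L2_on \<Omega> w} (norm_L2 \<Omega>) \<phi>" using eigen by (simp add: eigensystem_def)
  have "\<forall>\<epsilon>>0. \<exists>m c. norm_L2 \<Omega> (\<lambda>x. w x - (\<Sum>i=1..m. c i * \<phi> i x)) < \<epsilon>"
    by (rule bspec[OF total[unfolded total_in_def]]) (simp add: L2_on_iff assms)
  then obtain m c where "norm_L2 \<Omega> (\<lambda>x. w x - (\<Sum>i=1..m. c i * \<phi> i x)) < sqrt \<epsilon>"
    using assms(2) real_sqrt_gt_zero by blast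
  then have "norm_L2 \<Omega> (\<lambda>x. w x - comb m (\<lambda>i. c (Suc i)) x) < sqrt \<epsilon>"
    using fun_cong[OF eigen_sum_eq_comb[of c m]] by simp
  then show thesis
    by (intro that[of m "\<lambda>i. c (Suc i)"]) (simp add: norm_L2_def inner_L2_eq power2_eq_square)
qed

lemma X0_approximation:
  assumes "w \<in> space_X0 K \<Omega>" "0 < \<epsilon>"
  obtains m c where "norm_X0 K \<Omega> (\<lambda>x. w x - comb m c x) < \<epsilon>"
proof -
  have total: "total_in (space_X0 K \<Omega>) (norm_X0 K \<Omega>) \<phi>" using eigen by (simp add: eigensystem_def)
  have "\<forall>\<epsilon>>0. \<exists>m c. norm_X0 K \<Omega> (\<lambda>x. w x - (\<Sum>i=1..m. c i * \<phi> i x)) < \<epsilon>"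
    by (rule bspec[OF total[unfolded total_in_def] assms(1)])
  then obtain m c where "norm_X0 K \<Omega> (\<lambda>x. w x - (\<Sum>i=1..m. c i * \<phi> i x)) < \<epsilon>"
    using assms(2) by blast
  then show thesis
    using fun_cong[OF eigen_sum_eq_comb[of c m]] by (intro that[of m "\<lambda>i. c (Suc i)"]) simp
qed

text \<open>
  Both sides are compared with the Fourier coefficients \<open>a\<^sub>i\<close> of \<open>w\<close>: totality gives Parseval's identity
  \<open>\<parallel>w\<parallel>\<^sup>2 = \<Sum> a\<^sub>i\<^sup>2\<close> in \<open>L\<^sup>2\<close> up to \<open>\<epsilon>\<close>, and Bessel's inequality in \<open>X\<^sub>0\<close> gives \<open>\<Sum> \<lambda>\<^sub>i a\<^sub>i\<^sup>2 \<le> \<parallel>w\<parallel>\<^sup>2\<close>.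
\<close>

lemma poincare:
  assumes w: "w \<in> space_X0 K \<Omega>"
  shows "(\<integral>x. (w x)\<^sup>2 \<partial>lebesgue_on \<Omega>) \<le> inner_X0 K \<Omega> w w / ev 1"
proof (rule field_le_epsilon)
  fix \<epsilon> :: real assume "0 < \<epsilon>"
  note wsq = X0_sq[OF w]
  obtain m c where m: "(\<integral>x. (w x - comb m c x)\<^sup>2 \<partial>lebesgue_on \<Omega>) < \<epsilon>"
    using L2_approximation[OF wsq \<open>0 < \<epsilon>\<close>] .
  define a where "a i = (\<integral>x. w x * \<phi> (Suc i) x \<partial>lebesgue_on \<Omega>)" for i
  have "(\<integral>x. (w x - comb m c x)\<^sup>2 \<partial>lebesgue_on \<Omega>)
      = (\<integral>x. (w x)\<^sup>2 \<partial>lebesgue_on \<Omega>) - 2 * (\<Sum>i<m. a i * c i) + (\<Sum>i<m. (c i)\<^sup>2)"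
  proof -
    have "(\<integral>x. (w x - comb m c x)\<^sup>2 \<partial>lebesgue_on \<Omega>)
      = (\<integral>x. (w x)\<^sup>2 - 2 * (w x * comb m c x) + (comb m c x)\<^sup>2 \<partial>lebesgue_on \<Omega>)"
      by (simp add: power2_eq_square algebra_simps)
    then show ?thesis
      using sq_integrable_square[OF wsq] sq_integrable_square[OF comb_sq] sq_integrable_mult[OF wsq comb_sq]
      by (simp add: integral_comb_sq integral_comb[OF wsq] a_def)
  qed
  also have "\<dots> = (\<integral>x. (w x)\<^sup>2 \<partial>lebesgue_on \<Omega>) - (\<Sum>i<m. (a i)\<^sup>2) + (\<Sum>i<m. (a i - c i)\<^sup>2)"
    by (simp add: power2_diff sum.distrib sum_subtractf sum_distrib_left mult.assoc)
  finally have "(\<integral>x. (w x)\<^sup>2 \<partial>lebesgue_on \<Omega>) \<le> (\<Sum>i<m. (a i)\<^sup>2) + \<epsilon>"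
    using m sum_nonneg[of "{..<m}" "\<lambda>i. (a i - c i)\<^sup>2"] by simp
  also have "(\<Sum>i<m. (a i)\<^sup>2) \<le> inner_X0 K \<Omega> w w / ev 1"
  proof -
    have bw: "inner_X0 K \<Omega> (comb m a) w = (\<Sum>i<m. ev (Suc i) * (a i)\<^sup>2)"
      unfolding inner_X0_comb[OF w] by (simp add: a_def power2_eq_square mult.assoc)
    define d where "d = (\<lambda>x. w x - comb m a x)"
    have d: "d \<in> space_X0 K \<Omega>" unfolding d_def by (rule X0_diff[OF w comb_X0])
    have "0 \<le> inner_X0 K \<Omega> d d" by (rule inner_X0_nonneg)
    also have "\<dots> = inner_X0 K \<Omega> w d - inner_X0 K \<Omega> (comb m a) d"
      using inner_X0_diff[OF w comb_X0[of m a] d] unfolding d_def[symmetric]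
      by (simp add: inner_X0_commute[of d w] inner_X0_commute[of d "comb m a"])
    also have "\<dots> = inner_X0 K \<Omega> w w - inner_X0 K \<Omega> w (comb m a)
        - (inner_X0 K \<Omega> (comb m a) w - inner_X0 K \<Omega> (comb m a) (comb m a))"
      unfolding d_def inner_X0_diff[OF w comb_X0 w] inner_X0_diff[OF w comb_X0 comb_X0] ..
    also have "\<dots> = inner_X0 K \<Omega> w w - 2 * inner_X0 K \<Omega> (comb m a) w + inner_X0 K \<Omega> (comb m a) (comb m a)"
      using inner_X0_commute[of w "comb m a"] by simp
    also have "inner_X0 K \<Omega> (comb m a) (comb m a) = (\<Sum>i<m. ev (Suc i) * (a i)\<^sup>2)"
      unfolding inner_X0_comb_comb by (simp add: power2_eq_square mult.assoc)
    finally have "(\<Sum>i<m. ev (Suc i) * (a i)\<^sup>2) \<le> inner_X0 K \<Omega> w w"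
      unfolding bw by simp
    moreover have "ev 1 * (\<Sum>i<m. (a i)\<^sup>2) \<le> (\<Sum>i<m. ev (Suc i) * (a i)\<^sup>2)"
      unfolding sum_distrib_left using monoD[OF ev_mono, of 0] by (intro sum_mono mult_right_mono) auto
    ultimately show ?thesis
      using ev_pos[of 0] by (simp add: pos_le_divide_eq mult.commute)
  qed
  finally show "(\<integral>x. (w x)\<^sup>2 \<partial>lebesgue_on \<Omega>) \<le> inner_X0 K \<Omega> w w / ev 1 + \<epsilon>" by simp
qed

text \<open>
  The defect \<open>D\<close> of the weak equation is a linear functional vanishing on all finite combinations of eigenfunctions. It is
  continuous in the norm of \<open>X\<^sub>0\<close>, for the term with \<open>g\<close> by the Poincare inequality, and the combinations are dense.
\<close>

lemma weak_solution_from_coefficients: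
  assumes u: "u \<in> space_X0 K \<Omega>" and g: "sq_integrable (lebesgue_on \<Omega>) g"
    and coeff: "\<And>j. ev (Suc j) * (\<integral>x. u x * \<phi> (Suc j) x \<partial>lebesgue_on \<Omega>) = (\<integral>x. g x * \<phi> (Suc j) x \<partial>lebesgue_on \<Omega>)"
  shows "weak_solution K \<Omega> g u"
  unfolding weak_solution_def integral_\<Omega>_eq
proof (intro conjI u ballI)
  fix v assume v: "v \<in> space_X0 K \<Omega>"
  define D where "D w = inner_X0 K \<Omega> u w - (\<integral>x. g x * w x \<partial>lebesgue_on \<Omega>)" for w
  have D_comb: "D (comb m c) = 0" for m c
    unfolding D_def integral_comb[OF g] inner_X0_commute[of u] inner_X0_comb[OF u]
    unfolding coeff[symmetric] by (simp add: algebra_simps)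
  define C where "C = norm_X0 K \<Omega> u + sqrt (\<integral>x. (g x)\<^sup>2 \<partial>lebesgue_on \<Omega>) / sqrt (ev 1)"
  have D_bound: "\<bar>D w\<bar> \<le> C * norm_X0 K \<Omega> w" if w: "w \<in> space_X0 K \<Omega>" for w
  proof -
    have "\<bar>\<integral>x. g x * w x \<partial>lebesgue_on \<Omega>\<bar> \<le> sqrt (\<integral>x. (g x)\<^sup>2 \<partial>lebesgue_on \<Omega>) * sqrt (\<integral>x. (w x)\<^sup>2 \<partial>lebesgue_on \<Omega>)"
      by (rule L2_Cauchy_Schwarz_abs[OF g X0_sq[OF w]])
    also have "\<dots> \<le> sqrt (\<integral>x. (g x)\<^sup>2 \<partial>lebesgue_on \<Omega>) * (norm_X0 K \<Omega> w / sqrt (ev 1))"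
      using real_sqrt_le_mono[OF poincare[OF w]]
      by (intro mult_left_mono) (simp_all add: norm_X0_def real_sqrt_divide)
    finally show ?thesis
      using inner_X0_Cauchy_Schwarz[OF u w] by (simp add: D_def C_def algebra_simps)
  qed
  have C: "0 \<le> C" using ev_pos[of 0] by (simp add: C_def norm_X0_def inner_X0_nonneg)
  have "\<bar>D v\<bar> \<le> 0 + \<epsilon>" if "0 < \<epsilon>" for \<epsilon>
  proof -
    have "0 < \<epsilon> / (C + 1)" using that C by simp
    then obtain m c where mc: "norm_X0 K \<Omega> (\<lambda>x. v x - comb m c x) < \<epsilon> / (C + 1)"
      by (rule X0_approximation[OF v])
    have "D (\<lambda>x. v x - comb m c x) = D v - D (comb m c)"
      using sq_integrable_mult[OF g X0_sq[OF v]] sq_integrable_mult[OF g comb_sq]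
      by (simp add: D_def inner_X0_diff[OF v comb_X0 u] right_diff_distrib)
    then have "\<bar>D v\<bar> = \<bar>D (\<lambda>x. v x - comb m c x)\<bar>" by (simp add: D_comb)
    also have "\<dots> \<le> C * norm_X0 K \<Omega> (\<lambda>x. v x - comb m c x)"
      by (rule D_bound[OF X0_diff[OF v comb_X0]])
    also have "\<dots> \<le> C * (\<epsilon> / (C + 1))" using mc C by (intro mult_left_mono) auto
    also have "\<dots> \<le> \<epsilon>" using C that by (simp add: field_simps)
    finally show ?thesis by simp
  qed
  then have "\<bar>D v\<bar> \<le> 0" by (rule field_le_epsilon)
  then show "inner_X0 K \<Omega> u v = (\<integral>x. g x * v x \<partial>lebesgue_on \<Omega>)" by (simp add: D_def)
qed

section \<open>Unboundedness of the eigenvalues\<close>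

text \<open>
  If the eigenvalues were bounded by \<open>\<Lambda>\<close>, the energy of a finite combination would be at most \<open>\<Lambda>\<close> times its squared \<open>L\<^sup>2\<close> norm;
  by closedness the whole of \<open>L\<^sup>2\<close> would then consist of functions of finite energy. The constant \<open>4\<close> leaves
  room for approximations whose squared error is at most the squared norm of \<open>w\<close>.
\<close>

lemma bounded_eigenvalues_X0:
  assumes \<Lambda>: "\<And>i. ev (Suc i) \<le> \<Lambda>"
    and w: "w \<in> borel_measurable lebesgue" "sq_integrable (lebesgue_on \<Omega>) w" "\<And>x. x \<notin> \<Omega> \<Longrightarrow> w x = 0"
    and W: "0 < (\<integral>x. (w x)\<^sup>2 \<partial>lebesgue_on \<Omega>)"
  shows "w \<in> space_X0 K \<Omega>" "inner_X0 K \<Omega> w w \<le> 4 * \<Lambda> * (\<integral>x. (w x)\<^sup>2 \<partial>lebesgue_on \<Omega>)"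
proof -
  let ?M = "lebesgue_on \<Omega>"
  define W where "W = (\<integral>x. (w x)\<^sup>2 \<partial>?M)"
  have W0: "0 < W" using W by (simp add: W_def)
  have \<Lambda>0: "0 \<le> \<Lambda>" using ev_pos[of 0] \<Lambda>[of 0] by simp
  have "\<exists>p. (\<exists>n c. p = comb n c) \<and> (\<integral>x. (w x - p x)\<^sup>2 \<partial>?M) < min W (1 / Suc m)" for m
  proof -
    have "0 < min W (1 / Suc m)" using W0 by simp
    then obtain n c where "(\<integral>x. (w x - comb n c x)\<^sup>2 \<partial>?M) < min W (1 / Suc m)"
      by (rule L2_approximation[OF w(2)])
    then show ?thesis by blast
  qed
  then have "\<exists>p. \<forall>m. (\<exists>n c. p m = comb n c) \<and> (\<integral>x. (w x - p m x)\<^sup>2 \<partial>?M) < min W (1 / Suc m)"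
    by (intro choice allI)
  then obtain p where p: "\<forall>m. (\<exists>n c. p m = comb n c) \<and> (\<integral>x. (w x - p m x)\<^sup>2 \<partial>?M) < min W (1 / Suc m)"
    by (rule exE)
  have comb: "\<exists>n c. p m = comb n c" and close: "(\<integral>x. (w x - p m x)\<^sup>2 \<partial>?M) < min W (1 / Suc m)" for m
    using p by auto
  have psq: "sq_integrable ?M (p m)" for m using comb[of m] comb_sq by metis
  have int: "integrable ?M (\<lambda>x. (w x - p m x)\<^sup>2)" for m
    by (rule sq_integrable_square[OF sq_integrable_diff[OF w(2) psq]])
  have "(\<lambda>m. \<integral>x. (w x - p m x)\<^sup>2 \<partial>?M) \<longlonglongrightarrow> 0"
  proof (rule tendsto_sandwich[OF _ _ tendsto_const LIMSEQ_inverse_real_of_nat])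
    show "\<forall>\<^sub>F m in sequentially. (\<integral>x. (w x - p m x)\<^sup>2 \<partial>?M) \<le> inverse (real (Suc m))"
      using close by (intro always_eventually allI) (force simp: inverse_eq_divide intro: less_imp_le)
  qed simp
  then have "(\<lambda>m. \<integral>x. norm ((w x - p m x)\<^sup>2) \<partial>?M) \<longlonglongrightarrow> 0" by simp
  from tendsto_L1_AE_subseq[OF int this]
  obtain r :: "nat \<Rightarrow> nat" where r: "strict_mono r" "AE x in ?M. (\<lambda>m. (w x - p (r m) x)\<^sup>2) \<longlonglongrightarrow> 0"
    by blast
  have lim: "AE x in ?M. (\<lambda>m. p (r m) x) \<longlonglongrightarrow> w x"
    using r(2)
  proof eventually_elim
    case (elim x)
    then have "(\<lambda>m. sqrt ((w x - p (r m) x)\<^sup>2)) \<longlonglongrightarrow> sqrt 0" by (rule tendsto_real_sqrt)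
    then have "(\<lambda>m. \<bar>p (r m) x - w x\<bar>) \<longlonglongrightarrow> 0" by (simp add: abs_minus_commute)
    then show ?case by (rule LIM_zero_cancel[OF tendsto_rabs_zero_cancel])
  qed
  have bound: "inner_X0 K \<Omega> (p m) (p m) \<le> 4 * \<Lambda> * W" for m
  proof -
    obtain n c where nc: "p m = comb n c" using comb by blast
    have "(\<integral>x. (p m x)\<^sup>2 \<partial>?M) \<le> (\<integral>x. 2 * (w x)\<^sup>2 + 2 * (w x - p m x)\<^sup>2 \<partial>?M)"
    proof (rule integral_mono)
      fix x
      have "0 \<le> (2 * w x - p m x)\<^sup>2" by simp
      then show "(p m x)\<^sup>2 \<le> 2 * (w x)\<^sup>2 + 2 * (w x - p m x)\<^sup>2"
        by (simp add: power2_diff power_mult_distrib)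
    qed (use int sq_integrable_square[OF w(2)] sq_integrable_square[OF psq] in auto)
    also have "\<dots> = 2 * W + 2 * (\<integral>x. (w x - p m x)\<^sup>2 \<partial>?M)"
      using int sq_integrable_square[OF w(2)] by (simp add: W_def)
    also have "\<dots> \<le> 4 * W" using close[of m] by simp
    finally have p2: "(\<integral>x. (p m x)\<^sup>2 \<partial>?M) \<le> 4 * W" .
    have "inner_X0 K \<Omega> (p m) (p m) = (\<Sum>i<n. ev (Suc i) * (c i)\<^sup>2)"
      unfolding nc inner_X0_comb_comb by (simp add: power2_eq_square mult.assoc)
    also have "\<dots> \<le> \<Lambda> * (\<Sum>i<n. (c i)\<^sup>2)"
      unfolding sum_distrib_left using \<Lambda> by (intro sum_mono mult_right_mono) auto
    also have "\<dots> = \<Lambda> * (\<integral>x. (p m x)\<^sup>2 \<partial>?M)" unfolding nc integral_comb_sq ..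
    also have "\<dots> \<le> \<Lambda> * (4 * W)" by (rule mult_left_mono[OF p2 \<Lambda>0])
    finally show ?thesis by simp
  qed
  have pX0: "p m \<in> space_X0 K \<Omega>" for m using comb[of m] comb_X0 by metis
  show "w \<in> space_X0 K \<Omega>" "inner_X0 K \<Omega> w w \<le> 4 * \<Lambda> * (\<integral>x. (w x)\<^sup>2 \<partial>?M)"
    using X0_closed[of "\<lambda>m. p (r m)", OF pX0 bound lim w] by (simp_all add: W_def)
qed

text \<open>
  Apply \<open>bounded_eigenvalues_X0\<close> to the indicator function of a ball \<open>A\<close> of radius \<open>r\<close>. Pairs in \<open>A \<times> B\<close>, for a disjoint ball \<open>B\<close> of the
  same radius at distance \<open>3 r\<close> between the centres, have distance at most \<open>5 r\<close>, so they alone contribute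
  \<open>c\<^sub>0 (5 r)\<^sup>-\<^sup>n\<^sup>-\<^sup>2\<^sup>s \<bar>A\<bar> \<bar>B\<bar>\<close>, which is a constant times \<open>r\<^sup>-\<^sup>2\<^sup>s \<bar>A\<bar>\<close>. This exceeds \<open>4 \<Lambda> \<bar>A\<bar>\<close> for small \<open>r\<close>.
\<close>

lemma eigenvalues_unbounded:
  assumes ne: "\<Omega> \<noteq> {}" and s: "0 < s" and c0: "0 < c0"
    and K_lower: "\<And>x. x \<noteq> 0 \<Longrightarrow> c0 * norm x powr (- (real CARD('n) + 2 * s)) \<le> K x"
  shows "filterlim (\<lambda>i. ev (Suc i)) at_top sequentially"
proof (rule ccontr)
  assume "\<not> ?thesis"
  then obtain \<Lambda> where \<Lambda>: "\<not> (\<forall>\<^sub>F i in sequentially. \<Lambda> \<le> ev (Suc i))"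
    by (auto simp: filterlim_at_top)
  have bdd: "ev (Suc i) \<le> \<Lambda>" for i
  proof (rule ccontr)
    assume "\<not> ev (Suc i) \<le> \<Lambda>"
    then have "\<forall>j\<ge>i. \<Lambda> \<le> ev (Suc j)" using monoD[OF ev_mono, of i] by force
    with \<Lambda> show False by (auto simp: eventually_sequentially)
  qed
  have \<Lambda>0: "0 < \<Lambda>" using ev_pos[of 0] bdd[of 0] by simp
  define t where "t = real CARD('n) + 2 * s"
  define \<omega> where "\<omega> = measure lborel (ball (0::real^'n) 1)"
  define C where "C = c0 * 5 powr (- t) * \<omega>"
  have \<omega>: "0 < \<omega>" unfolding \<omega>_def by (rule content_ball_pos) simp
  have C: "0 < C" using c0 \<omega> by (simp add: C_def)
  obtain p \<delta> where p: "0 < \<delta>" "ball p \<delta> \<subseteq> \<Omega>"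
    using ne open_\<Omega> by (meson ex_in_conv open_contains_ball)
  \<comment> \<open>The energy of the indicator is at least \<open>C r\<^sup>-\<^sup>2\<^sup>s \<bar>A\<bar>\<close>; the radius makes \<open>r\<^sup>-\<^sup>2\<^sup>s\<close> at least \<open>Y\<close>, and \<open>C Y > 4 \<Lambda>\<close>.\<close>
  define Y where "Y = 4 * \<Lambda> / C + 1"
  have Y: "0 < Y" using \<Lambda>0 C by (simp add: Y_def add_pos_pos)
  define r where "r = min \<delta> (Y powr (- 1 / (2 * s)))"
  have r: "0 < r" using p Y by (simp add: r_def)
  have rY: "Y \<le> r powr (- 2 * s)"
  proof -
    have "Y = (Y powr (- 1 / (2 * s))) powr (- 2 * s)" using Y s by (simp add: powr_powr)
    also have "\<dots> \<le> r powr (- 2 * s)" using r s by (intro powr_mono2') (auto simp: r_def)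
    finally show ?thesis .
  qed
  obtain b :: "real^'n" where b: "norm b = 1" using vector_choose_size[of 1] by auto
  define q where "q = p + (3 * r) *\<^sub>R b"
  define A where "A = ball p r"
  define B where "B = ball q r"
  have pq: "dist p q = 3 * r" using b r by (simp add: q_def dist_norm)
  have A\<Omega>: "A \<subseteq> \<Omega>" using p by (auto simp: A_def r_def)
  have AB: "x \<notin> B" "x \<noteq> y" "norm (x - y) \<le> 5 * r" "y \<notin> A" if "x \<in> A" "y \<in> B" for x y
  proof -
    have d: "dist p x < r" "dist q y < r" using that by (auto simp: A_def B_def)
    have *: "z \<notin> B" if "dist p z < r" for z
      using dist_triangle[of p q z] that pq r by (auto simp: B_def dist_commute)
    show "x \<notin> B" using *[OF d(1)] .
    with that show "x \<noteq> y" by auto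
    show "y \<notin> A" using * that by (auto simp: A_def)
    have "dist x y \<le> dist x p + (dist p q + dist q y)"
      using dist_triangle[of x y p] dist_triangle[of p y q] by linarith
    then show "norm (x - y) \<le> 5 * r" using d pq by (simp add: dist_norm[symmetric] dist_commute)
  qed
  define w :: "real^'n \<Rightarrow> real" where "w = indicator A"
  have Am [measurable]: "A \<in> sets lebesgue" "B \<in> sets lebesgue" by (simp_all add: A_def B_def)
  have w2: "(\<lambda>x. (w x)\<^sup>2) = w" by (auto simp: w_def indicator_def)
  have Aon: "A \<in> sets (lebesgue_on \<Omega>)" using A\<Omega> by (auto simp: sets_restrict_space image_iff)
  have mA: "measure (lebesgue_on \<Omega>) A = measure lborel A"
    using A\<Omega> by (subst measure_restrict_space) (auto simp: A_def)
  have wm: "w \<in> borel_measurable lebesgue" unfolding w_def by measurable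
  have wint: "integrable (lebesgue_on \<Omega>) w"
    unfolding w_def using Aon emeasure_finite[of A] by (intro integrable_real_indicator) (auto simp: less_top[symmetric])
  have wsq: "sq_integrable (lebesgue_on \<Omega>) w"
    unfolding sq_integrable_def w2 using wint by (simp add: borel_measurable_integrable)
  have wI: "(\<integral>x. (w x)\<^sup>2 \<partial>lebesgue_on \<Omega>) = measure lborel A"
    unfolding w2 using Aon A\<Omega> by (simp add: w_def mA Int_absorb1 Int_absorb2 space_restrict_space)
  have cA: "0 < measure lborel A" and cB: "measure lborel B = r powr real CARD('n) * \<omega>"
    using r content_ball_pos[OF r, of p] content_ball_conv_unit_ball[of r q]
    by (simp_all add: A_def B_def \<omega>_def powr_realpow)
  have w_off: "w x = 0" if "x \<notin> \<Omega>" for x using that A\<Omega> by (auto simp: w_def indicator_def)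
  have wX: "w \<in> space_X0 K \<Omega>" "inner_X0 K \<Omega> w w \<le> 4 * \<Lambda> * measure lborel A"
    using bounded_eigenvalues_X0[of \<Lambda> w, unfolded wI, OF bdd wm wsq _ cA] w_off by blast+
  let ?MQ = "lebesgue_on (Q_set \<Omega>)"
  have ABQ: "A \<times> B \<subseteq> Q_set \<Omega>" using A\<Omega> by (auto simp: Q_set_def)
  have ABprod: "emeasure lborel (A \<times> B) = ennreal (measure lborel A * measure lborel B)"
  proof -
    have "emeasure lborel (A \<times> B) = emeasure lborel A * emeasure lborel B"
      unfolding lborel_prod[symmetric] by (rule lborel.emeasure_pair_measure_Times) (simp_all add: A_def B_def)
    also have "\<dots> = ennreal (measure lborel A) * ennreal (measure lborel B)"
      unfolding A_def B_def using emeasure_lborel_ball_finite[of p r] emeasure_lborel_ball_finite[of q r]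
      by (simp add: emeasure_eq_ennreal_measure top.not_eq_extremum)
    finally show ?thesis by (simp add: ennreal_mult)
  qed
  have ABm: "A \<times> B \<in> sets lebesgue"
    by (simp add: A_def B_def open_Times borel_open)
  have ABon: "A \<times> B \<in> sets ?MQ" using ABQ ABm by (auto simp: sets_restrict_space image_iff)
  have ABem: "emeasure ?MQ (A \<times> B) = ennreal (measure lborel A * measure lborel B)"
    using ABQ ABprod by (subst emeasure_restrict_space) (auto simp: A_def B_def open_Times borel_open)
  have low: "c0 * (5 * r) powr (- t) * (measure lborel A * measure lborel B) \<le> inner_X0 K \<Omega> w w"
  proof -
    have "c0 * (5 * r) powr (- t) * (measure lborel A * measure lborel B)
        = (\<integral>z. c0 * (5 * r) powr (- t) * indicator (A \<times> B) z \<partial>?MQ)"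
      using ABon ABem ABQ by (simp add: measure_def Int_absorb1 Int_absorb2 space_restrict_space)
    also have "\<dots> \<le> (\<integral>z. (increment w z)\<^sup>2 \<partial>?MQ)"
    proof (rule integral_mono)
      show "integrable ?MQ (\<lambda>z. c0 * (5 * r) powr (- t) * indicator (A \<times> B) z)"
        using ABon ABem by (intro integrable_mult_right integrable_real_indicator) auto
      show "integrable ?MQ (\<lambda>z. (increment w z)\<^sup>2)"
        by (rule sq_integrable_square[OF X0_increment[OF wX(1)]])
      fix z
      show "c0 * (5 * r) powr (- t) * indicator (A \<times> B) z \<le> (increment w z)\<^sup>2"
      proof (cases "z \<in> A \<times> B")
        case True
        then obtain x y where z: "z = (x, y)" "x \<in> A" "y \<in> B" by blast
        note ab = AB[OF z(2,3)]
        have "c0 * (5 * r) powr (- t) \<le> c0 * norm (x - y) powr (- t)"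
          using ab r c0 s by (intro mult_left_mono powr_mono2') (auto simp: t_def)
        also have "\<dots> \<le> K (x - y)" using K_lower[of "x - y"] ab by (simp add: t_def)
        also have "\<dots> = (increment w z)\<^sup>2"
          using increment_mult[of w x y w] ab z by (simp add: power2_eq_square w_def)
        finally show ?thesis using True by simp
      qed simp
    qed
    finally show ?thesis by (simp add: inner_X0_eq power2_eq_square)
  qed
  have "c0 * (5 * r) powr (- t) * measure lborel B * measure lborel A \<le> 4 * \<Lambda> * measure lborel A"
    using low wX(2) by (simp add: algebra_simps)
  then have "c0 * (5 * r) powr (- t) * measure lborel B \<le> 4 * \<Lambda>"
    using cA by simp
  moreover have "c0 * (5 * r) powr (- t) * measure lborel B = C * r powr (- 2 * s)"
  proof -
    have "(5 * r) powr (- t) * r powr real CARD('n) = 5 powr (- t) * r powr (- 2 * s)"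
      using r by (simp add: powr_mult t_def mult.assoc flip: powr_add)
    then show ?thesis unfolding cB C_def by (simp add: mult.assoc mult.left_commute mult.commute)
  qed
  ultimately have "C * Y \<le> 4 * \<Lambda>"
    using mult_left_mono[OF rY, of C] C by linarith
  then show False using C by (simp add: Y_def distrib_left)
qed

section \<open>Solvability below the threshold\<close>

lemma J_fun_comb:
  "J_fun K \<Omega> \<alpha> q (comb n c) = (\<Sum>i<n. ev (Suc i) * (c i)\<^sup>2) / 2
    - (\<integral>x. jumping_primitive \<alpha> q (comb n c x) \<partial>lebesgue_on \<Omega>)"
proof -
  have neg: "sq_integrable (lebesgue_on \<Omega>) (\<lambda>x. neg_part (comb n c x))"
    by (rule sq_integrable_neg_part[OF comb_sq])
  have pos: "sq_integrable (lebesgue_on \<Omega>) (\<lambda>x. pos_part (comb n c x))"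
    using sq_integrable_neg_part[OF sq_integrable_uminus[OF comb_sq[of n c]]] by (simp add: neg_part_def pos_part_def)
  have "(norm_X0 K \<Omega> (comb n c))\<^sup>2 = (\<Sum>i<n. ev (Suc i) * (c i)\<^sup>2)"
    unfolding norm_X0_sq inner_X0_comb_comb by (simp add: power2_eq_square mult.assoc)
  then show ?thesis
    using sq_integrable_square[OF neg] sq_integrable_square[OF pos]
    by (simp add: J_fun_def integral_\<Omega>_eq jumping_primitive_def add_divide_distrib diff_divide_distrib)
qed

lemma X1_eq: "X1 \<phi> k = range (comb k)"
proof -
  have "u \<in> X1 \<phi> k \<longleftrightarrow> (\<exists>c. u = comb k (\<lambda>i. c (Suc i)))" for u
    unfolding X1_def by (simp only: eigen_sum_eq_comb mem_Collect_eq)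
  moreover have "(\<exists>c. u = comb k (\<lambda>i. c (Suc i))) \<longleftrightarrow> (\<exists>c. u = comb k c)" for u
  proof
    assume "\<exists>c. u = comb k c"
    then obtain c where "u = comb k c" by blast
    then show "\<exists>c. u = comb k (\<lambda>i. c (Suc i))"
      by (intro exI[of _ "\<lambda>j. c (j - 1)"]) simp
  qed auto
  ultimately show ?thesis by auto
qed

lemma comb_truncate:
  assumes "k \<le> n" "\<And>i. k \<le> i \<Longrightarrow> c i = 0"
  shows "comb n c = comb k c"
  unfolding comb_def using assms by (intro ext sum.mono_neutral_right) auto

text \<open>
  The threshold condition concerns \<open>v\<close> of unit \<open>L\<^sup>2\<close> norm. Homogeneity of the energy extends it to
  all nonzero combinations of high modes, and over \<open>0\<close> the maximum is \<open>0\<close> by concavity.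
\<close>

lemma saddle_problem_of_threshold:
  assumes k: "1 \<le> k" and \<alpha>: "ev k < \<alpha>" "\<alpha> < ev (Suc k)"
    and b: "is_beta_threshold K \<Omega> \<phi> k \<alpha> b" and \<beta>: "\<alpha> \<le> \<beta>" "\<beta> < b"
  shows "saddle_problem (lebesgue_on \<Omega>) (\<lambda>i. \<phi> (Suc i)) (\<lambda>i. ev (Suc i)) k \<alpha> b (\<alpha> - ev k) (ev (Suc k) - \<alpha>) \<beta>"
proof -
  obtain k' where k': "k = Suc k'" using k by (cases k) auto
  interpret saddle_gap "lebesgue_on \<Omega>" "\<lambda>i. \<phi> (Suc i)" "\<lambda>i. ev (Suc i)" k \<alpha> b "\<alpha> - ev k" "ev (Suc k) - \<alpha>"
  proof
    show "0 < k" using k by simp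
    show "0 < \<alpha>" using ev_pos[of k'] k' \<alpha> by simp
    show "\<alpha> \<le> b" using b by (simp add: is_beta_threshold_def)
    show "0 < \<alpha> - ev k" "0 < ev (Suc k) - \<alpha>" using \<alpha> by simp_all
    show "ev (Suc i) \<le> \<alpha> - (\<alpha> - ev k)" if "i < k" for i
      using monoD[OF ev_mono, of i k'] that k' by simp
    show "\<alpha> + (ev (Suc k) - \<alpha>) \<le> ev (Suc i)" if "k \<le> i" for i
      using monoD[OF ev_mono, of k i] that by simp
  qed
  have J_energy: "J_fun K \<Omega> \<alpha> b (comb n c) = energy b n c" for n c
    by (simp add: J_fun_comb energy_def)
  have homogeneous: "energy b n (\<lambda>i. r * c i) = r\<^sup>2 * energy b n c" if "0 \<le> r" for n c r
    using that by (simp add: energy_def comb_cmult jumping_primitive_mult power_mult_distrib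
        sum_distrib_left right_diff_distrib mult.left_commute)
  obtain m where m: "(\<forall>v\<in>X2 K \<Omega> \<phi> k. norm_L2 \<Omega> v = 1 \<longrightarrow>
        is_maximum ((\<lambda>u. J_fun K \<Omega> \<alpha> b (\<lambda>x. u x + v x)) ` X1 \<phi> k) (m v)) \<and>
      is_minimum (m ` {v \<in> X2 K \<Omega> \<phi> k. norm_L2 \<Omega> v = 1}) 0"
    using b[unfolded is_beta_threshold_def minimax_value_def, THEN conjunct2] by (rule exE)
  have max: "is_maximum ((\<lambda>u. J_fun K \<Omega> \<alpha> b (\<lambda>x. u x + v x)) ` X1 \<phi> k) (m v)"
    if "v \<in> X2 K \<Omega> \<phi> k" "norm_L2 \<Omega> v = 1" for v
    using m that by simp
  have min: "is_minimum (m ` {v \<in> X2 K \<Omega> \<phi> k. norm_L2 \<Omega> v = 1}) 0"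
    using m by simp
  have "\<exists>c\<in>Low. 0 \<le> energy b n (\<lambda>i. c i + d i) \<and> (\<forall>c'\<in>Low. energy b n (\<lambda>i. c' i + d i) \<le> energy b n (\<lambda>i. c i + d i))"
    if d: "d \<in> High n" for n d
  proof (cases "\<forall>i. d i = 0")
    case True
    have zero: "energy b n (\<lambda>i. 0) = 0"
      by (simp add: energy_def comb_def jumping_primitive_def pos_part_def neg_part_def)
    have "energy b n c' \<le> 0" if "c' \<in> Low" for c'
    proof -
      have "energy_deriv b n (\<lambda>i. 0) c' = 0"
        by (simp add: energy_deriv_def comb_def jumping_def pos_part_def neg_part_def)
      moreover have "(\<Sum>i<n. ev (Suc i) * (c' i)\<^sup>2) \<le> \<alpha> * (\<Sum>i<n. (c' i)\<^sup>2)"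
        using low_form[OF that, of n] mult_right_mono[of "ev k" \<alpha> "\<Sum>i<n. (c' i)\<^sup>2"] \<alpha>(1)
        by (simp add: sum_nonneg)
      ultimately show ?thesis
        using energy_taylor_upper[OF ab, of n "\<lambda>i. 0" c'] zero by simp
    qed
    with True zero show ?thesis by (intro bexI[of _ "\<lambda>i. 0"]) (auto simp: Low_def)
  next
    case False
    then obtain i0 where i0: "d i0 \<noteq> 0" by blast
    then have i0n: "k \<le> i0" "i0 < n" using d by (auto simp: High_def not_less[symmetric])
    define r where "r = sqrt (\<Sum>i<n. (d i)\<^sup>2)"
    have "0 < (\<Sum>i<n. (d i)\<^sup>2)" using i0 i0n by (intro sum_pos2[of _ i0]) auto
    then have r: "0 < r" by (simp add: r_def)
    define v where "v = comb n (\<lambda>i. d i / r)"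
    have v_norm: "norm_L2 \<Omega> v = 1"
    proof -
      have "inner_L2 \<Omega> v v = (\<Sum>i<n. (d i / r)\<^sup>2)"
        unfolding inner_L2_eq v_def integral_comb_comb by (simp add: power2_eq_square)
      also have "\<dots> = (\<Sum>i<n. (d i)\<^sup>2) / r\<^sup>2" by (simp add: power_divide sum_divide_distrib)
      also have "\<dots> = 1" using \<open>0 < (\<Sum>i<n. (d i)\<^sup>2)\<close> by (simp add: r_def)
      finally show ?thesis by (simp add: norm_L2_def)
    qed
    have v_X2: "v \<in> X2 K \<Omega> \<phi> k"
    proof -
      have "inner_X0 K \<Omega> (comb k c) v = 0" for c
        unfolding v_def inner_X0_comb[OF comb_X0] integral_comb_e
        using d by (intro sum.neutral) (auto simp: High_def)
      then show ?thesis
        unfolding X2_def X1_eq using comb_X0 by (auto simp: v_def)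
    qed
    have "m v \<in> m ` {v \<in> X2 K \<Omega> \<phi> k. norm_L2 \<Omega> v = 1}" using v_X2 v_norm by blast
    then have "0 \<le> m v" using min by (auto simp: is_minimum_def)
    have mv: "is_maximum ((\<lambda>u. J_fun K \<Omega> \<alpha> b (\<lambda>x. u x + v x)) ` range (comb k)) (m v)"
      using max[OF v_X2 v_norm] by (simp add: X1_eq)
    have kn: "k \<le> n" using i0n by simp
    have J_v: "J_fun K \<Omega> \<alpha> b (\<lambda>x. comb k c x + v x) = energy b n (\<lambda>i. c i + d i / r)" if "c \<in> Low" for c
    proof -
      have "comb n c = comb k c" using that by (intro comb_truncate[OF kn]) (simp add: Low_def)
      then have "(\<lambda>x. comb k c x + v x) = comb n (\<lambda>i. c i + d i / r)"
        by (simp add: v_def comb_add fun_eq_iff)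
      then show ?thesis by (simp add: J_energy)
    qed
    have comb_low: "comb k c = comb k (\<lambda>i. if i < k then c i else 0)" for c
      by (simp add: comb_def fun_eq_iff)
    obtain c0 where "m v = J_fun K \<Omega> \<alpha> b (\<lambda>x. comb k c0 x + v x)"
      using mv by (auto simp: is_maximum_def)
    define c where "c = (\<lambda>i. if i < k then c0 i else 0)"
    have c: "c \<in> Low" by (simp add: c_def Low_def)
    have mv_c: "m v = energy b n (\<lambda>i. c i + d i / r)"
      using \<open>m v = _\<close> J_v[OF c] comb_low[of c0] by (simp add: c_def)
    have scale: "energy b n (\<lambda>i. r * x i + d i) = r\<^sup>2 * energy b n (\<lambda>i. x i + d i / r)" for x
      using homogeneous[of r n "\<lambda>i. x i + d i / r"] r by (simp add: distrib_left)
    show ?thesis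
    proof (intro bexI[of _ "\<lambda>i. r * c i"] conjI ballI)
      show "(\<lambda>i. r * c i) \<in> Low" using c by (simp add: Low_def)
      show "0 \<le> energy b n (\<lambda>i. r * c i + d i)"
        unfolding scale mv_c[symmetric] using \<open>0 \<le> m v\<close> by simp
      fix c' assume c': "c' \<in> Low"
      have "energy b n (\<lambda>i. c' i + d i) = r\<^sup>2 * energy b n (\<lambda>i. c' i / r + d i / r)"
        using scale[of "\<lambda>i. c' i / r"] r by simp
      also have "\<dots> \<le> r\<^sup>2 * m v"
      proof (rule mult_left_mono)
        have low: "(\<lambda>i. c' i / r) \<in> Low" using c' by (simp add: Low_def)
        have "J_fun K \<Omega> \<alpha> b (\<lambda>x. comb k (\<lambda>i. c' i / r) x + v x) \<le> m v"
          using mv unfolding is_maximum_def by blast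
        then show "energy b n (\<lambda>i. c' i / r + d i / r) \<le> m v" unfolding J_v[OF low] .
      qed simp
      finally show "energy b n (\<lambda>i. c' i + d i) \<le> energy b n (\<lambda>i. r * c i + d i)"
        unfolding scale mv_c .
    qed
  qed
  then show ?thesis
    by unfold_locales (use \<beta> in auto)
qed

end

theorem theorem1p1:
  fixes s :: real
    and \<Omega> :: "(real^'n) set"
    and K :: "real^'n \<Rightarrow> real"
    and ev :: "nat \<Rightarrow> real"
    and \<phi> :: "nat \<Rightarrow> real^'n \<Rightarrow> real"
    and k :: nat
    and \<alpha> \<beta> \<beta>\<alpha> :: real
    and f :: "real \<Rightarrow> real"
    and h :: "real^'n \<Rightarrow> real"
  assumes "0 < s" and "s < 1" and "real CARD('n) > 2 * s"
    and "bounded_lipschitz_domain \<Omega>"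
    and "admissible_kernel s K"
    and "eigensystem K \<Omega> ev \<phi>"
    and "k \<ge> 1" and "ev k < ev (Suc k)"
    and "ev k < \<alpha>" and "\<alpha> < ev (Suc k)"
    and "is_beta_threshold K \<Omega> \<phi> k \<alpha> \<beta>\<alpha>"
    and "\<alpha> \<le> \<beta>" and "\<beta> < \<beta>\<alpha>"
    and "bounded (range f)" and "continuous_on UNIV f"
    and "L2_on \<Omega> h"
  shows "\<exists>u\<in>space_X0 K \<Omega>.
    weak_solution K \<Omega> (\<lambda>x. \<alpha> * pos_part (u x) - \<beta> * neg_part (u x) + f (u x) + h x) u"
proof -
  have \<Omega>: "\<Omega> \<noteq> {}" "open \<Omega>" "bounded \<Omega>"
    using assms(4) by (simp_all add: bounded_lipschitz_domain_def)
  have K_pos: "\<And>x. x \<noteq> 0 \<Longrightarrow> 0 < K x"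
    using assms(5) by (simp add: admissible_kernel_def)
  obtain c0 where c0: "0 < c0" "\<And>x. x \<noteq> 0 \<Longrightarrow> c0 * norm x powr (- (real CARD('n) + 2 * s)) \<le> K x"
    using assms(5) by (auto simp: admissible_kernel_def)
  interpret eigen_expansion K \<Omega> ev \<phi>
    by unfold_locales (use \<Omega> K_pos assms(6) in \<open>auto intro: less_imp_le\<close>)
  interpret saddle_problem "lebesgue_on \<Omega>" "\<lambda>i. \<phi> (Suc i)" "\<lambda>i. ev (Suc i)" k \<alpha> \<beta>\<alpha> "\<alpha> - ev k" "ev (Suc k) - \<alpha>" \<beta>
    by (rule saddle_problem_of_threshold) (fact assms)+
  obtain B where B: "\<And>t. \<bar>f t\<bar> \<le> B"
    using assms(14) by (auto simp: bounded_iff)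
  have h: "sq_integrable (lebesgue_on \<Omega>) h"
    using assms(16) by (simp add: L2_on_iff)
  obtain v N c R where v: "sq_integrable (lebesgue_on \<Omega>) v"
    and bound: "\<forall>m. (\<Sum>i<N m. ev (Suc i) * (c m i)\<^sup>2) \<le> R"
    and conv: "AE x in lebesgue_on \<Omega>. (\<lambda>m::nat. comb (N m) (c m) x) \<longlonglongrightarrow> v x"
    and eq: "\<forall>j. ev (Suc j) * (\<integral>x. v x * \<phi> (Suc j) x \<partial>lebesgue_on \<Omega>)
      = (\<integral>x. (jumping \<alpha> \<beta> (v x) + f (v x) + h x) * \<phi> (Suc j) x \<partial>lebesgue_on \<Omega>)"
    by (rule limit_solution[OF ev_pos eigenvalues_unbounded[OF \<Omega>(1) assms(1) c0] assms(15) B h])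
  define u where "u x = indicator \<Omega> x *\<^sub>R v x" for x
  have uv: "u x = v x" if "x \<in> space (lebesgue_on \<Omega>)" for x
    using that by (simp add: u_def space_restrict_space)
  have u_lebesgue: "u \<in> borel_measurable lebesgue"
    using sq_integrable_measurable[OF v] unfolding u_def[abs_def] by (simp add: borel_measurable_restrict_space_iff)
  have u_sq: "sq_integrable (lebesgue_on \<Omega>) u"
    by (rule sq_integrable_bound[OF v measurable_restrict_space1[OF u_lebesgue]]) (rule AE_I2, simp add: uv)
  have u_conv: "AE x in lebesgue_on \<Omega>. (\<lambda>m. comb (N m) (c m) x) \<longlonglongrightarrow> u x"
    using conv by (rule AE_mp) (auto simp: uv intro!: AE_I2)
  have u: "u \<in> space_X0 K \<Omega>"
  proof (rule X0_closed(1)[OF comb_X0 _ u_conv u_lebesgue u_sq])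
    show "inner_X0 K \<Omega> (comb (N m) (c m)) (comb (N m) (c m)) \<le> R" for m
      using bound unfolding inner_X0_comb_comb by (simp add: power2_eq_square mult.assoc)
    show "u x = 0" if "x \<notin> \<Omega>" for x using that by (simp add: u_def)
  qed
  let ?g = "\<lambda>x. \<alpha> * pos_part (u x) - \<beta> * neg_part (u x) + f (u x) + h x"
  have g_eq: "?g = (\<lambda>x. jumping \<alpha> \<beta> (u x) + f (u x) + h x)" by (simp add: jumping_def)
  have "sq_integrable (lebesgue_on \<Omega>) (\<lambda>x. f (u x))"
  proof (rule sq_integrable_bound[OF sq_integrable_const[of B]])
    have "f \<in> borel_measurable borel" by (rule borel_measurable_continuous_onI[OF assms(15)])
    then show "(\<lambda>x. f (u x)) \<in> borel_measurable (lebesgue_on \<Omega>)"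
      using measurable_compose[OF sq_integrable_measurable[OF u_sq]] by blast
    have "\<bar>f t\<bar> \<le> \<bar>B\<bar>" for t using B[of t] by linarith
    then show "AE x in lebesgue_on \<Omega>. \<bar>f (u x)\<bar> \<le> \<bar>B\<bar>" by simp
  qed
  then have g: "sq_integrable (lebesgue_on \<Omega>) ?g"
    unfolding g_eq using a_pos \<beta>
    by (intro sq_integrable_add sq_integrable_jumping u_sq h) auto
  have "weak_solution K \<Omega> ?g u"
  proof (rule weak_solution_from_coefficients[OF u g])
    fix j
    have "(\<integral>x. u x * \<phi> (Suc j) x \<partial>lebesgue_on \<Omega>) = (\<integral>x. v x * \<phi> (Suc j) x \<partial>lebesgue_on \<Omega>)"
      by (rule Bochner_Integration.integral_cong) (simp_all add: uv)
    moreover have "(\<integral>x. ?g x * \<phi> (Suc j) x \<partial>lebesgue_on \<Omega>)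
        = (\<integral>x. (jumping \<alpha> \<beta> (v x) + f (v x) + h x) * \<phi> (Suc j) x \<partial>lebesgue_on \<Omega>)"
      by (rule Bochner_Integration.integral_cong) (simp_all add: uv jumping_def)
    ultimately show "ev (Suc j) * (\<integral>x. u x * \<phi> (Suc j) x \<partial>lebesgue_on \<Omega>) = (\<integral>x. ?g x * \<phi> (Suc j) x \<partial>lebesgue_on \<Omega>)"
      using eq by simp
  qed
  with u show ?thesis by blast
qed

end
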